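(* Every nonzero irreducible representation $\rho:\mathfrak{OA}\to\mathfrak{sl}(V)$ on a finite-dimensional complex vector space $V$ is equivalent to $\rho_{({\bf a},{\bf s})}$ for some $n\ge1$, some ${\bf a}=(a_1,\dots,a_n)\in(\mathbb C^* )^n$ with $a_j\neq\pm1$ and $a_j\neq a_k^{\pm1}$ for $j\neq k$, and some ${\bf s}=(s_1,\dots,s_n)$ of positive half-integers. Consequently the irreducible Hermitian representations $\rho:\mathfrak{OA}\to\mathfrak{sl}(V)$ ($V\ne0$ nontrivial action) are, up to equivalence, exactly the $\rho_{({\bf a},{\bf s})}$ with $\hat a_1,\dots,\hat a_n$ pairwise distinct elements of $(-1,1)$ and ${\bf s}$ positive half-integers, and two such, $\rho_{({\bf a},{\bf s})}$ and $\rho_{({\bf a}',{\bf s}')}$, are equivalent if and only if $n=n'$ and $(\hat a'_j,s'_j)=(\hat a_{\sigma(j)},s_{\sigma(j)})$ for some permutation $\sigma$.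
   Context: Work over $\mathbb C$; representations are finite-dimensional. $\mathfrak{sl}_2$ has basis $e,f,h$ with $[e,f]=h$, $[h,e]=2e$, $[h,f]=-2f$. The Onsager algebra is the Lie subalgebra $\mathfrak{OA}=\{p(t)e+p(t^{-1})f+q(t)h:\ p,q\in\mathbb C[t,t^{-1}],\ q(t^{-1})=-q(t)\}$ of the loop algebra $\mathbb C[t,t^{-1}]\otimes\mathfrak{sl}_2$, containing $A_m=2t^me+2t^{-m}f$. For $a\in\mathbb C^*$, $ev_a:\mathfrak{OA}\to\mathfrak{sl}_2$, $p(t)x\mapsto p(a)x$, and $\hat a=(a+a^{-1})/2$. For a positive half-integer $s$, $V(s)$ is the irreducible $(2s+1)$-dimensional representation of $\mathfrak{sl}_2$. For ${\bf a}\in(\mathbb C^* )^n$ and ${\bf s}=(s_1,\dots,s_n)$, $\rho_{({\bf a},{\bf s})}$ is the representation of $\mathfrak{OA}$ on $V(s_1)\otimes\cdots\otimes V(s_n)$ with $\rho_{({\bf a},{\bf s})}(X)=\sum_j1\otimes\cdots\otimes ev_{a_j}(X)\otimes\cdots\otimes1$ ($j$-th slot); its equivalence class depends only on $(\hat a_j)$ and ${\bf s}$. A representation $\rho$ on $V$ is Hermitian if for some Hermitian inner product on $V$ the operators $\rho(A_0),\rho(A_1)$ are Hermitian. *)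

theory Defs
  imports Complex_Main "Jordan_Normal_Form.Matrix"
begin

text \<open>A Laurent polynomial in C[t,t^-1] is represented by its coefficient function
  (coefficient of t^k at index k), with finite support.\<close>

type_synonym lpoly = "int \<Rightarrow> complex"

definition is_lpoly :: "lpoly \<Rightarrow> bool" where
  "is_lpoly p \<longleftrightarrow> finite {k. p k \<noteq> 0}"

definition lmult :: "lpoly \<Rightarrow> lpoly \<Rightarrow> lpoly" where
  "lmult p q = (\<lambda>k. \<Sum>i\<in>{i. p i \<noteq> 0}. p i * q (k - i))"

definition lrev :: "lpoly \<Rightarrow> lpoly" where
  "lrev p = (\<lambda>k. p (- k))"

definition leval :: "lpoly \<Rightarrow> complex \<Rightarrow> complex" where
  "leval p a = (\<Sum>k\<in>{k. p k \<noteq> 0}. p k * a powi k)"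

text \<open>Elements of the loop algebra C[t,t^-1] \<otimes> sl2: an element p e + r f + q h
  is represented by the triple (p, r, q).\<close>
type_synonym loop = "lpoly \<times> lpoly \<times> lpoly"

definition loop_add :: "loop \<Rightarrow> loop \<Rightarrow> loop" where
  "loop_add X Y = (case X of (p1, r1, q1) \<Rightarrow> case Y of (p2, r2, q2) \<Rightarrow>
     (\<lambda>k. p1 k + p2 k, \<lambda>k. r1 k + r2 k, \<lambda>k. q1 k + q2 k))"

definition loop_smult :: "complex \<Rightarrow> loop \<Rightarrow> loop" where
  "loop_smult c X = (case X of (p, r, q) \<Rightarrow> (\<lambda>k. c * p k, \<lambda>k. c * r k, \<lambda>k. c * q k))"

text \<open>Lie bracket of the loop algebra, using [e,f]=h, [h,e]=2e, [h,f]=-2f.\<close>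
definition loop_bracket :: "loop \<Rightarrow> loop \<Rightarrow> loop" where
  "loop_bracket X Y = (case X of (p1, r1, q1) \<Rightarrow> case Y of (p2, r2, q2) \<Rightarrow>
     (\<lambda>k. 2 * (lmult q1 p2 k - lmult p1 q2 k),
      \<lambda>k. 2 * (lmult r1 q2 k - lmult q1 r2 k),
      \<lambda>k. lmult p1 r2 k - lmult r1 p2 k))"

definition OA :: "loop set" where
  "OA = {(p, lrev p, q) | p q. is_lpoly p \<and> is_lpoly q \<and> (\<forall>k. q (- k) = - q k)}"

definition A_elt :: "int \<Rightarrow> loop" where
  "A_elt m = ((\<lambda>k. if k = m then 2 else 0), (\<lambda>k. if k = - m then 2 else 0), (\<lambda>k. 0))"

definition mat_trace :: "complex mat \<Rightarrow> complex" where
  "mat_trace A = (\<Sum>i<dim_row A. A $$ (i, i))"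

definition is_sl_rep :: "nat \<Rightarrow> (loop \<Rightarrow> complex mat) \<Rightarrow> bool" where
  "is_sl_rep d \<rho> \<longleftrightarrow>
     (\<forall>X\<in>OA. \<rho> X \<in> carrier_mat d d \<and> mat_trace (\<rho> X) = 0) \<and>
     (\<forall>X\<in>OA. \<forall>Y\<in>OA. \<rho> (loop_add X Y) = \<rho> X + \<rho> Y) \<and>
     (\<forall>c. \<forall>X\<in>OA. \<rho> (loop_smult c X) = c \<cdot>\<^sub>m \<rho> X) \<and>
     (\<forall>X\<in>OA. \<forall>Y\<in>OA. \<rho> (loop_bracket X Y) = \<rho> X * \<rho> Y - \<rho> Y * \<rho> X)"

definition is_subspace :: "nat \<Rightarrow> complex vec set \<Rightarrow> bool" where
  "is_subspace d W \<longleftrightarrow> W \<subseteq> carrier_vec d \<and> 0\<^sub>v d \<in> W \<and>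
     (\<forall>u\<in>W. \<forall>v\<in>W. u + v \<in> W) \<and> (\<forall>c. \<forall>v\<in>W. c \<cdot>\<^sub>v v \<in> W)"

definition irreducible_rep :: "nat \<Rightarrow> (loop \<Rightarrow> complex mat) \<Rightarrow> bool" where
  "irreducible_rep d \<rho> \<longleftrightarrow> d > 0 \<and>
     (\<forall>W. is_subspace d W \<and> (\<forall>X\<in>OA. \<forall>v\<in>W. \<rho> X *\<^sub>v v \<in> W)
          \<longrightarrow> W = {0\<^sub>v d} \<or> W = carrier_vec d)"

definition nonzero_rep :: "nat \<Rightarrow> (loop \<Rightarrow> complex mat) \<Rightarrow> bool" where
  "nonzero_rep d \<rho> \<longleftrightarrow> (\<exists>X\<in>OA. \<rho> X \<noteq> 0\<^sub>m d d)"

definition equiv_rep :: "nat \<Rightarrow> (loop \<Rightarrow> complex mat) \<Rightarrow> nat \<Rightarrow> (loop \<Rightarrow> complex mat) \<Rightarrow> bool" where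
  "equiv_rep d \<rho> d' \<rho>' \<longleftrightarrow> d = d' \<and>
     (\<exists>P\<in>carrier_mat d d. invertible_mat P \<and> (\<forall>X\<in>OA. P * \<rho> X = \<rho>' X * P))"

definition herm_inner :: "nat \<Rightarrow> (complex vec \<Rightarrow> complex vec \<Rightarrow> complex) \<Rightarrow> bool" where
  "herm_inner d ip \<longleftrightarrow>
     (\<forall>u\<in>carrier_vec d. \<forall>v\<in>carrier_vec d. \<forall>w\<in>carrier_vec d. ip (u + v) w = ip u w + ip v w) \<and>
     (\<forall>c. \<forall>u\<in>carrier_vec d. \<forall>w\<in>carrier_vec d. ip (c \<cdot>\<^sub>v u) w = c * ip u w) \<and>
     (\<forall>u\<in>carrier_vec d. \<forall>v\<in>carrier_vec d. ip u v = cnj (ip v u)) \<and>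
     (\<forall>v\<in>carrier_vec d. v \<noteq> 0\<^sub>v d \<longrightarrow> Re (ip v v) > 0)"

definition self_adjoint_wrt :: "nat \<Rightarrow> (complex vec \<Rightarrow> complex vec \<Rightarrow> complex) \<Rightarrow> complex mat \<Rightarrow> bool" where
  "self_adjoint_wrt d ip A \<longleftrightarrow>
     (\<forall>u\<in>carrier_vec d. \<forall>v\<in>carrier_vec d. ip (A *\<^sub>v u) v = ip u (A *\<^sub>v v))"

definition hermitian_rep :: "nat \<Rightarrow> (loop \<Rightarrow> complex mat) \<Rightarrow> bool" where
  "hermitian_rep d \<rho> \<longleftrightarrow> (\<exists>ip. herm_inner d ip \<and>
      self_adjoint_wrt d ip (\<rho> (A_elt 0)) \<and> self_adjoint_wrt d ip (\<rho> (A_elt 1)))"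

definition pos_half_int :: "real \<Rightarrow> bool" where
  "pos_half_int s \<longleftrightarrow> s > 0 \<and> 2 * s \<in> \<nat>"

definition spin_dim :: "real \<Rightarrow> nat" where
  "spin_dim s = nat \<lfloor>2 * s\<rfloor> + 1"

text \<open>Standard model of the irreducible m-dimensional sl2-module, basis v_0..v_(m-1):
  h v_k = (m-1-2k) v_k, f v_k = v_(k+1), e v_k = k(m-k) v_(k-1).\<close>
definition sl2_E :: "nat \<Rightarrow> complex mat" where
  "sl2_E m = mat m m (\<lambda>(i, j). if j = i + 1 then of_nat (j * (m - j)) else 0)"
definition sl2_F :: "nat \<Rightarrow> complex mat" where
  "sl2_F m = mat m m (\<lambda>(i, j). if i = j + 1 then 1 else 0)"
definition sl2_H :: "nat \<Rightarrow> complex mat" where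
  "sl2_H m = mat m m (\<lambda>(i, j). if i = j then of_int (int m - 1 - 2 * int i) else 0)"

definition ev_rep :: "nat \<Rightarrow> complex \<Rightarrow> loop \<Rightarrow> complex mat" where
  "ev_rep m a X = (case X of (p, r, q) \<Rightarrow>
      leval p a \<cdot>\<^sub>m sl2_E m + leval r a \<cdot>\<^sub>m sl2_F m + leval q a \<cdot>\<^sub>m sl2_H m)"

definition kron :: "complex mat \<Rightarrow> complex mat \<Rightarrow> complex mat" where
  "kron A B = mat (dim_row A * dim_row B) (dim_col A * dim_col B)
     (\<lambda>(i, j). A $$ (i div dim_row B, j div dim_col B) * B $$ (i mod dim_row B, j mod dim_col B))"

text \<open>sum_j 1 \<otimes> ... \<otimes> rho_j(X) \<otimes> ... \<otimes> 1 for a list of pairs (a_j, dim V(s_j)).\<close>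
fun tensor_rep :: "(complex \<times> nat) list \<Rightarrow> loop \<Rightarrow> complex mat" where
  "tensor_rep [] X = 0\<^sub>m 1 1"
| "tensor_rep ((a, m) # rest) X =
     kron (ev_rep m a X) (1\<^sub>m (prod_list (map snd rest))) + kron (1\<^sub>m m) (tensor_rep rest X)"

definition rho_dim :: "real list \<Rightarrow> nat" where
  "rho_dim ss = prod_list (map spin_dim ss)"

definition rho_as :: "complex list \<Rightarrow> real list \<Rightarrow> loop \<Rightarrow> complex mat" where
  "rho_as as ss = tensor_rep (zip as (map spin_dim ss))"

definition ahat :: "complex \<Rightarrow> complex" where
  "ahat a = (a + inverse a) / 2"

end

theory Submission
  imports Defs "Jordan_Normal_Form.Schur_Decomposition" "Jordan_Normal_Form.Spectral_Radius"
    "HOL-Library.Poly_Mapping"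
begin

text \<open>
The Onsager algebra is a module over the polynomial ring in \<open>u = t + t\<^sup>-\<^sup>1\<close>. For an irreducible
\<open>\<rho>\<close>, a linear dependence among the operators \<open>\<rho> (u\<^sup>k (e + f))\<close> yields a monic polynomial \<open>g\<close> in \<open>u\<close>
with \<open>\<rho> (g X) = 0\<close> for all \<open>X\<close>; take \<open>g\<close> of least degree. An ideal that acts by commuting
operators acts by \<open>0\<close>, since all traces vanish. Applied to multiples of \<open>g / (u - 2 c)\<close> this excludes
multiple roots of \<open>g\<close> and the roots \<open>c = 1\<close>, \<open>c = - 1\<close>. Hence \<open>\<rho>\<close> only sees the values at finitely
many points \<open>a\<^sub>j\<close>, that is, it is an irreducible representation of a sum of commuting copies of sl2.
The orbit of a joint highest weight vector gives a nonzero intertwiner from a tensor product of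
evaluation modules, which is irreducible, so Schur's lemma applies. The spins are recovered from
nilpotency indices. In the Hermitian case the raising operator at \<open>a\<close> would be normal and nilpotent
unless \<open>a\<close> lies on the unit circle.
\<close>

section \<open>Linear algebra\<close>

text \<open>The symmetry t -> 1/t shapes the proof. It ties the values at a and 1/a together, so
  each pair {a, 1/a} yields a single copy of sl2, in which evaluation at 1/a exchanges the roles of
  e and f. The algebra is linear only over symmetric multipliers, the polynomials in u. At t = 1 and
  t = -1 skew elements vanish, so p -> p(t) is a character of the algebra. The trace condition is
  what removes these characters, and with them the two points. Abelian ideals act by 0 for this
  reason: an operator X commuting with every [X, Y] has only one eigenvalue, which must be 0 when
  the trace is 0. So the ideal consists of commuting nilpotent operators; these have a common kernel
  vector, and the common kernel is an invariant subspace. A root 2c of g that is multiple makes the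
  square of g / (u - 2c) a multiple of g, and the ideal generated by g / (u - 2c) abelian on V.
  Since u - 2c vanishes at t = a exactly when c = (a + 1/a) / 2, the polynomial g is recorded as the
  list of these c, and least degree becomes least length.\<close>

lemma linear_dependence:
  fixes f :: "nat \<Rightarrow> nat \<Rightarrow> complex"
  obtains c where "\<exists>k\<le>N. c k \<noteq> 0" "\<And>i. i < N \<Longrightarrow> (\<Sum>k\<le>N. c k * f k i) = 0"
proof -
  define A where "A = mat (Suc N) (Suc N) (\<lambda>(i, k). if i < N then f k i else 0)"
  have A: "A \<in> carrier_mat (Suc N) (Suc N)" by (simp add: A_def)
  have "transpose_mat A *\<^sub>v unit_vec (Suc N) N = 0\<^sub>v (Suc N)"
    by (rule eq_vecI) (auto simp: A_def)
  moreover have "unit_vec (Suc N) N \<noteq> (0\<^sub>v (Suc N) :: complex vec)" by simp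
  ultimately have "det (transpose_mat A) = 0"
    using det_0_iff_vec_prod_zero[of "transpose_mat A" "Suc N"] A by (meson transpose_carrier_mat unit_vec_carrier)
  then have "det A = 0" using det_transpose[OF A] by simp
  then obtain v where v: "v \<in> carrier_vec (Suc N)" "v \<noteq> 0\<^sub>v (Suc N)" "A *\<^sub>v v = 0\<^sub>v (Suc N)"
    using det_0_iff_vec_prod_zero[OF A] by blast
  show ?thesis
  proof (rule that[of "\<lambda>k. v $ k"])
    show "\<exists>k\<le>N. v $ k \<noteq> 0"
    proof (rule ccontr)
      assume "\<not> ?thesis"
      then have "v = 0\<^sub>v (Suc N)" using v(1) by (intro eq_vecI) auto
      with v(2) show False by simp
    qed
    fix i assume i: "i < N"
    then have "(A *\<^sub>v v) $ i = (\<Sum>k\<le>N. v $ k * f k i)"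
      using v(1) by (auto simp: A_def scalar_prod_def mult.commute lessThan_Suc_atMost[symmetric]
          atLeast0LessThan intro!: sum.cong)
    then show "(\<Sum>k\<le>N. v $ k * f k i) = 0" using v(3) i by simp
  qed
qed

lemma mat_trace_eq_sum_diag: "A \<in> carrier_mat d d \<Longrightarrow> mat_trace A = sum_list (diag_mat A)"
  by (auto simp: mat_trace_def diag_mat_def interv_sum_list_conv_sum_set_nat atLeast0LessThan)

lemma mat_trace_comm:
  assumes "A \<in> carrier_mat n m" "B \<in> carrier_mat m n"
  shows "mat_trace (A * B) = mat_trace (B * A)"
proof -
  have "mat_trace (A * B) = (\<Sum>i<n. \<Sum>j<m. A $$ (i, j) * B $$ (j, i))"
    using assms by (auto simp: mat_trace_def scalar_prod_def atLeast0LessThan intro!: sum.cong)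
  also have "\<dots> = (\<Sum>j<m. \<Sum>i<n. B $$ (j, i) * A $$ (i, j))"
    by (subst sum.swap) (simp add: mult.commute)
  also have "\<dots> = mat_trace (B * A)"
    using assms by (auto simp: mat_trace_def scalar_prod_def atLeast0LessThan intro!: sum.cong)
  finally show ?thesis .
qed

text \<open>The list \<open>es\<close> is the diagonal of a triangular matrix similar to
  \<open>A\<close>. The last clause is the Cayley-Hamilton theorem in factored form: the factors
  \<open>A\<close> - e, applied from the bottom of the diagonal upwards, kill one more coordinate
  each.\<close>

lemma triangular_chain:
  assumes A: "(A :: complex mat) \<in> carrier_mat d d"
  obtains es where "\<And>e. e \<in> set es \<Longrightarrow> eigenvalue A e" "length es = d" "mat_trace A = sum_list es"
    "\<And>v. v \<in> carrier_vec d \<Longrightarrow> foldr (\<lambda>e w. A *\<^sub>v w - e \<cdot>\<^sub>v w) es v = 0\<^sub>v d"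
proof -
  obtain es where es: "char_poly A = (\<Prod>e\<leftarrow>es. [:- e, 1:])" "length es = d"
    using char_poly_factorized[OF A] by auto
  obtain B P Q where "schur_decomposition A es = (B, P, Q)" by (metis prod_cases3)
  from schur_decomposition[OF A es(1) this]
  have wit: "similar_mat_wit A B P Q" and ut: "upper_triangular B" and diag: "diag_mat B = es" by auto
  from similar_mat_witD2[OF A wit]
  have c: "B \<in> carrier_mat d d" "P \<in> carrier_mat d d" "Q \<in> carrier_mat d d"
    and PQ: "P * Q = 1\<^sub>m d" and QP: "Q * P = 1\<^sub>m d" and ABQ: "A = P * B * Q" by auto
  have "eigenvalue A e" if "e \<in> set es" for e
    using that unfolding eigenvalue_root_char_poly[OF A] es(1)
    by (auto simp: poly_prod_list prod_list_zero_iff)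
  moreover have "mat_trace A = sum_list es"
  proof -
    have "mat_trace A = mat_trace (P * (B * Q))" using c unfolding ABQ by (simp add: assoc_mult_mat)
    also have "\<dots> = mat_trace (B * Q * P)" using c by (intro mat_trace_comm) auto
    also have "B * Q * P = B" using c QP by (simp add: assoc_mult_mat[of _ d d _ d _ d])
    finally show ?thesis using mat_trace_eq_sum_diag[OF c(1)] diag by simp
  qed
  moreover have "foldr (\<lambda>e w. A *\<^sub>v w - e \<cdot>\<^sub>v w) es v = 0\<^sub>v d" if v: "v \<in> carrier_vec d" for v
  proof -
    \<comment> \<open>\<open>w i\<close> is the vector after the factors with indices d - 1 down to
      i. It is followed in the coordinates \<open>Q *\<^sub>v w i\<close> of the triangular form,
      where the entries from i on turn out to be 0.\<close>
    define w where "w i = foldr (\<lambda>e w. A *\<^sub>v w - e \<cdot>\<^sub>v w) (drop i es) v" for i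
    have w_Suc: "w i = A *\<^sub>v w (Suc i) - (es ! i) \<cdot>\<^sub>v w (Suc i)" if "i < d" for i
      using that es(2) unfolding w_def by (simp add: Cons_nth_drop_Suc[symmetric])
    have wd: "w d = v" using es(2) by (simp add: w_def)
    have wc: "w i \<in> carrier_vec d" if "i \<le> d" for i
      using that
    proof (induction rule: inc_induct)
      case base then show ?case using v wd by simp
    next
      case (step n) then show ?case using A w_Suc[of n] by simp
    qed
    have Qw: "Q *\<^sub>v w i = B *\<^sub>v (Q *\<^sub>v w (Suc i)) - (es ! i) \<cdot>\<^sub>v (Q *\<^sub>v w (Suc i))" if "i < d" for i
    proof -
      have ws: "w (Suc i) \<in> carrier_vec d" using wc that by simp
      have "Q *\<^sub>v w i = Q *\<^sub>v (A *\<^sub>v w (Suc i)) - Q *\<^sub>v ((es ! i) \<cdot>\<^sub>v w (Suc i))"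
        unfolding w_Suc[OF that] using ws A c by (intro mult_minus_distrib_mat_vec) auto
      also have "Q *\<^sub>v (A *\<^sub>v w (Suc i)) = (Q * P) *\<^sub>v (B *\<^sub>v (Q *\<^sub>v w (Suc i)))"
        unfolding ABQ using ws c by (simp add: assoc_mult_mat_vec[of _ d d _ d])
      finally show ?thesis using ws c by (simp add: QP mult_mat_vec)
    qed
    have "\<forall>j. i \<le> j \<and> j < d \<longrightarrow> (Q *\<^sub>v w i) $ j = 0" if "i \<le> d" for i
      using that
    proof (induction rule: inc_induct)
      case base then show ?case by linarith
    next
      case (step n)
      let ?u = "Q *\<^sub>v w (Suc n)"
      have u: "?u \<in> carrier_vec d" using c wc step by simp
      show ?case
      proof (intro allI impI)
        fix j assume j: "n \<le> j \<and> j < d"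
        have "(B *\<^sub>v ?u) $ j = (\<Sum>k<d. B $$ (j, k) * ?u $ k)"
          using c u j by (simp add: scalar_prod_def atLeast0LessThan)
        also have "\<dots> = (\<Sum>k<d. if k = j then B $$ (j, j) * ?u $ j else 0)"
        proof (rule sum.cong)
          fix k assume k: "k \<in> {..<d}"
          have "B $$ (j, k) = 0" if "k < j" using ut j that c unfolding upper_triangular_def by auto
          moreover have "?u $ k = 0" if "j < k" using step.IH j that k by auto
          ultimately show "B $$ (j, k) * ?u $ k = (if k = j then B $$ (j, j) * ?u $ j else 0)"
            by (cases k j rule: linorder_cases) auto
        qed simp
        also have "\<dots> = B $$ (j, j) * ?u $ j" using j by simp
        finally have Bu: "(B *\<^sub>v ?u) $ j = B $$ (j, j) * ?u $ j" .
        have esj: "es ! j = B $$ (j, j)" using j c unfolding diag[symmetric] diag_mat_def by simp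
        have "(Q *\<^sub>v w n) $ j = B $$ (j, j) * ?u $ j - es ! n * ?u $ j"
          unfolding Qw[OF step.hyps(2)] using j u c Bu
          by (simp del: index_mult_mat_vec)
        also have "\<dots> = 0"
        proof (cases "j = n")
          case True then show ?thesis using esj by simp
        next
          case False then show ?thesis using step.IH j by simp
        qed
        finally show "(Q *\<^sub>v w n) $ j = 0" .
      qed
    qed
    from this[of 0] have "Q *\<^sub>v w 0 = 0\<^sub>v d" using c by (intro eq_vecI) (auto simp del: index_mult_mat_vec)
    then have "P *\<^sub>v (Q *\<^sub>v w 0) = 0\<^sub>v d" using c by auto
    then have "w 0 = 0\<^sub>v d" using wc[of 0] c PQ by (simp add: assoc_mult_mat_vec[symmetric, of _ d d _ d])
    then show ?thesis by (simp add: w_def)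
  qed
  ultimately show ?thesis using that es(2) by blast
qed

section \<open>Invariant subspaces, eigenvectors and intertwiners\<close>

lemma is_subspaceD:
  assumes "is_subspace d W"
  shows "\<And>v. v \<in> W \<Longrightarrow> v \<in> carrier_vec d" "0\<^sub>v d \<in> W" "\<And>u v. u \<in> W \<Longrightarrow> v \<in> W \<Longrightarrow> u + v \<in> W"
    "\<And>c v. v \<in> W \<Longrightarrow> c \<cdot>\<^sub>v v \<in> W"
  using assms unfolding is_subspace_def by auto

lemma is_subspace_diff:
  assumes W: "is_subspace d W" and "u \<in> W" "v \<in> W"
  shows "u - v \<in> W"
proof -
  have "u - v = u + (- 1) \<cdot>\<^sub>v v"
    using is_subspaceD(1)[OF W] assms(2,3) by (intro eq_vecI) auto
  then show ?thesis using assms(2,3) is_subspaceD[OF W] by metis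
qed

text \<open>The factors of the annihilating chain are applied to v one by one. All results stay in
  W, and the last one that is still nonzero is an eigenvector.\<close>

lemma invariant_subspace_eigenvector:
  assumes A: "A \<in> carrier_mat d d" and W: "is_subspace d W" and v: "v \<in> W" "v \<noteq> 0\<^sub>v d"
    and inv: "\<And>w. w \<in> W \<Longrightarrow> A *\<^sub>v w \<in> W"
  obtains u e where "u \<in> W" "u \<noteq> 0\<^sub>v d" "A *\<^sub>v u = e \<cdot>\<^sub>v u"
proof -
  obtain es where es: "\<And>v. v \<in> carrier_vec d \<Longrightarrow> foldr (\<lambda>e w. A *\<^sub>v w - e \<cdot>\<^sub>v w) es v = 0\<^sub>v d"
    using triangular_chain[OF A] by metis
  let ?f = "\<lambda>es. foldr (\<lambda>e w. A *\<^sub>v w - e \<cdot>\<^sub>v w) es v"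
  have fW: "?f es \<in> W" for es
    by (induction es) (auto simp: v intro!: is_subspace_diff[OF W] inv is_subspaceD(4)[OF W])
  have "?f es = 0\<^sub>v d \<longrightarrow> (\<exists>u e. u \<in> W \<and> u \<noteq> 0\<^sub>v d \<and> A *\<^sub>v u = e \<cdot>\<^sub>v u)" for es
  proof (induction es)
    case Nil then show ?case using v by simp
  next
    case (Cons e es)
    show ?case
    proof (cases "?f es = 0\<^sub>v d")
      case False
      let ?u = "?f es"
      show ?thesis
      proof
        assume 0: "?f (e # es) = 0\<^sub>v d"
        have u: "?u \<in> carrier_vec d" "A *\<^sub>v ?u \<in> carrier_vec d"
          using fW inv is_subspaceD(1)[OF W] by auto
        have "A *\<^sub>v ?u = e \<cdot>\<^sub>v ?u"
        proof (rule eq_vecI)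
          fix i assume "i < dim_vec (e \<cdot>\<^sub>v ?u)"
          then have i: "i < d" using u by simp
          have "(A *\<^sub>v ?u - e \<cdot>\<^sub>v ?u) $ i = 0" using 0 i by simp
          then show "(A *\<^sub>v ?u) $ i = (e \<cdot>\<^sub>v ?u) $ i" using i u by (simp del: index_mult_mat_vec)
        qed (use u A in simp)
        then show "\<exists>u e. u \<in> W \<and> u \<noteq> 0\<^sub>v d \<and> A *\<^sub>v u = e \<cdot>\<^sub>v u" using fW False by blast
      qed
    qed (use Cons in simp)
  qed
  then show ?thesis using es[of v] is_subspaceD(1)[OF W v(1)] that by blast
qed

lemma trace_eq_of_single_eigenvalue:
  assumes A: "(A :: complex mat) \<in> carrier_mat d d" and "\<And>e. eigenvalue A e \<Longrightarrow> e = \<mu>"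
  shows "mat_trace A = of_nat d * \<mu>"
proof -
  obtain es where es: "\<And>e. e \<in> set es \<Longrightarrow> eigenvalue A e" "length es = d" "mat_trace A = sum_list es"
    using triangular_chain[OF A] by metis
  have "es = replicate d \<mu>" using es assms(2) by (intro replicate_eqI) auto
  then show ?thesis using es(3) by (simp add: sum_list_replicate)
qed

lemma invertible_matI:
  fixes P :: "complex mat"
  assumes P: "P \<in> carrier_mat d d" and inj: "\<And>v. v \<in> carrier_vec d \<Longrightarrow> P *\<^sub>v v = 0\<^sub>v d \<Longrightarrow> v = 0\<^sub>v d"
  shows "invertible_mat P"
proof -
  have "det P \<noteq> 0" using det_0_iff_vec_prod_zero[OF P] inj by blast
  from det_non_zero_imp_unit[OF P this, of undefined]
  obtain Q where "Q \<in> carrier_mat d d" "Q * P = 1\<^sub>m d" "P * Q = 1\<^sub>m d"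
    by (auto simp: Units_def ring_mat_def)
  then show ?thesis using P unfolding invertible_mat_def inverts_mat_def by auto
qed

lemma invertible_mat_inverse:
  fixes P :: "complex mat"
  assumes P: "P \<in> carrier_mat d d" "invertible_mat P"
  obtains Q where "Q \<in> carrier_mat d d" "P * Q = 1\<^sub>m d" "Q * P = 1\<^sub>m d"
proof -
  obtain Q where Q: "P * Q = 1\<^sub>m d" "Q * P = 1\<^sub>m (dim_row Q)"
    using P unfolding invertible_mat_def inverts_mat_def by auto
  have Qc: "Q \<in> carrier_mat d d"
    using arg_cong[OF Q(1), of dim_col] arg_cong[OF Q(2), of dim_col] P(1) by auto
  then show ?thesis using that Q by simp
qed

lemma intertwiner_inverse:
  fixes P Q R S :: "complex mat"
  assumes c: "P \<in> carrier_mat d d" "Q \<in> carrier_mat d d" and PQ: "P * Q = 1\<^sub>m d" and QP: "Q * P = 1\<^sub>m d"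
    and RS: "R \<in> carrier_mat d d" "S \<in> carrier_mat d d" and inter: "P * R = S * P"
  shows "Q * S = R * Q"
proof -
  have "Q * S = Q * S * (P * Q)" unfolding PQ using c RS by simp
  also have "\<dots> = Q * (S * P) * Q" using c RS by (simp add: assoc_mult_mat[of _ d d _ d _ d])
  also have "\<dots> = (Q * P) * R * Q"
    unfolding inter[symmetric] using c RS by (simp add: assoc_mult_mat[of _ d d _ d _ d])
  also have "\<dots> = R * Q" unfolding QP using c RS by simp
  finally show ?thesis .
qed

lemma commute_of_commutator_zero:
  fixes X Y :: "complex mat"
  assumes "X \<in> carrier_mat d d" "Y \<in> carrier_mat d d" and 0: "X * Y - Y * X = 0\<^sub>m d d"
  shows "X * Y = Y * X"
proof (rule eq_matI)
  fix i j assume "i < dim_row (Y * X)" "j < dim_col (Y * X)"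
  then show "(X * Y) $$ (i, j) = (Y * X) $$ (i, j)"
    using arg_cong[OF 0, of "\<lambda>M. M $$ (i, j)"] assms(1,2) by (simp del: index_mult_mat(1))
qed (use assms in auto)

lemma mat_eq_zeroI:
  fixes A :: "complex mat"
  assumes A: "A \<in> carrier_mat n m" and "\<And>v. v \<in> carrier_vec m \<Longrightarrow> A *\<^sub>v v = 0\<^sub>v n"
  shows "A = 0\<^sub>m n m"
proof (rule eq_matI)
  fix i j assume ij: "i < dim_row (0\<^sub>m n m :: complex mat)" "j < dim_col (0\<^sub>m n m :: complex mat)"
  then have "A $$ (i, j) = (A *\<^sub>v unit_vec m j) $ i" using A by simp
  also have "\<dots> = 0" using assms(2)[of "unit_vec m j"] ij by simp
  finally show "A $$ (i, j) = (0\<^sub>m n m :: complex mat) $$ (i, j)" using ij by simp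
qed (use A in auto)

lemma smult_zero_vec_right: "(c :: complex) \<cdot>\<^sub>v 0\<^sub>v n = 0\<^sub>v n"
  by (rule eq_vecI) auto

lemma mult_mat_zero_vec [simp]: "(A :: complex mat) \<in> carrier_mat n m \<Longrightarrow> A *\<^sub>v 0\<^sub>v m = 0\<^sub>v n"
  by (rule eq_vecI) auto

section \<open>Common kernels of commuting nilpotent matrices\<close>

definition locally_nilpotent :: "nat \<Rightarrow> complex mat \<Rightarrow> bool" where
  "locally_nilpotent d A \<longleftrightarrow> (\<forall>v\<in>carrier_vec d. \<exists>k. ((*\<^sub>v) A ^^ k) v = 0\<^sub>v d)"

lemma funpow_mult_carrier:
  "A \<in> carrier_mat d d \<Longrightarrow> v \<in> carrier_vec d \<Longrightarrow> ((*\<^sub>v) A ^^ k) v \<in> carrier_vec d"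
  by (induction k) auto

lemma funpow_mult_zero: "A \<in> carrier_mat d d \<Longrightarrow> ((*\<^sub>v) A ^^ k) (0\<^sub>v d) = (0\<^sub>v d :: complex vec)"
  by (induction k) auto

lemma funpow_mult_add:
  "A \<in> carrier_mat d d \<Longrightarrow> u \<in> carrier_vec d \<Longrightarrow> v \<in> carrier_vec d \<Longrightarrow>
   ((*\<^sub>v) A ^^ k) (u + v) = ((*\<^sub>v) A ^^ k) u + ((*\<^sub>v) (A :: complex mat) ^^ k) v"
  by (induction k) (auto simp: mult_add_distrib_mat_vec funpow_mult_carrier)

lemma funpow_mult_smult:
  "A \<in> carrier_mat d d \<Longrightarrow> v \<in> carrier_vec d \<Longrightarrow>
   ((*\<^sub>v) A ^^ k) (c \<cdot>\<^sub>v v) = c \<cdot>\<^sub>v ((*\<^sub>v) (A :: complex mat) ^^ k) v"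
  by (induction k) (auto simp: mult_mat_vec funpow_mult_carrier)

lemma funpow_mult_commute:
  fixes A B :: "complex mat"
  assumes "A \<in> carrier_mat d d" "B \<in> carrier_mat d d" "A * B = B * A" "v \<in> carrier_vec d"
  shows "((*\<^sub>v) A ^^ k) (B *\<^sub>v v) = B *\<^sub>v (((*\<^sub>v) A ^^ k) v)"
proof (induction k)
  case (Suc k)
  let ?w = "((*\<^sub>v) A ^^ k) v"
  have w: "?w \<in> carrier_vec d" using assms by (simp add: funpow_mult_carrier)
  have "A *\<^sub>v (B *\<^sub>v ?w) = B *\<^sub>v (A *\<^sub>v ?w)"
    using assoc_mult_mat_vec[OF assms(1,2) w] assoc_mult_mat_vec[OF assms(2,1) w] assms(3) by simp
  then show ?case using Suc by simp
qed simp

lemma funpow_mult_eigen: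
  assumes "(A :: complex mat) \<in> carrier_mat d d" "v \<in> carrier_vec d" "A *\<^sub>v v = e \<cdot>\<^sub>v v"
  shows "((*\<^sub>v) A ^^ k) v = e ^ k \<cdot>\<^sub>v v"
  by (induction k) (use assms in \<open>auto simp: mult_mat_vec smult_smult_assoc mult.commute\<close>)

text \<open>By commutativity the next matrix A preserves the joint kernel of the others, so the last
  nonzero iterate of A on a vector of this kernel is killed by A as well.\<close>

lemma commuting_nilpotent_list_kernel:
  fixes As :: "complex mat list"
  assumes "d > 0" "set As \<subseteq> carrier_mat d d" "\<And>A. A \<in> set As \<Longrightarrow> locally_nilpotent d A"
    "\<And>A B. A \<in> set As \<Longrightarrow> B \<in> set As \<Longrightarrow> A * B = B * A"
  shows "\<exists>v\<in>carrier_vec d. v \<noteq> 0\<^sub>v d \<and> (\<forall>A\<in>set As. A *\<^sub>v v = 0\<^sub>v d)"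
  using assms
proof (induction As)
  case Nil
  then show ?case by (intro bexI[of _ "unit_vec d 0"]) auto
next
  case (Cons A As)
  then obtain v where v: "v \<in> carrier_vec d" "v \<noteq> 0\<^sub>v d" "\<And>B. B \<in> set As \<Longrightarrow> B *\<^sub>v v = 0\<^sub>v d"
    by auto
  have A: "A \<in> carrier_mat d d" using Cons.prems by simp
  define k where "k = (LEAST k. ((*\<^sub>v) A ^^ k) v = 0\<^sub>v d)"
  have ex: "\<exists>k. ((*\<^sub>v) A ^^ k) v = 0\<^sub>v d"
    using Cons.prems(3)[of A] v(1) by (auto simp: locally_nilpotent_def)
  have k: "((*\<^sub>v) A ^^ k) v = 0\<^sub>v d" unfolding k_def using ex by (rule LeastI_ex)
  then have "k \<noteq> 0" using v(2) by (intro notI) simp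
  then obtain j where j: "k = Suc j" by (cases k) auto
  let ?u = "((*\<^sub>v) A ^^ j) v"
  have "?u \<noteq> 0\<^sub>v d" using not_less_Least[of j "\<lambda>k. ((*\<^sub>v) A ^^ k) v = 0\<^sub>v d"] j by (simp add: k_def)
  moreover have "A *\<^sub>v ?u = 0\<^sub>v d" using k j by simp
  moreover have "B *\<^sub>v ?u = 0\<^sub>v d" if "B \<in> set As" for B
  proof -
    have "B *\<^sub>v ?u = ((*\<^sub>v) A ^^ j) (B *\<^sub>v v)"
      using funpow_mult_commute[of A d B v j] Cons.prems that v(1) by auto
    then show ?thesis using v(3)[OF that] A by (simp add: funpow_mult_zero)
  qed
  moreover have "?u \<in> carrier_vec d" using A v(1) by (rule funpow_mult_carrier)
  ultimately show ?case by auto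
qed

text \<open>A strictly decreasing chain of common kernels of finite subfamilies has length at most \<open>d\<close>.\<close>

lemma commuting_nilpotent_set_kernel:
  fixes D :: "complex mat set"
  assumes d: "d > 0" and D: "D \<subseteq> carrier_mat d d" and nil: "\<And>A. A \<in> D \<Longrightarrow> locally_nilpotent d A"
    and comm: "\<And>A B. A \<in> D \<Longrightarrow> B \<in> D \<Longrightarrow> A * B = B * A"
  obtains v where "v \<in> carrier_vec d" "v \<noteq> 0\<^sub>v d" "\<And>A. A \<in> D \<Longrightarrow> A *\<^sub>v v = 0\<^sub>v d"
proof -
  have "\<exists>v\<in>carrier_vec d. v \<noteq> 0\<^sub>v d \<and> (\<forall>A\<in>D. A *\<^sub>v v = 0\<^sub>v d)"
  proof (rule ccontr)
    assume neg: "\<not> ?thesis"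
    \<comment> \<open>Without a common kernel vector every finite stage can be prolonged: each new
      vector is killed by all earlier matrices, but not by the one chosen together with it.\<close>
    have "\<exists>As us. length As = n \<and> length us = n \<and> set As \<subseteq> D \<and> set us \<subseteq> carrier_vec d \<and>
        (\<forall>i<n. As ! i *\<^sub>v us ! i \<noteq> 0\<^sub>v d \<and> (\<forall>j<i. As ! j *\<^sub>v us ! i = 0\<^sub>v d))" for n
    proof (induction n)
      case (Suc n)
      then obtain As us where IH: "length As = n" "length us = n" "set As \<subseteq> D" "set us \<subseteq> carrier_vec d"
        "\<forall>i<n. As ! i *\<^sub>v us ! i \<noteq> 0\<^sub>v d \<and> (\<forall>j<i. As ! j *\<^sub>v us ! i = 0\<^sub>v d)" by auto
      obtain v where v: "v \<in> carrier_vec d" "v \<noteq> 0\<^sub>v d" "\<forall>A\<in>set As. A *\<^sub>v v = 0\<^sub>v d"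
        using commuting_nilpotent_list_kernel[of d As] d IH(3) D nil comm by blast
      then obtain A where A: "A \<in> D" "A *\<^sub>v v \<noteq> 0\<^sub>v d" using neg by auto
      show ?case
        by (rule exI[of _ "As @ [A]"], rule exI[of _ "us @ [v]"])
          (use IH v A in \<open>auto simp: nth_append less_Suc_eq\<close>)
    qed simp
    from this[of "Suc d"] obtain As us where *: "length As = Suc d" "length us = Suc d" "set As \<subseteq> D"
      "set us \<subseteq> carrier_vec d" and
      nz: "\<And>i. i \<le> d \<Longrightarrow> As ! i *\<^sub>v us ! i \<noteq> 0\<^sub>v d" and
      z: "\<And>i j. i \<le> d \<Longrightarrow> j < i \<Longrightarrow> As ! j *\<^sub>v us ! i = 0\<^sub>v d" by (auto simp: less_Suc_eq_le)
    obtain c where c: "\<exists>k\<le>d. c k \<noteq> 0" "\<And>i. i < d \<Longrightarrow> (\<Sum>k\<le>d. c k * (us ! k) $ i) = 0"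
      using linear_dependence[of d "\<lambda>k i. (us ! k) $ i"] by blast
    \<comment> \<open>\<open>As ! m\<close> is applied to the dependence. It kills
      \<open>us ! k\<close> for k > m, so only the term k = m is left, and \<open>us ! m\<close>
      would be killed too.\<close>
    define m where "m = (LEAST k. c k \<noteq> 0)"
    obtain k0 where k0: "k0 \<le> d" "c k0 \<noteq> 0" using c(1) by blast
    have m: "c m \<noteq> 0" unfolding m_def by (rule LeastI[of "\<lambda>k. c k \<noteq> 0", OF k0(2)])
    have "m \<le> k0" unfolding m_def by (rule Least_le) (rule k0(2))
    with m k0(1) have m: "c m \<noteq> 0" "m \<le> d" by auto
    have cm: "c k = 0" if "k < m" for k using that not_less_Least unfolding m_def by blast
    let ?A = "As ! m"
    have A: "?A \<in> carrier_mat d d" using * m D by (metis in_mono le_imp_less_Suc nth_mem)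
    have us: "us ! k \<in> carrier_vec d" if "k \<le> d" for k using * that
      by (metis in_mono le_imp_less_Suc nth_mem)
    have "?A *\<^sub>v us ! m = 0\<^sub>v d"
    proof (rule eq_vecI)
      fix i assume "i < dim_vec (0\<^sub>v d :: complex vec)"
      then have i: "i < d" by simp
      have "0 = (\<Sum>r<d. ?A $$ (i, r) * (\<Sum>k\<le>d. c k * (us ! k) $ r))" using c(2) by simp
      also have "\<dots> = (\<Sum>k\<le>d. c k * (\<Sum>r<d. ?A $$ (i, r) * (us ! k) $ r))"
        by (simp add: sum_distrib_left sum.swap[of _ "{..<d}"] mult.left_commute)
      also have "\<dots> = (\<Sum>k\<le>d. c k * (?A *\<^sub>v us ! k) $ i)"
        using A i us[THEN carrier_vecD] by (intro sum.cong) (auto simp: scalar_prod_def atLeast0LessThan)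
      also have "\<dots> = (\<Sum>k\<le>d. if k = m then c m * (?A *\<^sub>v us ! m) $ i else 0)"
      proof (rule sum.cong)
        fix k assume "k \<in> {..d}"
        then show "c k * (?A *\<^sub>v us ! k) $ i = (if k = m then c m * (?A *\<^sub>v us ! m) $ i else 0)"
          using cm[of k] z[of k m] i by (cases k m rule: linorder_cases) (auto simp del: index_mult_mat_vec)
      qed simp
      also have "\<dots> = c m * (?A *\<^sub>v us ! m) $ i" using m(2) by simp
      finally show "(?A *\<^sub>v us ! m) $ i = 0\<^sub>v d $ i" using m(1) i by (simp del: index_mult_mat_vec)
    qed (use A in auto)
    with nz m(2) show False by blast
  qed
  then show ?thesis using that by blast
qed

section \<open>Irreducible families and abelian ideals\<close>

definition irreducible_set :: "nat \<Rightarrow> complex mat set \<Rightarrow> bool" where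
  "irreducible_set d G \<longleftrightarrow> d > 0 \<and> (\<forall>W. is_subspace d W \<and> (\<forall>Y\<in>G. \<forall>v\<in>W. Y *\<^sub>v v \<in> W)
     \<longrightarrow> W = {0\<^sub>v d} \<or> W = carrier_vec d)"

lemma irreducible_setD:
  assumes "irreducible_set d G" "is_subspace d W" "\<And>Y v. Y \<in> G \<Longrightarrow> v \<in> W \<Longrightarrow> Y *\<^sub>v v \<in> W"
    "v \<in> W" "v \<noteq> 0\<^sub>v d"
  shows "W = carrier_vec d"
proof -
  have "W = {0\<^sub>v d} \<or> W = carrier_vec d"
    using assms(1-3) unfolding irreducible_set_def by blast
  then show ?thesis using assms(4,5) by auto
qed

text \<open>If \<open>X\<close> commutes with \<open>[X, Y]\<close> for all \<open>Y\<close> in the family, then the generalized eigenspaces of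
  \<open>X\<close> are invariant, so \<open>X\<close> has a single eigenvalue, and this is \<open>0\<close> when the trace vanishes.\<close>

lemma ad_square_zero_nilpotent:
  assumes irr: "irreducible_set d G" and G: "G \<subseteq> carrier_mat d d" and X: "X \<in> carrier_mat d d"
    and tr: "mat_trace X = 0"
    and comm: "\<And>Y. Y \<in> G \<Longrightarrow> X * (X * Y - Y * X) = (X * Y - Y * X) * X"
  shows "locally_nilpotent d X"
proof -
  have d: "d > 0" using irr unfolding irreducible_set_def by simp
  obtain \<mu> where "\<mu> \<in> spectrum X" using spectrum_non_empty[OF X d] by blast
  then obtain v where "eigenvector X v \<mu>" unfolding spectrum_def eigenvalue_def by auto
  then have v: "v \<in> carrier_vec d" "v \<noteq> 0\<^sub>v d" "X *\<^sub>v v = \<mu> \<cdot>\<^sub>v v"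
    using X unfolding eigenvector_def by auto
  define N where "N = X - \<mu> \<cdot>\<^sub>m 1\<^sub>m d"
  have N: "N \<in> carrier_mat d d" using X by (simp add: N_def minus_carrier_mat)
  have Nv: "N *\<^sub>v w = X *\<^sub>v w - \<mu> \<cdot>\<^sub>v w" if "w \<in> carrier_vec d" for w
    using that X unfolding N_def
    by (subst minus_mult_distrib_mat_vec) (auto intro!: arg_cong2[of _ _ _ _ "(-)"] eq_vecI)
  define U where "U = {w \<in> carrier_vec d. \<exists>k. ((*\<^sub>v) N ^^ k) w = 0\<^sub>v d}"
  have mono: "((*\<^sub>v) N ^^ (k + j)) w = 0\<^sub>v d" if "((*\<^sub>v) N ^^ k) w = 0\<^sub>v d" for k j w
    using that funpow_mult_zero[OF N] by (subst add.commute) (simp add: funpow_add)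
  have sub: "is_subspace d U"
    unfolding is_subspace_def
  proof (intro conjI ballI allI)
    show "0\<^sub>v d \<in> U" unfolding U_def by (auto intro: exI[of _ 0])
  next
    fix u w assume "u \<in> U" "w \<in> U"
    then obtain k j where kj: "u \<in> carrier_vec d" "w \<in> carrier_vec d"
      "((*\<^sub>v) N ^^ k) u = 0\<^sub>v d" "((*\<^sub>v) N ^^ j) w = 0\<^sub>v d" unfolding U_def by auto
    then have "((*\<^sub>v) N ^^ (k + j)) (u + w) = 0\<^sub>v d"
      using mono[of k u j] mono[of j w k] by (simp add: funpow_mult_add[OF N] add.commute)
    then show "u + w \<in> U" using kj unfolding U_def by auto
  next
    fix c w assume "w \<in> U"
    then show "c \<cdot>\<^sub>v w \<in> U" unfolding U_def
      by (auto simp: funpow_mult_smult[OF N]) (metis smult_zero_vec_right)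
  qed (auto simp: U_def)
  \<comment> \<open>With Z = [X, Y] one has N Y w = Y N w + Z w, and Z commutes with N. So passing Y
    costs one extra power of N, whatever k is.\<close>
  have step: "((*\<^sub>v) N ^^ Suc k) (Y *\<^sub>v w) = 0\<^sub>v d"
    if Y: "Y \<in> G" and "w \<in> carrier_vec d" "((*\<^sub>v) N ^^ k) w = 0\<^sub>v d" for Y w k
    using that(2,3)
  proof (induction k arbitrary: w)
    case 0
    have Yc: "Y \<in> carrier_mat d d" using Y G by blast
    show ?case using 0 Yc N by simp
  next
    case (Suc k)
    define Z where "Z = X * Y - Y * X"
    have Yc: "Y \<in> carrier_mat d d" using Y G by auto
    have Z: "Z \<in> carrier_mat d d" unfolding Z_def using X Yc by (intro minus_carrier_mat) auto
    have w: "w \<in> carrier_vec d" by fact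
    have NZ: "N * Z = Z * N"
    proof -
      have "N * Z = X * Z - \<mu> \<cdot>\<^sub>m Z" unfolding N_def using X Z
        by (subst minus_mult_distrib_mat) (auto simp: mult_smult_assoc_mat[of _ d d])
      moreover have "Z * N = Z * X - \<mu> \<cdot>\<^sub>m Z" unfolding N_def using X Z
        by (subst mult_minus_distrib_mat) (auto simp: mult_smult_distrib[of _ d d])
      ultimately show ?thesis using comm[OF Y] by (simp add: Z_def)
    qed
    have c: "Y *\<^sub>v w \<in> carrier_vec d" "X *\<^sub>v w \<in> carrier_vec d" "N *\<^sub>v w \<in> carrier_vec d"
      "Y *\<^sub>v (X *\<^sub>v w) \<in> carrier_vec d" "X *\<^sub>v (Y *\<^sub>v w) \<in> carrier_vec d" "Z *\<^sub>v w \<in> carrier_vec d"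
      using w X Yc N Z by auto
    have "N *\<^sub>v (Y *\<^sub>v w) = Y *\<^sub>v (N *\<^sub>v w) + Z *\<^sub>v w"
    proof -
      have "Y *\<^sub>v (N *\<^sub>v w) = Y *\<^sub>v (X *\<^sub>v w) - \<mu> \<cdot>\<^sub>v (Y *\<^sub>v w)"
        unfolding Nv[OF w] using c w Yc by (simp add: mult_minus_distrib_mat_vec[of _ d d] mult_mat_vec)
      moreover have "Z *\<^sub>v w = X *\<^sub>v (Y *\<^sub>v w) - Y *\<^sub>v (X *\<^sub>v w)"
        unfolding Z_def using X Yc w
        by (subst minus_mult_distrib_mat_vec[of _ d d]) auto
      moreover have "N *\<^sub>v (Y *\<^sub>v w) = X *\<^sub>v (Y *\<^sub>v w) - \<mu> \<cdot>\<^sub>v (Y *\<^sub>v w)" using Nv c by simp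
      ultimately show ?thesis using c
        by (auto intro!: eq_vecI simp del: index_mult_mat_vec)
    qed
    then have "((*\<^sub>v) N ^^ Suc (Suc k)) (Y *\<^sub>v w) = ((*\<^sub>v) N ^^ Suc k) (Y *\<^sub>v (N *\<^sub>v w)) + ((*\<^sub>v) N ^^ Suc k) (Z *\<^sub>v w)"
      using c Yc by (subst funpow_Suc_right) (simp add: funpow_mult_add[OF N] del: funpow.simps)
    also have "((*\<^sub>v) N ^^ Suc k) (Z *\<^sub>v w) = Z *\<^sub>v (((*\<^sub>v) N ^^ Suc k) w)"
      by (rule funpow_mult_commute[OF N Z NZ w])
    also have "((*\<^sub>v) N ^^ Suc k) (Y *\<^sub>v (N *\<^sub>v w)) = 0\<^sub>v d"
      using Suc.prems c by (intro Suc.IH) (auto simp: funpow_swap1)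
    finally show ?case using Suc.prems(2) Z by (simp del: funpow.simps)
  qed
  have "U = carrier_vec d"
  proof (rule irreducible_setD[OF irr sub])
    fix Y w assume "Y \<in> G" "w \<in> U"
    then show "Y *\<^sub>v w \<in> U" using step[of Y w] G unfolding U_def by (auto simp del: funpow.simps)
  next
    show "v \<in> U" unfolding U_def using v by (auto intro!: exI[of _ 1] simp: Nv)
  qed (use v in simp)
  then have gen: "\<exists>k. ((*\<^sub>v) N ^^ k) w = 0\<^sub>v d" if "w \<in> carrier_vec d" for w
    using that unfolding U_def by blast
  have "e = \<mu>" if ev: "eigenvalue X e" for e
  proof -
    obtain w where w: "w \<in> carrier_vec d" "w \<noteq> 0\<^sub>v d" "X *\<^sub>v w = e \<cdot>\<^sub>v w"
      using ev X unfolding eigenvalue_def eigenvector_def by auto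
    obtain k where k: "((*\<^sub>v) N ^^ k) w = 0\<^sub>v d" using gen[OF w(1)] by blast
    have "N *\<^sub>v w = (e - \<mu>) \<cdot>\<^sub>v w" using Nv[OF w(1)] w(1,3)
      by (auto intro!: eq_vecI simp: left_diff_distrib)
    from funpow_mult_eigen[OF N w(1) this, of k] k have z: "(e - \<mu>) ^ k \<cdot>\<^sub>v w = 0\<^sub>v d" by simp
    obtain i where i: "i < d" "w $ i \<noteq> 0" using w(1,2) by (metis carrier_vecD eq_vecI index_zero_vec(1,2))
    have "(e - \<mu>) ^ k * w $ i = 0" using arg_cong[OF z, of "\<lambda>x. x $ i"] i w(1) by simp
    then show "e = \<mu>" using i by simp
  qed
  then have "mat_trace X = of_nat d * \<mu>" by (rule trace_eq_of_single_eigenvalue[OF X])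
  then have "\<mu> = 0" using tr d by simp
  then have "N = X" using X unfolding N_def by (auto intro!: eq_matI)
  then show ?thesis unfolding locally_nilpotent_def using gen by simp
qed

text \<open>For X in D the brackets [X, Y] lie in D and commute with X, so every element of D is
  nilpotent. The common kernel of D is nonzero and invariant, by A Y w = [A, Y] w + Y A w;
  irreducibility makes it the whole space.\<close>

lemma abelian_ideal_zero:
  assumes irr: "irreducible_set d G" and G: "G \<subseteq> carrier_mat d d" and DG: "D \<subseteq> G"
    and tr: "\<And>X. X \<in> D \<Longrightarrow> mat_trace X = 0"
    and comm: "\<And>X Y. X \<in> D \<Longrightarrow> Y \<in> D \<Longrightarrow> X * Y = Y * X"
    and ideal: "\<And>X Y. X \<in> D \<Longrightarrow> Y \<in> G \<Longrightarrow> X * Y - Y * X \<in> D"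
    and X: "X \<in> D"
  shows "X = 0\<^sub>m d d"
proof -
  have d: "d > 0" using irr unfolding irreducible_set_def by simp
  have D: "D \<subseteq> carrier_mat d d" using DG G by blast
  have nil: "locally_nilpotent d A" if "A \<in> D" for A
    using that D comm ideal tr by (intro ad_square_zero_nilpotent[OF irr G]) auto
  obtain v where v: "v \<in> carrier_vec d" "v \<noteq> 0\<^sub>v d" "\<And>A. A \<in> D \<Longrightarrow> A *\<^sub>v v = 0\<^sub>v d"
    using commuting_nilpotent_set_kernel[OF d D nil comm] by blast
  define W where "W = {w \<in> carrier_vec d. \<forall>A\<in>D. A *\<^sub>v w = 0\<^sub>v d}"
  have "W = carrier_vec d"
  proof (rule irreducible_setD[OF irr])
    show "is_subspace d W" unfolding is_subspace_def W_def
    proof (intro conjI ballI allI)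
      fix u w assume "u \<in> {w \<in> carrier_vec d. \<forall>A\<in>D. A *\<^sub>v w = 0\<^sub>v d}" "w \<in> {w \<in> carrier_vec d. \<forall>A\<in>D. A *\<^sub>v w = 0\<^sub>v d}"
      then show "u + w \<in> {w \<in> carrier_vec d. \<forall>A\<in>D. A *\<^sub>v w = 0\<^sub>v d}"
        using D by (auto simp: mult_add_distrib_mat_vec[of _ d d])
    next
      fix c w assume "w \<in> {w \<in> carrier_vec d. \<forall>A\<in>D. A *\<^sub>v w = 0\<^sub>v d}"
      then show "c \<cdot>\<^sub>v w \<in> {w \<in> carrier_vec d. \<forall>A\<in>D. A *\<^sub>v w = 0\<^sub>v d}"
        using D by (auto simp: mult_mat_vec[of _ d d] smult_zero_vec_right)
    qed (use D in \<open>auto dest!: subsetD[OF D]\<close>)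
    show "v \<in> W" using v by (simp add: W_def)
    fix Y w assume Y: "Y \<in> G" and "w \<in> W"
    then have w: "w \<in> carrier_vec d" "\<And>A. A \<in> D \<Longrightarrow> A *\<^sub>v w = 0\<^sub>v d" unfolding W_def by auto
    have "A *\<^sub>v (Y *\<^sub>v w) = 0\<^sub>v d" if A: "A \<in> D" for A
    proof -
      have Ac: "A \<in> carrier_mat d d" "Y \<in> carrier_mat d d" using A Y D G by auto
      have "0\<^sub>v d = (A * Y - Y * A) *\<^sub>v w" using w(2)[OF ideal[OF A Y]] by simp
      also have "\<dots> = A *\<^sub>v (Y *\<^sub>v w) - Y *\<^sub>v (A *\<^sub>v w)"
        using Ac w(1) by (subst minus_mult_distrib_mat_vec[of _ d d]) auto
      also have "\<dots> = A *\<^sub>v (Y *\<^sub>v w)" using w(2)[OF A] Ac w(1) by (auto intro!: eq_vecI)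
      finally show ?thesis by simp
    qed
    then show "Y *\<^sub>v w \<in> W" using w(1) Y G unfolding W_def by auto
  qed (use v in simp)
  then have "X *\<^sub>v w = 0\<^sub>v d" if "w \<in> carrier_vec d" for w using that X unfolding W_def by blast
  then show ?thesis using X D by (intro mat_eq_zeroI) auto
qed

section \<open>Laurent polynomials\<close>

text \<open>Finitely supported functions form a commutative ring under convolution, so ring
  reasoning is available; \<open>lookup\<close> leads back to the coefficient functions in which the
  representations are stated.\<close>

type_synonym laurent = "int \<Rightarrow>\<^sub>0 complex"

abbreviation "lookup \<equiv> Poly_Mapping.lookup"
abbreviation "single \<equiv> Poly_Mapping.single"
abbreviation "keys \<equiv> Poly_Mapping.keys"

definition flip :: "laurent \<Rightarrow> laurent" where
  "flip p = Poly_Mapping.map_key uminus p"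

definition conj_l :: "laurent \<Rightarrow> laurent" where
  "conj_l p = Poly_Mapping.map cnj p"

definition ev :: "laurent \<Rightarrow> complex \<Rightarrow> complex" where
  "ev p a = leval (lookup p) a"

definition cst :: "complex \<Rightarrow> laurent" where
  "cst c = single 0 c"

definition tvar :: laurent where "tvar = single 1 1"

definition uvar :: laurent where "uvar = single 1 1 + single (- 1) 1"

lemma laurent_induct [case_names single add]:
  fixes p :: laurent
  assumes "\<And>k c. P (single k c)" "\<And>p q. P p \<Longrightarrow> P q \<Longrightarrow> P (p + q)"
  shows "P p"
proof (induction p rule: update_induct)
  case const
  show ?case using assms(1)[of 0 0] by simp
next
  case (update f a b)
  have "Poly_Mapping.update a b f = f + single a b"
    using update(1) by (intro poly_mapping_eqI) (auto simp: lookup_update lookup_add lookup_single in_keys_iff)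
  then show ?case using assms update by simp
qed

lemma lookup_flip [simp]: "lookup (flip p) k = lookup p (- k)"
  unfolding flip_def by (simp add: map_key.rep_eq)

lemma lookup_conj_l [simp]: "lookup (conj_l p) k = cnj (lookup p k)"
  unfolding conj_l_def by (simp add: map.rep_eq when_def)

lemma flip_simps [simp]:
  "flip 0 = 0" "flip (p + q) = flip p + flip q" "flip (- p) = - flip p"
  "flip (p - q) = flip p - flip q" "flip (flip p) = p" "flip (single k c) = single (- k) c"
  "flip (cst c) = cst c" "flip uvar = uvar"
  by (auto intro!: poly_mapping_eqI simp: lookup_add lookup_minus lookup_single when_def cst_def uvar_def)

lemma flip_one [simp]: "flip 1 = 1"
  using flip_simps(7)[of 1] by (simp add: cst_def)

lemma flip_numeral [simp]: "flip (numeral n) = numeral n"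
  using flip_simps(7)[of "numeral n"] by (simp add: cst_def)

lemma conj_l_simps [simp]:
  "conj_l 0 = 0" "conj_l (p + q) = conj_l p + conj_l q" "conj_l (- p) = - conj_l p"
  "conj_l (p - q) = conj_l p - conj_l q" "conj_l (conj_l p) = p" "conj_l (single k c) = single k (cnj c)"
  "conj_l (cst c) = cst (cnj c)" "flip (conj_l p) = conj_l (flip p)"
  by (auto intro!: poly_mapping_eqI simp: lookup_add lookup_minus lookup_single when_def cst_def)

lemma flip_mult [simp]: "flip (p * q) = flip p * flip q"
proof (induction p rule: laurent_induct)
  case (single k c)
  show ?case
    by (induction q rule: laurent_induct) (auto simp: mult_single distrib_left add.commute)
qed (simp add: distrib_right)

lemma conj_l_mult [simp]: "conj_l (p * q) = conj_l p * conj_l q"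
proof (induction p rule: laurent_induct)
  case (single k c)
  show ?case
    by (induction q rule: laurent_induct) (auto simp: mult_single distrib_left)
qed (simp add: distrib_right)

lemma ev_eq_sum:
  assumes "finite K" "keys p \<subseteq> K"
  shows "ev p a = (\<Sum>k\<in>K. lookup p k * a powi k)"
  unfolding ev_def leval_def using assms by (intro sum.mono_neutral_left) (auto simp: in_keys_iff)

lemma ev_add [simp]: "ev (p + q) a = ev p a + ev q a"
  using ev_eq_sum[of "keys p \<union> keys q" p a] ev_eq_sum[of "keys p \<union> keys q" q a]
    ev_eq_sum[of "keys p \<union> keys q" "p + q" a] Poly_Mapping.keys_add[of p q]
  by (simp add: lookup_add distrib_right sum.distrib)

lemma ev_single [simp]: "ev (single k c) a = c * a powi k"
  using ev_eq_sum[of "{k}" "single k c" a] by simp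

lemma ev_zero [simp]: "ev 0 a = 0"
  using ev_single[of 0 0 a] by simp

lemma ev_uminus [simp]: "ev (- p) a = - ev p a"
  using ev_add[of p "- p" a] by (simp add: eq_neg_iff_add_eq_0 add.commute)

lemma ev_minus [simp]: "ev (p - q) a = ev p a - ev q a"
  using ev_add[of p "- q" a] by simp

lemma ev_cst [simp]: "ev (cst c) a = c"
  by (simp add: cst_def)

lemma ev_one [simp]: "ev 1 a = 1"
  using ev_cst[of 1 a] by (simp add: cst_def)

lemma ev_numeral [simp]: "ev (numeral n) a = numeral n"
  using ev_cst[of "numeral n" a] by (simp add: cst_def)

lemma ev_tvar [simp]: "ev tvar a = a"
  by (simp add: tvar_def)

lemma ev_uvar [simp]: "ev uvar a = a + inverse a"
  by (simp add: uvar_def power_int_minus)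

lemma ev_mult [simp]:
  assumes "a \<noteq> 0"
  shows "ev (p * q) a = ev p a * ev q a"
proof (induction p rule: laurent_induct)
  case (single k c)
  show ?case
    by (induction q rule: laurent_induct) (auto simp: mult_single distrib_left power_int_add assms)
qed (simp add: distrib_right)

lemma ev_prod_list [simp]: "a \<noteq> 0 \<Longrightarrow> ev (prod_list ps) a = (\<Prod>p\<leftarrow>ps. ev p a)"
  by (induction ps) auto

lemma ev_flip [simp]: "ev (flip p) a = ev p (inverse a)"
  by (induction p rule: laurent_induct) (auto simp: power_int_minus power_int_inverse)

lemma ev_conj_l [simp]: "ev (conj_l p) a = cnj (ev p (cnj a))"
proof (induction p rule: laurent_induct)
  case (single k c)
  have "cnj (x powi k) = cnj x powi k" for x by (simp add: power_int_def)
  then show ?case by simp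
qed simp

lemma cst_mult [simp]: "cst c * cst d = cst (c * d)"
  by (simp add: cst_def mult_single)

lemma cst_add: "cst (c + d) = cst c + cst d"
  by (simp add: cst_def single_add)

lemma cst_minus: "cst (- c) = - cst c"
  by (simp add: cst_def single_uminus)

lemma cst_0 [simp]: "cst 0 = 0" and cst_1 [simp]: "cst 1 = 1"
  by (simp_all add: cst_def)

lemma lookup_cst_mult [simp]: "lookup (cst c * p) k = c * lookup p k"
proof (induction p rule: laurent_induct)
  case (single j d)
  show ?case by (simp add: cst_def mult_single lookup_single when_def)
qed (simp add: distrib_left lookup_add)

lemma lookup_mult_sum:
  fixes p q :: laurent
  shows "lookup (p * q) k = (\<Sum>i\<in>keys p. lookup p i * lookup q (k - i))"
proof -
  have sup: "(\<Sum>i\<in>keys p. lookup p i * lookup q (k - i)) = (\<Sum>i\<in>K. lookup p i * lookup q (k - i))"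
    if "finite K" "keys p \<subseteq> K" for K and p :: laurent
    using that by (intro sum.mono_neutral_left) (auto simp: in_keys_iff)
  show ?thesis
  proof (induction p rule: laurent_induct)
    case (single j c)
    have "lookup (single j c * q) k = c * lookup q (k - j)"
      by (induction q rule: laurent_induct)
        (auto simp: mult_single lookup_single when_def distrib_left lookup_add algebra_simps)
    then show ?case by (subst sup[of "{j}"]) auto
  next
    case (add p1 p2)
    have "(\<Sum>i\<in>keys (p1 + p2). lookup (p1 + p2) i * lookup q (k - i)) =
      (\<Sum>i\<in>keys p1 \<union> keys p2. lookup (p1 + p2) i * lookup q (k - i))"
      using Poly_Mapping.keys_add[of p1 p2] by (intro sup) auto
    also have "\<dots> = (\<Sum>i\<in>keys p1 \<union> keys p2. lookup p1 i * lookup q (k - i))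
        + (\<Sum>i\<in>keys p1 \<union> keys p2. lookup p2 i * lookup q (k - i))"
      by (simp add: lookup_add distrib_right sum.distrib)
    also have "\<dots> = lookup (p1 * q) k + lookup (p2 * q) k"
      using add sup[of "keys p1 \<union> keys p2" p1] sup[of "keys p1 \<union> keys p2" p2] by simp
    finally show ?case by (simp add: distrib_right lookup_add)
  qed
qed

lemma lmult_lookup: "lmult (lookup p) (lookup q) = lookup (p * q)"
  unfolding lmult_def by (rule ext) (simp add: lookup_mult_sum in_keys_iff[symmetric])

text \<open>The product of t - c over the prescribed zeros, normalised at b. The point 0 is excluded
  because evaluation is multiplicative only at nonzero arguments.\<close>

lemma interpolation:
  assumes "finite B" "b \<notin> B" "b \<noteq> 0" "0 \<notin> B"
  obtains p where "ev p b = 1" "\<And>c. c \<in> B \<Longrightarrow> ev p c = 0"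
proof -
  define r where "r = (\<Prod>c\<in>B. tvar - cst c)"
  have evr: "ev r x = (\<Prod>c\<in>B. x - c)" if "x \<noteq> 0" for x
    unfolding r_def using assms(1) by (induction B rule: finite_induct) (auto simp: that)
  have "ev r b \<noteq> 0" using assms by (auto simp: evr)
  show ?thesis
  proof (rule that[of "cst (inverse (ev r b)) * r"])
    show "ev (cst (inverse (ev r b)) * r) b = 1" using \<open>ev r b \<noteq> 0\<close> assms(3) by simp
    fix c assume c: "c \<in> B"
    then have "c \<noteq> 0" using assms by auto
    then have "ev r c = 0" using c assms(1) by (auto simp: evr)
    then show "ev (cst (inverse (ev r b)) * r) c = 0" using \<open>c \<noteq> 0\<close> by simp
  qed
qed

text \<open>By linearity powers of t suffice; these are reached from exponent 0 in both
  directions.\<close>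

lemma division_by_root:
  assumes "b \<noteq> 0"
  shows "\<exists>q. p - cst (ev p b) = (tvar - cst b) * q"
proof (induction p rule: laurent_induct)
  case (add p1 p2)
  then obtain q1 q2 where q: "p1 - cst (ev p1 b) = (tvar - cst b) * q1" "p2 - cst (ev p2 b) = (tvar - cst b) * q2"
    by blast
  have "p1 + p2 - cst (ev (p1 + p2) b) = (p1 - cst (ev p1 b)) + (p2 - cst (ev p2 b))"
    by (simp add: cst_add)
  also have "\<dots> = (tvar - cst b) * (q1 + q2)" unfolding q by (simp only: distrib_left)
  finally show ?case by blast
next
  case (single k c)
  let ?ti = "single (- 1) 1 :: laurent"
  have ti: "?ti * tvar = 1" by (simp add: tvar_def mult_single)
  have bi: "cst (inverse b) * cst b = 1" using assms by simp
  have "\<exists>q. single k 1 = (tvar - cst b) * q + cst (b powi k)"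
  proof (induction k rule: int_induct[of _ 0])
    case base
    show ?case by (intro exI[of _ 0]) (simp add: cst_def)
  next
    case (step1 i)
    then obtain q where q: "single i 1 = (tvar - cst b) * q + cst (b powi i)" by blast
    have "single (i + 1) 1 = tvar * single i 1" by (simp add: tvar_def mult_single add.commute)
    also have "\<dots> = (tvar - cst b) * (tvar * q + cst (b powi i)) + cst b * cst (b powi i)"
      unfolding q by (simp only: algebra_simps)
    also have "cst b * cst (b powi i) = cst (b powi (i + 1))"
      using assms by (simp add: power_int_add mult.commute)
    finally show ?case by blast
  next
    case (step2 i)
    then obtain q where q: "single i 1 = (tvar - cst b) * q + cst (b powi i)" by blast
    let ?B = "cst (b powi i)" and ?bi = "cst (inverse b)"
    have "single (i - 1) 1 = ?ti * single i 1" by (simp add: mult_single)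
    \<comment> \<open>The factor 1 = b^-1 b is inserted for the sake of t^-1 b = 1 - t^-1 (t - b),
      which splits off another multiple of t - b.\<close>
    also have "\<dots> = ?ti * (tvar - cst b) * q + ?B * ?ti * (?bi * cst b)"
      unfolding q bi by (simp only: algebra_simps mult_1_right mult_1_left)
    also have "\<dots> = (tvar - cst b) * (?ti * q - ?B * ?ti * ?bi) + ?B * ?bi * (?ti * tvar)"
      by (simp only: algebra_simps)
    also have "?B * ?bi * (?ti * tvar) = cst (b powi (i - 1))"
      unfolding ti using assms by (simp add: power_int_diff divide_inverse)
    finally show ?case by blast
  qed
  then obtain q where q: "single k 1 = (tvar - cst b) * q + cst (b powi k)" by blast
  have "single k c - cst (ev (single k c) b) = cst c * single k 1 - cst c * cst (b powi k)"
    by (simp add: cst_def mult_single)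
  also have "\<dots> = (tvar - cst b) * (cst c * q)"
    unfolding q by (simp only: algebra_simps add_diff_cancel_left' add_diff_cancel_right')
  finally show ?case by blast
qed

lemma lookup_numeral_mult [simp]: "lookup (numeral n * p) k = numeral n * lookup (p :: laurent) k"
  using lookup_cst_mult[of "numeral n" p k] by (simp add: cst_def)

text \<open>The factor 2 makes \<open>ahat a\<close> = c the condition for vanishing at a nonzero a.
  The list keeps multiplicities, and every such product is symmetric, so multiplication by it
  preserves the Onsager algebra.\<close>

definition upoly :: "complex list \<Rightarrow> laurent" where
  "upoly cs = (\<Prod>c\<leftarrow>cs. uvar - cst (2 * c))"

lemma flip_upoly [simp]: "flip (upoly cs) = upoly cs"
  unfolding upoly_def by (induction cs) auto

lemma upoly_simps [simp]: "upoly [] = 1" "upoly (c # cs) = (uvar - cst (2 * c)) * upoly cs"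
  "upoly (cs @ ds) = upoly cs * upoly ds"
  by (simp_all add: upoly_def)

lemma uvar_factor:
  assumes "a \<noteq> 0"
  shows "uvar - cst (2 * ahat a) = single (- 1) 1 * ((tvar - cst a) * (tvar - cst (inverse a)))"
proof -
  let ?ti = "single (- 1) 1 :: laurent" and ?A = "cst a" and ?B = "cst (inverse a)"
  have ti: "?ti * tvar = 1" by (simp add: tvar_def mult_single)
  have AB: "?A * ?B = 1" using assms by simp
  have "?ti * ((tvar - ?A) * (tvar - ?B)) = (?ti * tvar) * tvar - (?A + ?B) * (?ti * tvar) + (?A * ?B) * ?ti"
    by (simp only: algebra_simps)
  also have "\<dots> = uvar - (?A + ?B)" unfolding ti AB by (simp add: uvar_def tvar_def)
  also have "?A + ?B = cst (2 * ahat a)"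
  proof -
    have "2 * ahat a = a + inverse a" by (simp add: ahat_def)
    then show ?thesis by (simp only: cst_add)
  qed
  finally show ?thesis by simp
qed

text \<open>The factors t - a and t - 1/a split off one at a time. Neither vanishes at another b or
  1/b, so the cofactor inherits the zeros there; the leftover power of t is a unit.\<close>

lemma divisible_by_upoly:
  assumes "distinct (as @ map inverse as)" "0 \<notin> set as"
    and "\<And>a. a \<in> set as \<Longrightarrow> ev p a = 0 \<and> ev p (inverse a) = 0"
  shows "\<exists>q. p = upoly (map ahat as) * q"
  using assms
proof (induction as arbitrary: p)
  case (Cons a as)
  have a: "a \<noteq> 0" "inverse a \<noteq> 0" "a \<noteq> inverse a" using Cons.prems by auto
  obtain q where q: "p = (tvar - cst a) * q"
    using division_by_root[OF a(1), of p] Cons.prems(3)[of a] by auto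
  have "ev q (inverse a) = 0" using Cons.prems(3)[of a] a unfolding q by auto
  then obtain r where r: "q = (tvar - cst (inverse a)) * r"
    using division_by_root[OF a(2), of q] by auto
  have "\<exists>s. r = upoly (map ahat as) * s"
  proof (rule Cons.IH)
    fix b assume b: "b \<in> set as"
    then have "b \<noteq> 0" "a \<noteq> b" "a \<noteq> inverse b" "inverse a \<noteq> b" "inverse a \<noteq> inverse b"
      using Cons.prems(1,2) by auto
    then show "ev r b = 0 \<and> ev r (inverse b) = 0"
      using Cons.prems(3)[of b] b unfolding q r by auto
  qed (use Cons.prems in auto)
  then obtain s where s: "r = upoly (map ahat as) * s" by blast
  have "single 1 1 * single (- 1) 1 = (1 :: laurent)" by (simp add: mult_single)
  then have "p = (uvar - cst (2 * ahat a)) * (upoly (map ahat as) * (single 1 1 * s))"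
    unfolding q r s uvar_factor[OF a(1)] by (simp add: mult.assoc mult.left_commute)
  then show ?case by (auto simp: mult.assoc)
qed (auto intro: exI[of _ p])

text \<open>The element \<open>p(t) e + p(t\<^sup>-\<^sup>1) f + q(t) h\<close>; it lies in the Onsager algebra exactly when \<open>flip q = - q\<close>.\<close>

definition oa :: "laurent \<Rightarrow> laurent \<Rightarrow> loop" where
  "oa p q = (lookup p, lookup (flip p), lookup q)"

lemma oa_in_OA [simp]: "flip q = - q \<Longrightarrow> oa p q \<in> OA"
proof -
  assume "flip q = - q"
  then have "lookup q (- k) = - lookup q k" for k by (metis lookup_flip lookup_uminus)
  moreover have "lookup (flip p) = lrev (lookup p)" by (auto simp: lrev_def)
  moreover have "is_lpoly (lookup r)" for r by (simp add: is_lpoly_def)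
  ultimately show ?thesis unfolding oa_def OA_def by blast
qed

lemma OA_cases:
  assumes "X \<in> OA"
  obtains p q where "X = oa p q" "flip q = - q"
proof -
  from assms obtain p q where pq: "X = (p, lrev p, q)" "is_lpoly p" "is_lpoly q" "\<And>k. q (- k) = - q k"
    unfolding OA_def by blast
  have lp: "lookup (Abs_poly_mapping p) = p" "lookup (Abs_poly_mapping q) = q"
    using pq(2,3) by (auto simp: is_lpoly_def)
  have "lookup (flip (Abs_poly_mapping p)) = lrev p" by (rule ext) (simp add: lp lrev_def)
  then have "X = oa (Abs_poly_mapping p) (Abs_poly_mapping q)" unfolding oa_def lp pq(1) by simp
  moreover have "flip (Abs_poly_mapping q) = - Abs_poly_mapping q"
    by (rule poly_mapping_eqI) (simp add: lp pq(4))
  ultimately show ?thesis by (rule that)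
qed

lemma loop_add_oa: "loop_add (oa p q) (oa p' q') = oa (p + p') (q + q')"
  by (simp add: loop_add_def oa_def fun_eq_iff lookup_add)

lemma loop_smult_oa: "loop_smult c (oa p q) = oa (cst c * p) (cst c * q)"
  by (simp add: loop_smult_def oa_def fun_eq_iff)

lemma loop_bracket_oa:
  assumes "flip q = - q" "flip q' = - q'"
  shows "loop_bracket (oa p q) (oa p' q') = oa (2 * (q * p' - p * q')) (p * flip p' - flip p * p')"
  unfolding loop_bracket_def oa_def prod.case lmult_lookup prod.inject
  using assms by (auto simp: fun_eq_iff lookup_minus mult.commute[of "flip p"] right_diff_distrib)

lemma A_elt_oa: "A_elt m = oa (single m 2) 0"
  by (auto simp: A_elt_def oa_def lookup_single when_def fun_eq_iff)

lemma ev_rep_oa: "ev_rep m a (oa p q) = ev p a \<cdot>\<^sub>m sl2_E m + ev p (inverse a) \<cdot>\<^sub>m sl2_F m + ev q a \<cdot>\<^sub>m sl2_H m"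
  by (simp add: ev_rep_def oa_def ev_def[symmetric])

text \<open>The simplest skew element t - 1/t. Multiplication by it exchanges symmetric and skew
  elements, at the price of zeros at 1 and -1.\<close>

definition wvar :: laurent where "wvar = single 1 1 - single (- 1) 1"

lemma flip_wvar [simp]: "flip wvar = - wvar"
  by (simp add: wvar_def)

lemma wvar_square: "wvar * wvar = upoly [1, - 1]"
proof -
  have c: "cst (2 * (- 1)) = - cst (2 * 1)" by (simp add: cst_minus[symmetric])
  have "wvar * wvar = uvar * uvar - 4"
    unfolding wvar_def uvar_def by (simp add: left_diff_distrib right_diff_distrib distrib_left distrib_right mult_single)
  also have "\<dots> = upoly [1, - 1]"
    unfolding upoly_simps c by (simp add: left_diff_distrib right_diff_distrib distrib_left distrib_right cst_def)
  finally show ?thesis .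
qed

lemma uvar_minus_cst_nonzero: "uvar - cst c \<noteq> 0"
proof
  assume "uvar - cst c = 0"
  then have "lookup (uvar - cst c) 1 = 0" by simp
  then show False by (simp add: uvar_def cst_def lookup_minus lookup_add lookup_single)
qed

lemma upoly_nonzero: "upoly cs \<noteq> 0"
proof (induction cs)
  case (Cons c cs)
  then show ?case using uvar_minus_cst_nonzero[of "2 * c"] by (simp del: eq_iff_diff_eq_0 right_minus_eq)
qed simp

lemma upoly_perm: "mset cs = mset ds \<Longrightarrow> upoly cs = upoly ds"
  unfolding upoly_def by (metis mset_map prod_mset_prod_list)

text \<open>For symmetric g the bracket of \<open>oa g 0\<close> and \<open>oa p 0\<close> has
  h-coordinate g (flip p - p); hence every skew multiple of g occurs there.\<close>

lemma half_skew:
  assumes "flip q = - q"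
  shows "\<exists>p. flip p - p = q"
proof -
  have "cst (1/2) * q + cst (1/2) * q = q"
    unfolding distrib_right[symmetric] cst_add[symmetric] by simp
  then show ?thesis using assms by (intro exI[of _ "- (cst (1/2) * q)"]) simp
qed

lemma sym_skew_decomp: "\<exists>s a. p = s + a \<and> flip s = s \<and> flip a = - a" for p :: laurent
proof (intro exI conjI)
  have "cst (1/2) * p + cst (1/2) * p = p"
    unfolding distrib_right[symmetric] cst_add[symmetric] by simp
  then show "p = cst (1/2) * (p + flip p) + cst (1/2) * (p - flip p)" by (simp add: algebra_simps)
qed (simp_all add: algebra_simps)

lemma ev_skew_zero: "flip q = - q \<Longrightarrow> inverse c = c \<Longrightarrow> ev q c = 0"
  using ev_flip[of q c] by simp

text \<open>The two coordinates of the bracket of \<open>oa p q\<close> and \<open>oa p' q'\<close>.\<close>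

definition br_p :: "laurent \<Rightarrow> laurent \<Rightarrow> laurent \<Rightarrow> laurent \<Rightarrow> laurent" where
  "br_p p q p' q' = 2 * (q * p' - p * q')"

definition br_q :: "laurent \<Rightarrow> laurent \<Rightarrow> laurent" where
  "br_q p p' = p * flip p' - flip p * p'"

lemma flip_br_q [simp]: "flip (br_q p p') = - br_q p p'"
  by (simp add: br_q_def)

text \<open>A complex polynomial splits by the fundamental theorem of algebra, and the ring
  homomorphism \<open>cst\<close> carries the splitting over to its value at u. The roots are halved
  because \<open>upoly\<close> doubles them.\<close>

lemma poly_uvar_factor:
  assumes "\<exists>k\<le>N. c k \<noteq> 0"
  obtains l cs where "l \<noteq> 0" "(\<Sum>k\<le>N. cst (c k) * uvar ^ k) = cst l * upoly cs"
proof -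
  interpret cst: comm_ring_hom cst
    by unfold_locales (auto simp: cst_add cst_minus)
  interpret map_poly_comm_ring_hom cst ..
  define Q where "Q = (\<Sum>k\<le>N. monom (c k) k)"
  have "coeff Q k = c k" if "k \<le> N" for k
    using that unfolding Q_def by (simp add: coeff_sum when_def if_distrib cong: if_cong)
  then have Q: "Q \<noteq> 0" using assms by fastforce
  obtain as where as: "Q = smult (coeff Q (degree Q)) (\<Prod>a\<leftarrow>as. [:- a, 1:])"
    using fundamental_theorem_algebra_factorized[of Q] by metis
  define l where "l = coeff Q (degree Q)"
  define cs where "cs = map (\<lambda>a. a / 2) as"
  have "poly (map_poly cst Q) uvar = (\<Sum>k\<le>N. cst (c k) * uvar ^ k)"
    unfolding Q_def by (simp add: hom_distribs poly_sum poly_monom)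
  moreover have "poly (map_poly cst Q) uvar = cst l * upoly cs"
  proof -
    have "poly (map_poly cst (\<Prod>a\<leftarrow>as. [:- a, 1:])) uvar = upoly cs"
      unfolding cs_def by (induction as) (auto simp: hom_distribs cst_minus left_diff_distrib)
    then show ?thesis by (subst as) (simp add: l_def hom_distribs)
  qed
  ultimately show ?thesis using that[of l cs] Q by (simp add: l_def)
qed

section \<open>Abelian ideals and the support of an irreducible representation\<close>

locale oa_rep =
  fixes d :: nat and \<rho> :: "loop \<Rightarrow> complex mat"
  assumes rep: "is_sl_rep d \<rho>"
begin

definition T :: "laurent \<Rightarrow> laurent \<Rightarrow> complex mat" where
  "T p q = \<rho> (oa p q)"

lemma T_carrier [simp]: "flip q = - q \<Longrightarrow> T p q \<in> carrier_mat d d"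
  using rep unfolding is_sl_rep_def T_def by simp

lemma T_dim [simp]: "flip q = - q \<Longrightarrow> dim_row (T p q) = d" "flip q = - q \<Longrightarrow> dim_col (T p q) = d"
  using T_carrier by (metis carrier_matD)+

lemma T_trace: "flip q = - q \<Longrightarrow> mat_trace (T p q) = 0"
  using rep unfolding is_sl_rep_def T_def by simp

lemma T_add: "flip q = - q \<Longrightarrow> flip q' = - q' \<Longrightarrow> T (p + p') (q + q') = T p q + T p' q'"
  using rep unfolding is_sl_rep_def T_def by (simp add: loop_add_oa[symmetric])

lemma T_cst: "flip q = - q \<Longrightarrow> T (cst c * p) (cst c * q) = c \<cdot>\<^sub>m T p q"
  using rep unfolding is_sl_rep_def T_def by (simp add: loop_smult_oa[symmetric])

lemma T_bracket: "flip q = - q \<Longrightarrow> flip q' = - q' \<Longrightarrow>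
    T (br_p p q p' q') (br_q p p') = T p q * T p' q' - T p' q' * T p q"
  using rep loop_bracket_oa[of q q' p p'] unfolding is_sl_rep_def T_def br_p_def br_q_def
  by (metis oa_in_OA)

lemma T_image: "\<rho> ` OA = {T p q | p q. flip q = - q}"
proof
  show "\<rho> ` OA \<subseteq> {T p q | p q. flip q = - q}" unfolding T_def using OA_cases by blast
qed (auto simp: T_def)

lemma T_zero [simp]: "T 0 0 = 0\<^sub>m d d"
proof -
  have c: "T 0 0 \<in> carrier_mat d d" by simp
  have "T 0 0 = 0 \<cdot>\<^sub>m T 0 0" using T_cst[of 0 0 0] by simp
  also have "\<dots> = 0\<^sub>m d d" using c by (intro eq_matI) auto
  finally show ?thesis .
qed

lemma T_zero_add:
  "flip q = - q \<Longrightarrow> flip q' = - q' \<Longrightarrow> T p q = 0\<^sub>m d d \<Longrightarrow> T p' q' = 0\<^sub>m d d \<Longrightarrow> T (p + p') (q + q') = 0\<^sub>m d d"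
  by (simp add: T_add)

lemma T_zero_cst: "flip q = - q \<Longrightarrow> T p q = 0\<^sub>m d d \<Longrightarrow> T (cst c * p) (cst c * q) = 0\<^sub>m d d"
  by (simp add: T_cst)

lemma T_zero_cst_iff: "flip q = - q \<Longrightarrow> c \<noteq> 0 \<Longrightarrow> T (cst c * p) (cst c * q) = 0\<^sub>m d d \<Longrightarrow> T p q = 0\<^sub>m d d"
  using T_zero_cst[of "cst c * q" "cst c * p" "inverse c"] by (simp add: mult.assoc[symmetric])

lemma T_zero_bracket:
  assumes "flip q = - q" "flip q' = - q'" "T p q = 0\<^sub>m d d"
  shows "T (br_p p q p' q') (br_q p p') = 0\<^sub>m d d"
proof -
  have "0\<^sub>m d d * T p' q' = 0\<^sub>m d d" "T p' q' * 0\<^sub>m d d = 0\<^sub>m d d"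
    using T_carrier[OF assms(2), of p'] by (metis left_mult_zero_mat right_mult_zero_mat)+
  then show ?thesis using assms by (simp add: T_bracket)
qed

definition annihilates :: "complex list \<Rightarrow> bool" where
  "annihilates cs \<longleftrightarrow> (\<forall>p q. flip q = - q \<longrightarrow> T (upoly cs * p) (upoly cs * q) = 0\<^sub>m d d)"

lemma T_sum:
  assumes "finite K" "i < d" "j < d"
  shows "T (\<Sum>k\<in>K. cst (c k) * g k) 0 $$ (i, j) = (\<Sum>k\<in>K. c k * T (g k) 0 $$ (i, j))"
  using assms(1)
proof (induction K rule: finite_induct)
  case (insert x K)
  have "T (cst (c x) * g x + (\<Sum>k\<in>K. cst (c k) * g k)) (cst (c x) * 0 + 0) =
      c x \<cdot>\<^sub>m T (g x) 0 + T (\<Sum>k\<in>K. cst (c k) * g k) 0"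
    by (subst T_add) (simp_all add: T_cst[of 0, simplified])
  then show ?case using insert assms T_carrier[of 0 "g x"] T_carrier[of 0 "\<Sum>k\<in>K. cst (c k) * g k"]
    by simp
qed (use assms in simp)

text \<open>The d^2 + 1 matrices \<open>T (uvar ^ k) 0\<close> are dependent, so S (e + f) acts by 0
  for some S = \<open>upoly cs\<close>. Brackets spread this to S p for skew p and to S q for all
  skew q. For symmetric p a further factor u^2 - 4 is picked up, hence the appended entries 1 and
  -1.\<close>

lemma exists_annihilator: "\<exists>cs. annihilates cs"
proof -
  obtain c where c: "\<exists>k\<le>d * d. c k \<noteq> 0"
    "\<And>i. i < d * d \<Longrightarrow> (\<Sum>k\<le>d * d. c k * T (uvar ^ k) 0 $$ (i div d, i mod d)) = 0"
    using linear_dependence[of "d * d" "\<lambda>k i. T (uvar ^ k) 0 $$ (i div d, i mod d)"] by blast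
  obtain l cs where l: "l \<noteq> 0" "(\<Sum>k\<le>d * d. cst (c k) * uvar ^ k) = cst l * upoly cs"
    using poly_uvar_factor[OF c(1)] by blast
  let ?S = "upoly cs"
  have "T (cst l * ?S) 0 = 0\<^sub>m d d"
  proof (rule eq_matI)
    fix i j assume ij: "i < dim_row (0\<^sub>m d d :: complex mat)" "j < dim_col (0\<^sub>m d d :: complex mat)"
    then have "i * d + j < Suc i * d" "Suc i * d \<le> d * d" by (simp, intro mult_le_mono1, simp)
    then have "i * d + j < d * d" by linarith
    from c(2)[OF this] ij show "T (cst l * ?S) 0 $$ (i, j) = 0\<^sub>m d d $$ (i, j)"
      unfolding l(2)[symmetric] by (simp add: T_sum)
  qed (use T_carrier[of 0 "cst l * ?S"] in auto)
  then have S: "T ?S 0 = 0\<^sub>m d d" using T_zero_cst_iff[of 0 l ?S] l(1) by simp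
  have p_skew: "T (?S * q) 0 = 0\<^sub>m d d" if q: "flip q = - q" for q
  proof -
    have "T (cst (- 2) * (?S * q)) (cst (- 2) * 0) = 0\<^sub>m d d"
      using T_zero_bracket[of 0 q ?S 0] q S
      by (simp add: br_p_def br_q_def cst_minus) (simp add: cst_def mult.assoc)
    then show ?thesis by (rule T_zero_cst_iff[rotated 2]) simp_all
  qed
  \<comment> \<open>The bracket of S (e + f) with \<open>oa p 0\<close> has p-coordinate 0 and
    h-coordinate S (flip p - p).\<close>
  have q_skew: "T 0 (?S * q) = 0\<^sub>m d d" if q: "flip q = - q" for q
  proof -
    obtain p where p: "flip p - p = q" using half_skew[OF q] by blast
    show ?thesis using T_zero_bracket[of 0 0 ?S p] S p
      by (simp add: br_p_def br_q_def right_diff_distrib[symmetric])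
  qed
  let ?W = "upoly [1, - 1]"
  \<comment> \<open>With w = t - 1/t, the bracket of S w h with \<open>oa (s * wvar) 0\<close> has
    p-coordinate 2 S w^2 s, and w^2 = u^2 - 4.\<close>
  have p_sym: "T (?S * ?W * s) 0 = 0\<^sub>m d d" if s: "flip s = s" for s
  proof -
    have "T (cst 2 * (?S * ?W * s)) (cst 2 * 0) = 0\<^sub>m d d"
      using T_zero_bracket[of "?S * wvar" 0 0 "s * wvar"] q_skew[of wvar] s
      unfolding wvar_square[symmetric]
      by (simp add: br_p_def br_q_def) (simp add: cst_def ac_simps)
    then show ?thesis by (rule T_zero_cst_iff[rotated 2]) simp_all
  qed
  have "annihilates (cs @ [1, - 1])"
    unfolding annihilates_def
  proof (intro allI impI)
    fix p q :: laurent assume q: "flip q = - q"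
    obtain s a where sa: "p = s + a" "flip s = s" "flip a = - a" using sym_skew_decomp[of p] by blast
    have "T (?S * ?W * s + (?S * (?W * a) + 0)) (0 + (0 + ?S * (?W * q))) = 0\<^sub>m d d"
      using q sa p_sym[of s] p_skew[of "?W * a"] q_skew[of "?W * q"]
      by (intro T_zero_add) (simp_all del: upoly_simps)
    then show "T (upoly (cs @ [1, - 1]) * p) (upoly (cs @ [1, - 1]) * q) = 0\<^sub>m d d"
      unfolding upoly_simps(3) sa(1) by (simp add: algebra_simps del: upoly_simps)
  qed
  then show ?thesis by blast
qed

end

locale oa_irrep = oa_rep +
  assumes irr: "irreducible_rep d \<rho>"
begin

lemma irreducible_image: "irreducible_set d (\<rho> ` OA)"
  using irr unfolding irreducible_rep_def irreducible_set_def by auto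

text \<open>Pairs of coordinates stand for elements of the algebra. Only the images have to commute:
  brackets within the ideal must lie in the kernel of \<open>T\<close>, without being 0 in the
  algebra.\<close>

lemma abelian_ideal_T:
  assumes I: "\<And>p q. (p, q) \<in> I \<Longrightarrow> flip q = - q"
    and ideal: "\<And>p q p' q'. (p, q) \<in> I \<Longrightarrow> flip q' = - q' \<Longrightarrow> (br_p p q p' q', br_q p p') \<in> I"
    and abelian: "\<And>p q p' q'. (p, q) \<in> I \<Longrightarrow> (p', q') \<in> I \<Longrightarrow> T (br_p p q p' q') (br_q p p') = 0\<^sub>m d d"
    and pq: "(p, q) \<in> I"
  shows "T p q = 0\<^sub>m d d"
proof (rule abelian_ideal_zero[OF irreducible_image])
  let ?D = "{T p q | p q. (p, q) \<in> I}"
  show "\<rho> ` OA \<subseteq> carrier_mat d d" unfolding T_image by auto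
  show "?D \<subseteq> \<rho> ` OA" unfolding T_image using I by blast
  show "T p q \<in> ?D" using pq by blast
  show "mat_trace X = 0" if "X \<in> ?D" for X using that I T_trace by blast
  show "X * Y = Y * X" if XY: "X \<in> ?D" "Y \<in> ?D" for X Y
  proof -
    from XY obtain p q p' q' where *: "X = T p q" "Y = T p' q'" "(p, q) \<in> I" "(p', q') \<in> I" by blast
    then have "X * Y - Y * X = 0\<^sub>m d d" using T_bracket I abelian by metis
    then show ?thesis using * I T_carrier by (intro commute_of_commutator_zero) auto
  qed
  show "X * Y - Y * X \<in> ?D" if "X \<in> ?D" "Y \<in> \<rho> ` OA" for X Y
  proof -
    from that(1) obtain p q where *: "X = T p q" "(p, q) \<in> I" by blast
    from that(2) obtain p' q' where **: "Y = T p' q'" "flip q' = - q'" unfolding T_image by blast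
    have "X * Y - Y * X = T (br_p p q p' q') (br_q p p')" using * ** I T_bracket by simp
    then show ?thesis using ideal[OF *(2) **(2)] by blast
  qed
qed

lemma br_scale:
  assumes "flip g = g"
  shows "br_p (g * p) (g * q) p' q' = g * br_p p q p' q'" "br_q (g * p) p' = g * br_q p p'"
    "br_p p q (g * p') (g * q') = g * br_p p q p' q'" "br_q p (g * p') = g * br_q p p'"
  using assms by (simp_all add: br_p_def br_q_def algebra_simps)

text \<open>If c still occurs in \<open>cs\<close>, then g = \<open>upoly cs\<close> equals (u - 2c)
  h, so g g x = \<open>upoly (c # cs)\<close> h x. Brackets of two multiples of g therefore act by
  0, and the multiples of g form an abelian ideal on V.\<close>

lemma annihilates_repeated:
  assumes ann: "annihilates (c # cs)" and c: "c \<in> set cs"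
  shows "annihilates cs"
proof -
  let ?g = "upoly cs"
  obtain h where h: "?g = (uvar - cst (2 * c)) * h" "flip h = h"
  proof -
    have "mset cs = mset (c # remove1 c cs)" using c by simp
    from upoly_perm[OF this] show ?thesis by (intro that[of "upoly (remove1 c cs)"]) auto
  qed
  define I where "I = {(?g * p, ?g * q) | p q. flip q = - q}"
  have "T p q = 0\<^sub>m d d" if "(p, q) \<in> I" for p q
    using _ _ _ that
  proof (rule abelian_ideal_T)
    show "flip q = - q" if "(p, q) \<in> I" for p q using that unfolding I_def by auto
    show "(br_p p q p' q', br_q p p') \<in> I" if pq: "(p, q) \<in> I" "flip q' = - q'" for p q p' q'
    proof -
      obtain p0 q0 where "p = ?g * p0" "q = ?g * q0" "flip q0 = - q0" using pq unfolding I_def by blast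
      then have "br_p p q p' q' = ?g * br_p p0 q0 p' q'" "br_q p p' = ?g * br_q p0 p'"
        by (simp_all add: br_scale)
      then show ?thesis unfolding I_def using flip_br_q by blast
    qed
    show "T (br_p p q p' q') (br_q p p') = 0\<^sub>m d d" if pq: "(p, q) \<in> I" "(p', q') \<in> I" for p q p' q'
    proof -
      obtain p0 q0 p1 q1 where *: "p = ?g * p0" "q = ?g * q0" "p' = ?g * p1" "q' = ?g * q1"
        using pq unfolding I_def by blast
      have gg: "?g * (?g * x) = upoly (c # cs) * (h * x)" for x
        unfolding upoly_simps by (subst (2) h(1)) (simp only: ac_simps)
      have "br_p p q p' q' = upoly (c # cs) * (h * br_p p0 q0 p1 q1)"
        "br_q p p' = upoly (c # cs) * (h * br_q p0 p1)"
        unfolding * gg[symmetric] by (simp_all add: br_scale)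
      then show ?thesis using ann h(2) unfolding annihilates_def by simp
    qed
  qed
  then show ?thesis unfolding annihilates_def I_def by blast
qed

text \<open>At a fixed point u - 2c = t^-1 (t - c)^2, and each of the two elements supplies one
  factor t - c.\<close>

lemma double_root_divides:
  assumes c: "c \<in> {1, - 1}" and "ev p c = 0" "ev q c = 0"
  shows "\<exists>r. p * q = (uvar - cst (2 * c)) * r"
proof -
  have c0: "c \<noteq> 0" "inverse c = c" "ahat c = c" using c by (auto simp: ahat_def)
  obtain p1 q1 where "p = (tvar - cst c) * p1" "q = (tvar - cst c) * q1"
    using division_by_root[OF c0(1), of p] division_by_root[OF c0(1), of q] assms by auto
  moreover have "single 1 1 * single (- 1) 1 = (1 :: laurent)" by (simp add: mult_single)
  ultimately have "p * q = (uvar - cst (2 * c)) * (single 1 1 * p1 * q1)"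
    using uvar_factor[OF c0(1)] unfolding c0 by (simp only: ac_simps) (simp add: mult.assoc[symmetric])
  then show ?thesis by blast
qed

text \<open>At a fixed point \<open>c = \<plusminus>1\<close> of \<open>t \<mapsto> t\<^sup>-\<^sup>1\<close> the fibre of the Onsager algebra is a solvable
  three-dimensional algebra; its derived algebra is cut out by \<open>p(c) = 0\<close>. Hence two applications of
  the lemma on abelian ideals.\<close>

lemma annihilates_fixed_point:
  assumes ann: "annihilates (c # cs)" and c: "c \<in> {1, - 1}"
  shows "annihilates cs"
proof -
  let ?g = "upoly cs" and ?v = "uvar - cst (2 * c)"
  have c0: "c \<noteq> 0" "inverse c = c" using c by auto
  have br_ev: "ev (br_p p q p' q') c = 0" if "flip q = - q" "flip q' = - q'" for p q p' q'
    using that c0 by (simp add: br_p_def ev_skew_zero)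
  have gg: "?g * (?g * (?v * x)) = upoly (c # cs) * (?g * x)" for x
    by (simp only: upoly_simps ac_simps)
  define I1 where "I1 = {(?g * p, ?g * q) | p q. flip q = - q \<and> ev p c = 0}"
  have I1: "T p q = 0\<^sub>m d d" if "(p, q) \<in> I1" for p q
    using _ _ _ that
  proof (rule abelian_ideal_T)
    show "flip q = - q" if "(p, q) \<in> I1" for p q using that unfolding I1_def by auto
    show "(br_p p q p' q', br_q p p') \<in> I1" if pq: "(p, q) \<in> I1" "flip q' = - q'" for p q p' q'
    proof -
      obtain p0 q0 where *: "p = ?g * p0" "q = ?g * q0" "flip q0 = - q0" using pq unfolding I1_def by blast
      then have "br_p p q p' q' = ?g * br_p p0 q0 p' q'" "br_q p p' = ?g * br_q p0 p'"
        by (simp_all add: br_scale)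
      then show ?thesis unfolding I1_def using flip_br_q br_ev[OF *(3) pq(2)] by blast
    qed
    show "T (br_p p q p' q') (br_q p p') = 0\<^sub>m d d" if pq: "(p, q) \<in> I1" "(p', q') \<in> I1" for p q p' q'
    proof -
      obtain p0 q0 p1 q1 where *: "p = ?g * p0" "q = ?g * q0" "p' = ?g * p1" "q' = ?g * q1"
        and z: "flip q0 = - q0" "flip q1 = - q1" "ev p0 c = 0" "ev p1 c = 0"
        using pq unfolding I1_def by blast
      \<comment> \<open>Skew elements vanish at c, and \<open>flip\<close> does not change values
        there. So every factor in the two coordinates of the bracket is 0 at c, and all four
        products are divisible by u - 2c.\<close>
      have zz: "ev q0 c = 0" "ev q1 c = 0" "ev (flip p0) c = 0" "ev (flip p1) c = 0"
        using z c0 by (simp_all add: ev_skew_zero)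
      obtain r1 r2 r3 r4 where r: "q0 * p1 = ?v * r1" "p0 * q1 = ?v * r2"
        "p0 * flip p1 = ?v * r3" "flip p0 * p1 = ?v * r4"
        using double_root_divides[OF c] z zz by meson
      define P where "P = 2 * (r1 - r2)"
      define Q where "Q = r3 - r4"
      have P: "br_p p0 q0 p1 q1 = ?v * P" unfolding br_p_def r P_def by (simp only: algebra_simps)
      have Q: "br_q p0 p1 = ?v * Q" unfolding br_q_def r Q_def by (simp only: algebra_simps)
      \<comment> \<open>The quotient is skew because the nonzero factor u - 2c can be
        cancelled.\<close>
      have "?v * flip Q = ?v * (- Q)" using flip_br_q[of p0 p1] unfolding Q by simp
      then have fQ: "flip Q = - Q" using uvar_minus_cst_nonzero mult_cancel_left by metis
      have "br_p p q p' q' = upoly (c # cs) * (?g * P)" "br_q p p' = upoly (c # cs) * (?g * Q)"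
        unfolding gg[symmetric] P[symmetric] Q[symmetric] * by (simp_all add: br_scale)
      then show ?thesis using ann fQ unfolding annihilates_def by simp
    qed
  qed
  \<comment> \<open>Second round: p-coordinates of brackets vanish at c, since q(c) = 0 for skew q.
    So brackets of multiples of g fall into \<open>I1\<close>, which is now known to act by
    0.\<close>
  define I where "I = {(?g * p, ?g * q) | p q. flip q = - q}"
  have "T p q = 0\<^sub>m d d" if "(p, q) \<in> I" for p q
    using _ _ _ that
  proof (rule abelian_ideal_T)
    show "flip q = - q" if "(p, q) \<in> I" for p q using that unfolding I_def by auto
    show "(br_p p q p' q', br_q p p') \<in> I" if pq: "(p, q) \<in> I" "flip q' = - q'" for p q p' q'
    proof -
      obtain p0 q0 where "p = ?g * p0" "q = ?g * q0" "flip q0 = - q0" using pq unfolding I_def by blast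
      then have "br_p p q p' q' = ?g * br_p p0 q0 p' q'" "br_q p p' = ?g * br_q p0 p'"
        by (simp_all add: br_scale)
      then show ?thesis unfolding I_def using flip_br_q by blast
    qed
    show "T (br_p p q p' q') (br_q p p') = 0\<^sub>m d d" if pq: "(p, q) \<in> I" "(p', q') \<in> I" for p q p' q'
    proof -
      obtain p0 q0 p1 q1 where *: "p = ?g * p0" "q = ?g * q0" "p' = ?g * p1" "q' = ?g * q1"
        and z: "flip q0 = - q0" "flip q1 = - q1"
        using pq unfolding I_def by blast
      have "ev (?g * br_p p0 q0 p1 q1) c = 0" "flip (?g * br_q p0 p1) = - (?g * br_q p0 p1)"
        using br_ev[OF z] c0 by simp_all
      then have "(?g * (?g * br_p p0 q0 p1 q1), ?g * (?g * br_q p0 p1)) \<in> I1"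
        unfolding I1_def using c0 br_ev[OF z] by (intro CollectI exI conjI) (auto simp: br_scale)
      then show ?thesis unfolding * by (intro I1) (simp add: br_scale)
    qed
  qed
  then show ?thesis unfolding annihilates_def I_def by blast
qed

text \<open>The value of q at 1/b is not listed because skewness makes it the negative of the value
  at b.\<close>

definition kills :: "complex set \<Rightarrow> bool" where
  "kills B \<longleftrightarrow> (\<forall>p q. flip q = - q \<longrightarrow>
     (\<forall>b\<in>B. ev p b = 0 \<and> ev p (inverse b) = 0 \<and> ev q b = 0) \<longrightarrow> T p q = 0\<^sub>m d d)"

text \<open>With s^2 = c^2 - 1 the numbers c + s and c - s are inverse to each other and have mean
  c.\<close>

lemma exists_ahat: "\<exists>a. a \<noteq> 0 \<and> ahat a = c"
proof -
  define s where "s = csqrt (c\<^sup>2 - 1)"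
  have s: "(c + s) * (c - s) = 1"
  proof -
    have "(c + s) * (c - s) = c\<^sup>2 - s\<^sup>2" by (simp add: power2_eq_square square_diff_square_factored)
    then show ?thesis by (simp add: s_def)
  qed
  then have "c + s \<noteq> 0" "inverse (c + s) = c - s" by (auto simp: inverse_unique)
  then show ?thesis by (intro exI[of _ "c + s"]) (simp add: ahat_def)
qed

text \<open>A shortest annihilating list has distinct entries, none of them 1 or -1, so each entry c
  has two different preimages a and 1/a under \<open>ahat\<close>, of which one is chosen. The last
  clause keeps the minimality; it later excludes one-dimensional tensor factors.\<close>

lemma exists_support:
  obtains as where "distinct (as @ map inverse as)" "0 \<notin> set as" "kills (set as)"
    "\<And>a. a \<in> set as \<Longrightarrow> \<not> kills (set as - {a})"
proof -
  define cs where "cs = arg_min length annihilates"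
  have cs: "annihilates cs" and min: "\<And>ds. annihilates ds \<Longrightarrow> length cs \<le> length ds"
    unfolding cs_def using exists_annihilator by (auto intro: arg_min_natI arg_min_nat_le)
  have min1: "\<not> annihilates (remove1 c cs)" if "c \<in> set cs" for c
  proof
    assume "annihilates (remove1 c cs)"
    then have "length cs \<le> length cs - 1" using min[of "remove1 c cs"] that by (simp only: length_remove1 if_True)
    moreover have "length cs > 0" using that by (rule length_pos_if_in_set)
    ultimately show False by arith
  qed
  have ann1: "annihilates (c # remove1 c cs)" if "c \<in> set cs" for c
    using cs upoly_perm[of "c # remove1 c cs" cs] that unfolding annihilates_def by simp
  have not_rep: "c \<notin> set (remove1 c cs)" if "c \<in> set cs" for c
    using annihilates_repeated[OF ann1[OF that]] min1[OF that] by blast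
  have dist: "distinct cs"
  proof (rule ccontr)
    assume "\<not> distinct cs"
    then obtain xs ys zs y where "cs = xs @ [y] @ ys @ [y] @ zs" using not_distinct_decomp by blast
    then have "y \<in> set cs" "y \<in> set (remove1 y cs)" by (auto simp: remove1_append)
    then show False using not_rep by blast
  qed
  have not1: "c \<noteq> 1" "c \<noteq> - 1" if "c \<in> set cs" for c
    using annihilates_fixed_point[OF ann1[OF that]] min1[OF that] by blast+
  obtain f where f: "\<And>c. f c \<noteq> 0" "\<And>c. ahat (f c) = c" using exists_ahat by metis
  define as where "as = map f cs"
  have ahat_as: "map ahat as = cs" unfolding as_def by (simp add: f(2) comp_def)
  have "ahat (inverse a) = ahat a" for a by (simp add: ahat_def add.commute)
  have sq: "f c \<noteq> inverse (f c)" if "c \<in> set cs" for c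
  proof
    assume "f c = inverse (f c)"
    then have "f c = c" using f(2)[of c] by (simp add: ahat_def)
    then have "c * c = 1" using \<open>f c = inverse (f c)\<close> f(1)[of c] by (metis right_inverse)
    then show False using not1[OF that] by (metis square_eq_1_iff)
  qed
  have ainv: "ahat (inverse a) = ahat a" for a by (simp add: ahat_def add.commute)
  have inj: "f c \<noteq> inverse (f c')" if "c \<in> set cs" for c c'
    using sq[OF that] f(2) ainv by metis
  have inj_f: "inj_on f A" for A using f(2) by (metis inj_onI)
  have d1: "distinct (as @ map inverse as)"
    unfolding as_def using dist inj_f inj by (auto simp: distinct_map inj_on_def)
  have d2: "0 \<notin> set as" unfolding as_def using f(1) by auto
  show ?thesis
  proof (rule that[OF d1 d2])
    show "kills (set as)" unfolding kills_def
    proof (intro allI impI)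
      fix p q assume q: "flip q = - q" and v: "\<forall>b\<in>set as. ev p b = 0 \<and> ev p (inverse b) = 0 \<and> ev q b = 0"
      have v': "ev q (inverse b) = 0" if "b \<in> set as" for b
        using ev_flip[of q b] v that unfolding q by simp
      obtain p' where p': "p = upoly cs * p'"
        using divisible_by_upoly[OF d1 d2, of p] v unfolding ahat_as by blast
      obtain q' where q': "q = upoly cs * q'"
        using divisible_by_upoly[OF d1 d2, of q] v v' unfolding ahat_as by blast
      have "upoly cs * flip q' = upoly cs * (- q')" using q unfolding q' by simp
      then have "flip q' = - q'" using upoly_nonzero mult_cancel_left by metis
      then show "T p q = 0\<^sub>m d d" using cs unfolding p' q' annihilates_def by blast
    qed
    fix a assume "a \<in> set as"
    then obtain c where c: "c \<in> set cs" "a = f c" unfolding as_def by auto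
    show "\<not> kills (set as - {a})"
    proof
      assume k: "kills (set as - {a})"
      \<comment> \<open>Any other point belongs to another entry, which survives in
        \<open>remove1 c cs\<close>. So multiples of the shorter product vanish at all remaining
        points and their inverses.\<close>
      have z: "ev (upoly (remove1 c cs)) b = 0 \<and> ev (upoly (remove1 c cs)) (inverse b) = 0"
        if b: "b \<in> set as - {a}" for b
      proof -
        obtain c' where c': "c' \<in> set cs" "b = f c'" "c' \<noteq> c" using b c unfolding as_def by auto
        have "c' \<in> set (remove1 c cs)" using c' dist by simp
        moreover have "f c' + inverse (f c') = 2 * c'" using f(2)[of c'] by (simp add: ahat_def field_simps)
        ultimately show ?thesis using f(1)[of c'] unfolding c'(2) upoly_def
          by (auto simp: prod_list_zero_iff image_iff add.commute intro!: bexI[of _ c'])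
      qed
      have "annihilates (remove1 c cs)" unfolding annihilates_def
      proof (intro allI impI)
        fix p q :: laurent assume q: "flip q = - q"
        have "ev (upoly (remove1 c cs) * r) b = 0 \<and> ev (upoly (remove1 c cs) * r) (inverse b) = 0"
          if b: "b \<in> set as - {a}" for r b
        proof -
          have "b \<noteq> 0" "inverse b \<noteq> 0" using b d2 by auto
          then show ?thesis using z[OF b] by (simp add: ev_mult)
        qed
        then show "T (upoly (remove1 c cs) * p) (upoly (remove1 c cs) * q) = 0\<^sub>m d d"
          using k q unfolding kills_def by simp
      qed
      then show False using min1[OF c(1)] by blast
    qed
  qed
qed

end

section \<open>Tensor products of evaluation modules\<close>

lemma sum_div_mod:
  fixes f :: "nat \<Rightarrow> nat \<Rightarrow> 'a :: comm_monoid_add"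
  shows "(\<Sum>l<m * n. f (l div n) (l mod n)) = (\<Sum>a<m. \<Sum>b<n. f a b)"
proof (cases "n = 0")
  case False
  have "(\<Sum>l<m * n. f (l div n) (l mod n)) = (\<Sum>(a, b)\<in>{..<m} \<times> {..<n}. f a b)"
  proof (rule sum.reindex_bij_witness[where i = "\<lambda>(a, b). a * n + b" and j = "\<lambda>l. (l div n, l mod n)"])
    fix ab assume "ab \<in> {..<m} \<times> {..<n}"
    then obtain a b where ab: "ab = (a, b)" "a < m" "b < n" by auto
    have "a * n + b < Suc a * n" using ab by simp
    also have "\<dots> \<le> m * n" using ab by (intro mult_le_mono1) simp
    finally show "(case ab of (a, b) \<Rightarrow> a * n + b) \<in> {..<m * n}" using ab by simp
  qed (use False in \<open>auto simp: less_mult_imp_div_less\<close>)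
  then show ?thesis by (simp add: sum.cartesian_product)
qed simp

lemma block_index_less: "k < m \<Longrightarrow> j < n \<Longrightarrow> k * n + j < m * (n :: nat)"
proof -
  assume "k < m" "j < n"
  then have "k * n + j < Suc k * n" "Suc k * n \<le> m * n" by (simp, intro mult_le_mono1, simp)
  then show ?thesis by linarith
qed

lemma block_index [simp]:
  assumes "j < (n :: nat)"
  shows "(k * n + j) div n = k" "(k * n + j) mod n = j"
  using assms by auto

lemma block_index_cases:
  assumes "i < m * (n :: nat)"
  obtains k j where "k < m" "j < n" "i = k * n + j"
proof -
  have "n > 0" using assms by (cases n) auto
  then show ?thesis using that[of "i div n" "i mod n"] assms by (simp add: less_mult_imp_div_less)
qed

lemma kron_carrier [simp]:
  "A \<in> carrier_mat m m \<Longrightarrow> B \<in> carrier_mat n n \<Longrightarrow> kron A B \<in> carrier_mat (m * n) (m * n)"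
  by (simp add: kron_def)

lemma kron_dim [simp]:
  "dim_row (kron A B) = dim_row A * dim_row B" "dim_col (kron A B) = dim_col A * dim_col B"
  by (simp_all add: kron_def)

lemma kron_index:
  assumes "A \<in> carrier_mat m m" "B \<in> carrier_mat n n" "i < m * n" "j < m * n"
  shows "kron A B $$ (i, j) = A $$ (i div n, j div n) * B $$ (i mod n, j mod n)"
  using assms by (simp add: kron_def)

lemma mod_div_less:
  assumes "i < m * (n :: nat)"
  shows "i div n < m" "i mod n < n"
  using assms by (auto elim!: block_index_cases)

lemma kron_mult:
  assumes "A \<in> carrier_mat m m" "B \<in> carrier_mat n n" "C \<in> carrier_mat m m" "D \<in> carrier_mat n n"
  shows "kron A B * kron C D = kron (A * C) (B * D)"
proof (rule eq_matI)
  fix i j assume "i < dim_row (kron (A * C) (B * D))" "j < dim_col (kron (A * C) (B * D))"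
  then have ij: "i < m * n" "j < m * n" using assms by auto
  note l = mod_div_less[OF ij(1)] mod_div_less[OF ij(2)]
  have "(kron A B * kron C D) $$ (i, j) = (\<Sum>l<m * n. kron A B $$ (i, l) * kron C D $$ (l, j))"
    using assms ij by (simp add: scalar_prod_def atLeast0LessThan)
  also have "\<dots> = (\<Sum>l<m * n. (A $$ (i div n, l div n) * C $$ (l div n, j div n)) *
      (B $$ (i mod n, l mod n) * D $$ (l mod n, j mod n)))"
    using assms ij by (intro sum.cong) (auto simp: kron_index)
  also have "\<dots> = (\<Sum>a<m. \<Sum>b<n. (A $$ (i div n, a) * C $$ (a, j div n)) * (B $$ (i mod n, b) * D $$ (b, j mod n)))"
    by (rule sum_div_mod)
  also have "\<dots> = (A * C) $$ (i div n, j div n) * (B * D) $$ (i mod n, j mod n)"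
    using assms l by (simp add: scalar_prod_def atLeast0LessThan sum_product)
  also have "\<dots> = kron (A * C) (B * D) $$ (i, j)"
    using assms ij by (subst kron_index[of _ m _ n]) auto
  finally show "(kron A B * kron C D) $$ (i, j) = kron (A * C) (B * D) $$ (i, j)" .
qed (use assms in auto)

lemma kron_trace:
  assumes "A \<in> carrier_mat m m" "B \<in> carrier_mat n n"
  shows "mat_trace (kron A B) = mat_trace A * mat_trace B"
proof -
  have "mat_trace (kron A B) = (\<Sum>l<m * n. A $$ (l div n, l div n) * B $$ (l mod n, l mod n))"
    using assms by (simp add: mat_trace_def kron_index)
  also have "\<dots> = (\<Sum>a<m. \<Sum>b<n. A $$ (a, a) * B $$ (b, b))" by (rule sum_div_mod)
  finally show ?thesis using assms by (simp add: mat_trace_def sum_product)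
qed

lemma kron_diff_left:
  assumes "A \<in> carrier_mat m m" "A' \<in> carrier_mat m m" "B \<in> carrier_mat n n"
  shows "kron (A - A') B = kron A B - kron A' B"
  using assms by (intro eq_matI) (auto simp: kron_def mod_div_less left_diff_distrib)

lemma kron_diff_right:
  assumes "A \<in> carrier_mat m m" "B \<in> carrier_mat n n" "B' \<in> carrier_mat n n"
  shows "kron A (B - B') = kron A B - kron A B'"
  using assms by (intro eq_matI) (auto simp: kron_def mod_div_less right_diff_distrib)

lemma kron_smult_left:
  assumes "A \<in> carrier_mat m m" "B \<in> carrier_mat n n"
  shows "kron (c \<cdot>\<^sub>m A) B = c \<cdot>\<^sub>m kron A B"
  using assms by (intro eq_matI) (auto simp: kron_def mod_div_less)

lemma kron_smult_right:
  assumes "A \<in> carrier_mat m m" "B \<in> carrier_mat n n"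
  shows "kron A (c \<cdot>\<^sub>m B) = c \<cdot>\<^sub>m kron A B"
  using assms by (intro eq_matI) (auto simp: kron_def mod_div_less)

lemma kron_zero_right: "A \<in> carrier_mat m m \<Longrightarrow> kron A (0\<^sub>m n n) = 0\<^sub>m (m * n) (m * n)"
  by (intro eq_matI) (auto simp: kron_def mod_div_less)

lemma kron_zero_left: "B \<in> carrier_mat n n \<Longrightarrow> kron (0\<^sub>m m m) B = 0\<^sub>m (m * n) (m * n)"
  by (intro eq_matI) (auto simp: kron_def mod_div_less)

section \<open>The sl2 matrices and their evaluation modules\<close>

lemma sl2_carrier [simp]:
  "sl2_E m \<in> carrier_mat m m" "sl2_F m \<in> carrier_mat m m" "sl2_H m \<in> carrier_mat m m"
  by (simp_all add: sl2_E_def sl2_F_def sl2_H_def)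

lemma sl2_dim [simp]:
  "dim_row (sl2_E m) = m" "dim_col (sl2_E m) = m" "dim_row (sl2_F m) = m" "dim_col (sl2_F m) = m"
  "dim_row (sl2_H m) = m" "dim_col (sl2_H m) = m"
  by (simp_all add: sl2_E_def sl2_F_def sl2_H_def)

lemma mult_index_sum:
  assumes "A \<in> carrier_mat m m" "B \<in> carrier_mat m m" "i < m" "j < m"
  shows "(A * B) $$ (i, j) = (\<Sum>l<m. A $$ (i, l) * B $$ (l, j))"
  using assms by (simp add: scalar_prod_def atLeast0LessThan)

text \<open>On the diagonal this is (i + 1)(m - i - 1) - i (m - i) = m - 1 - 2 i, the recursion that
  produces the entries k (m - k) of E.\<close>

lemma sl2_EF: "sl2_E m * sl2_F m - sl2_F m * sl2_E m = sl2_H m"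
proof (rule eq_matI)
  fix i j assume "i < dim_row (sl2_H m)" "j < dim_col (sl2_H m)"
  then have ij: "i < m" "j < m" by auto
  have "(sl2_E m * sl2_F m) $$ (i, j) = (\<Sum>l<m. if l = Suc i then (if i = j then of_nat (l * (m - l)) else 0) else 0)"
    unfolding mult_index_sum[OF sl2_carrier(1) sl2_carrier(2) ij] using ij by (intro sum.cong) (auto simp: sl2_E_def sl2_F_def)
  also have "\<dots> = (if i = j \<and> Suc i < m then of_nat (Suc i * (m - Suc i)) else 0)"
    by (simp del: mult_Suc)
  finally have EF: "(sl2_E m * sl2_F m) $$ (i, j) = \<dots>" .
  \<comment> \<open>For i = 0 the index i - 1 is again 0; the guard i > 0 makes the term 0, in
    agreement with i (m - i) = 0.\<close>
  have "(sl2_F m * sl2_E m) $$ (i, j) = (\<Sum>l<m. if l = i - 1 then (if i = j \<and> i > 0 then of_nat (i * (m - i)) else 0) else 0)"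
    unfolding mult_index_sum[OF sl2_carrier(2) sl2_carrier(1) ij] using ij by (intro sum.cong) (auto simp: sl2_E_def sl2_F_def)
  also have "\<dots> = (if i = j then of_nat (i * (m - i)) else 0)"
    using ij by auto
  finally have FE: "(sl2_F m * sl2_E m) $$ (i, j) = \<dots>" .
  have "(of_nat (Suc i * (m - Suc i)) :: complex) - of_nat (i * (m - i)) = of_int (int m - 1 - 2 * int i)"
  proof -
    obtain k where "m = Suc i + k" using ij(1) less_iff_Suc_add by auto
    then show ?thesis by (simp add: algebra_simps)
  qed
  moreover have "(if Suc i < m then of_nat (Suc i * (m - Suc i)) else 0) = (of_nat (Suc i * (m - Suc i)) :: complex)"
    by simp
  ultimately have "(if i = j \<and> Suc i < m then of_nat (Suc i * (m - Suc i)) else 0) -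
      (if i = j then of_nat (i * (m - i)) else 0) = sl2_H m $$ (i, j)"
    using ij by (cases "i = j") (simp_all only: sl2_H_def index_mat split if_True if_False simp_thms diff_self)
  then show "(sl2_E m * sl2_F m - sl2_F m * sl2_E m) $$ (i, j) = sl2_H m $$ (i, j)"
    using EF FE ij by (simp del: index_mult_mat(1) of_nat_mult mult_Suc)
qed auto

lemma sl2_HE: "sl2_H m * sl2_E m - sl2_E m * sl2_H m = 2 \<cdot>\<^sub>m sl2_E m"
proof (rule eq_matI)
  fix i j assume "i < dim_row (2 \<cdot>\<^sub>m sl2_E m)" "j < dim_col (2 \<cdot>\<^sub>m sl2_E m)"
  then have ij: "i < m" "j < m" by auto
  have "(sl2_H m * sl2_E m) $$ (i, j) = (\<Sum>l<m. if l = i then sl2_H m $$ (i, i) * sl2_E m $$ (i, j) else 0)"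
    unfolding mult_index_sum[OF sl2_carrier(3) sl2_carrier(1) ij] using ij by (intro sum.cong) (auto simp: sl2_H_def sl2_E_def sl2_F_def)
  moreover have "(sl2_E m * sl2_H m) $$ (i, j) = (\<Sum>l<m. if l = j then sl2_E m $$ (i, j) * sl2_H m $$ (j, j) else 0)"
    unfolding mult_index_sum[OF sl2_carrier(1) sl2_carrier(3) ij] using ij by (intro sum.cong) (auto simp: sl2_H_def sl2_E_def sl2_F_def)
  ultimately have "(sl2_H m * sl2_E m - sl2_E m * sl2_H m) $$ (i, j) =
      (sl2_H m $$ (i, i) - sl2_H m $$ (j, j)) * sl2_E m $$ (i, j)"
    using ij by (simp add: algebra_simps del: index_mult_mat(1))
  moreover have "sl2_H m $$ (i, i) - sl2_H m $$ (j, j) = 2" if "j = Suc i"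
    using ij that by (simp add: sl2_H_def)
  moreover have "sl2_E m $$ (i, j) = 0" if "\<not> (j = Suc i)" using ij that by (simp add: sl2_E_def)
  ultimately show "(sl2_H m * sl2_E m - sl2_E m * sl2_H m) $$ (i, j) = (2 \<cdot>\<^sub>m sl2_E m) $$ (i, j)"
    using ij by (cases "j = Suc i") (simp_all del: index_mult_mat(1))
qed auto

lemma sl2_HF: "sl2_H m * sl2_F m - sl2_F m * sl2_H m = (- 2) \<cdot>\<^sub>m sl2_F m"
proof (rule eq_matI)
  fix i j assume "i < dim_row (- 2 \<cdot>\<^sub>m sl2_F m)" "j < dim_col (- 2 \<cdot>\<^sub>m sl2_F m)"
  then have ij: "i < m" "j < m" by auto
  have "(sl2_H m * sl2_F m) $$ (i, j) = (\<Sum>l<m. if l = i then sl2_H m $$ (i, i) * sl2_F m $$ (i, j) else 0)"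
    unfolding mult_index_sum[OF sl2_carrier(3) sl2_carrier(2) ij] using ij by (intro sum.cong) (auto simp: sl2_H_def sl2_E_def sl2_F_def)
  moreover have "(sl2_F m * sl2_H m) $$ (i, j) = (\<Sum>l<m. if l = j then sl2_F m $$ (i, j) * sl2_H m $$ (j, j) else 0)"
    unfolding mult_index_sum[OF sl2_carrier(2) sl2_carrier(3) ij] using ij by (intro sum.cong) (auto simp: sl2_H_def sl2_E_def sl2_F_def)
  ultimately have "(sl2_H m * sl2_F m - sl2_F m * sl2_H m) $$ (i, j) =
      (sl2_H m $$ (i, i) - sl2_H m $$ (j, j)) * sl2_F m $$ (i, j)"
    using ij by (simp add: algebra_simps del: index_mult_mat(1))
  moreover have "sl2_H m $$ (i, i) - sl2_H m $$ (j, j) = (- 2)" if "i = Suc j"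
    using ij that by (simp add: sl2_H_def)
  moreover have "sl2_F m $$ (i, j) = 0" if "\<not> (i = Suc j)" using ij that by (simp add: sl2_F_def)
  ultimately show "(sl2_H m * sl2_F m - sl2_F m * sl2_H m) $$ (i, j) = ((- 2) \<cdot>\<^sub>m sl2_F m) $$ (i, j)"
    using ij by (cases "i = Suc j") (simp_all del: index_mult_mat(1))
qed auto

lemma lin_comb_mult_index:
  fixes E F H :: "complex mat"
  assumes "E \<in> carrier_mat m m" "F \<in> carrier_mat m m" "H \<in> carrier_mat m m" "i < m" "j < m"
  shows "((p \<cdot>\<^sub>m E + r \<cdot>\<^sub>m F + q \<cdot>\<^sub>m H) * (p' \<cdot>\<^sub>m E + r' \<cdot>\<^sub>m F + q' \<cdot>\<^sub>m H)) $$ (i, j) =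
    p * p' * (E * E) $$ (i, j) + p * r' * (E * F) $$ (i, j) + p * q' * (E * H) $$ (i, j) +
    r * p' * (F * E) $$ (i, j) + r * r' * (F * F) $$ (i, j) + r * q' * (F * H) $$ (i, j) +
    q * p' * (H * E) $$ (i, j) + q * r' * (H * F) $$ (i, j) + q * q' * (H * H) $$ (i, j)"
proof -
  note * = mult_index_sum[OF _ _ assms(4,5)]
  show ?thesis using assms
    by (simp add: * sum.distrib sum_distrib_left algebra_simps del: index_mult_mat(1))
qed

lemma ev_rep_carrier [simp]: "ev_rep m a X \<in> carrier_mat m m"
  by (cases X) (simp add: ev_rep_def)

lemma ev_rep_dim [simp]: "dim_row (ev_rep m a X) = m" "dim_col (ev_rep m a X) = m"
  using ev_rep_carrier[of m a X] by (metis carrier_matD)+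

lemma sum_sl2_weights: "(\<Sum>i<m. complex_of_int (int m - 1 - 2 * int i)) = 0"
proof -
  have "(\<Sum>i<m. 2 * int i) = int m * (int m - 1)"
    by (induction m) (auto simp: algebra_simps)
  then have "(\<Sum>i<m. int m - 1 - 2 * int i) = 0"
    by (simp add: sum_subtractf algebra_simps)
  then show ?thesis by (metis of_int_0 of_int_sum)
qed

lemma ev_rep_is_sl_rep:
  assumes a: "a \<noteq> 0"
  shows "is_sl_rep m (ev_rep m a)"
  unfolding is_sl_rep_def
proof (intro conjI ballI allI)
  fix X assume "X \<in> OA"
  then obtain p q where X: "X = oa p q" "flip q = - q" by (rule OA_cases)
  have "mat_trace (ev_rep m a X) = (\<Sum>i<m. ev q a * of_int (int m - 1 - 2 * int i))"
    unfolding X ev_rep_oa mat_trace_def by (simp add: sl2_E_def sl2_F_def sl2_H_def)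
  also have "\<dots> = 0" by (simp only: sum_distrib_left[symmetric] sum_sl2_weights mult_zero_right)
  finally show "mat_trace (ev_rep m a X) = 0" .
  fix c show "ev_rep m a (loop_smult c X) = c \<cdot>\<^sub>m ev_rep m a X"
    unfolding X loop_smult_oa ev_rep_oa using a by (intro eq_matI) (auto simp: algebra_simps)
next
  fix X Y assume "X \<in> OA" "Y \<in> OA"
  then obtain p q p' q' where X: "X = oa p q" "flip q = - q" and Y: "Y = oa p' q'" "flip q' = - q'"
    by (metis OA_cases)
  show "ev_rep m a (loop_add X Y) = ev_rep m a X + ev_rep m a Y"
    unfolding X Y loop_add_oa ev_rep_oa by (intro eq_matI) (auto simp: algebra_simps)
  \<comment> \<open>The f-coordinate is read at 1/a, where skew elements change sign. This sign
    turns the factor 2 of the p-coordinate into the -2 of [h, f].\<close>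
  have inv: "ev q (inverse a) = - ev q a" "ev q' (inverse a) = - ev q' a"
    using ev_flip[of q a] ev_flip[of q' a] X Y by auto
  show "ev_rep m a (loop_bracket X Y) = ev_rep m a X * ev_rep m a Y - ev_rep m a Y * ev_rep m a X"
  proof (rule eq_matI)
    fix i j assume "i < dim_row (ev_rep m a X * ev_rep m a Y - ev_rep m a Y * ev_rep m a X)"
      "j < dim_col (ev_rep m a X * ev_rep m a Y - ev_rep m a Y * ev_rep m a X)"
    then have ij: "i < m" "j < m" by auto
    note lin = lin_comb_mult_index[OF sl2_carrier(1)[of m] sl2_carrier(2) sl2_carrier(3) ij]
    let ?x = "\<lambda>A B. (A * B) $$ (i, j)"
    have rel: "?x (sl2_E m) (sl2_F m) = ?x (sl2_F m) (sl2_E m) + sl2_H m $$ (i, j)"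
      "?x (sl2_H m) (sl2_E m) = ?x (sl2_E m) (sl2_H m) + 2 * sl2_E m $$ (i, j)"
      "?x (sl2_H m) (sl2_F m) = ?x (sl2_F m) (sl2_H m) - 2 * sl2_F m $$ (i, j)"
      using arg_cong[OF sl2_EF[of m], of "\<lambda>A. A $$ (i, j)"] arg_cong[OF sl2_HE[of m], of "\<lambda>A. A $$ (i, j)"]
        arg_cong[OF sl2_HF[of m], of "\<lambda>A. A $$ (i, j)"] ij
      by (simp_all add: algebra_simps del: index_mult_mat(1))
    have "(ev_rep m a X * ev_rep m a Y - ev_rep m a Y * ev_rep m a X) $$ (i, j) =
      (ev_rep m a X * ev_rep m a Y) $$ (i, j) - (ev_rep m a Y * ev_rep m a X) $$ (i, j)"
      using ij by (simp del: index_mult_mat(1))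
    also have "\<dots> = (2 * (ev q a * ev p' a - ev p a * ev q' a)) * sl2_E m $$ (i, j)
        + (2 * (ev p (inverse a) * ev q' a - ev q a * ev p' (inverse a))) * sl2_F m $$ (i, j)
        + (ev p a * ev p' (inverse a) - ev p (inverse a) * ev p' a) * sl2_H m $$ (i, j)"
      unfolding X(1) Y(1) ev_rep_oa lin rel by (simp only: algebra_simps)
    also have "\<dots> = ev_rep m a (loop_bracket X Y) $$ (i, j)"
      unfolding X(1) Y(1) loop_bracket_oa[OF X(2) Y(2)] ev_rep_oa
      using ij a by (simp add: inv)
    finally show "ev_rep m a (loop_bracket X Y) $$ (i, j) =
      (ev_rep m a X * ev_rep m a Y - ev_rep m a Y * ev_rep m a X) $$ (i, j)" by simp
  qed auto
qed auto

lemma add_diff_swap_mat: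
  fixes P :: "complex mat"
  assumes "P \<in> carrier_mat n m" "P' \<in> carrier_mat n m" "R \<in> carrier_mat n m" "R' \<in> carrier_mat n m"
    "S \<in> carrier_mat n m" "S' \<in> carrier_mat n m"
  shows "P - P' + (R - R') = P + S + (S' + R) - (P' + S' + (S + R'))"
  using assms by (intro eq_matI) auto

text \<open>The mixed terms pair \<sigma> of one element with \<tau> of the other and agree in both
  orders of multiplication, so the commutator keeps only the two unmixed brackets.\<close>

lemma tensor_product_is_sl_rep:
  assumes \<sigma>: "is_sl_rep m \<sigma>" and \<tau>: "is_sl_rep n \<tau>"
  shows "is_sl_rep (m * n) (\<lambda>X. kron (\<sigma> X) (1\<^sub>m n) + kron (1\<^sub>m m) (\<tau> X))"
  unfolding is_sl_rep_def
proof (intro conjI ballI allI)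
  have s: "\<sigma> X \<in> carrier_mat m m" "mat_trace (\<sigma> X) = 0" and t: "\<tau> X \<in> carrier_mat n n" "mat_trace (\<tau> X) = 0"
    if "X \<in> OA" for X using that \<sigma> \<tau> unfolding is_sl_rep_def by auto
  {
    fix X assume X: "X \<in> OA"
    show "kron (\<sigma> X) (1\<^sub>m n) + kron (1\<^sub>m m) (\<tau> X) \<in> carrier_mat (m * n) (m * n)"
      using s[OF X] t[OF X] by simp
    have "mat_trace (kron (\<sigma> X) (1\<^sub>m n) + kron (1\<^sub>m m) (\<tau> X)) =
        mat_trace (kron (\<sigma> X) (1\<^sub>m n)) + mat_trace (kron (1\<^sub>m m) (\<tau> X))"
      using s[OF X] t[OF X] by (auto simp: mat_trace_def sum.distrib)
    then show "mat_trace (kron (\<sigma> X) (1\<^sub>m n) + kron (1\<^sub>m m) (\<tau> X)) = 0"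
      using s[OF X] t[OF X] kron_trace[OF s(1)[OF X], of "1\<^sub>m n" n] kron_trace[OF _ t(1)[OF X], of "1\<^sub>m m" m] by simp
    fix c
    have "\<sigma> (loop_smult c X) = c \<cdot>\<^sub>m \<sigma> X" "\<tau> (loop_smult c X) = c \<cdot>\<^sub>m \<tau> X"
      using X \<sigma> \<tau> unfolding is_sl_rep_def by auto
    then show "kron (\<sigma> (loop_smult c X)) (1\<^sub>m n) + kron (1\<^sub>m m) (\<tau> (loop_smult c X)) =
        c \<cdot>\<^sub>m (kron (\<sigma> X) (1\<^sub>m n) + kron (1\<^sub>m m) (\<tau> X))"
      using s[OF X] t[OF X]
      by (simp add: kron_smult_left[of _ m _ n] kron_smult_right[of _ m _ n] add_smult_distrib_left_mat[of _ "m * n" "m * n"])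
  }
  fix X Y assume XY: "X \<in> OA" "Y \<in> OA"
  note c = s(1)[OF XY(1)] s(1)[OF XY(2)] t(1)[OF XY(1)] t(1)[OF XY(2)]
  have add: "\<sigma> (loop_add X Y) = \<sigma> X + \<sigma> Y" "\<tau> (loop_add X Y) = \<tau> X + \<tau> Y"
    and br: "\<sigma> (loop_bracket X Y) = \<sigma> X * \<sigma> Y - \<sigma> Y * \<sigma> X"
      "\<tau> (loop_bracket X Y) = \<tau> X * \<tau> Y - \<tau> Y * \<tau> X"
    using XY \<sigma> \<tau> unfolding is_sl_rep_def by auto
  show "kron (\<sigma> (loop_add X Y)) (1\<^sub>m n) + kron (1\<^sub>m m) (\<tau> (loop_add X Y)) =
    kron (\<sigma> X) (1\<^sub>m n) + kron (1\<^sub>m m) (\<tau> X) + (kron (\<sigma> Y) (1\<^sub>m n) + kron (1\<^sub>m m) (\<tau> Y))"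
    unfolding add using c by (intro eq_matI) (auto simp: kron_def mod_div_less algebra_simps)
  have mult: "(kron A (1\<^sub>m n) + kron (1\<^sub>m m) B) * (kron A' (1\<^sub>m n) + kron (1\<^sub>m m) B') =
      kron (A * A') (1\<^sub>m n) + kron A B' + (kron A' B + kron (1\<^sub>m m) (B * B'))"
    if "A \<in> carrier_mat m m" "A' \<in> carrier_mat m m" "B \<in> carrier_mat n n" "B' \<in> carrier_mat n n" for A A' B B'
  proof -
    let ?N = "m * n" and ?A = "kron A (1\<^sub>m n)" and ?A' = "kron A' (1\<^sub>m n)"
      and ?B = "kron (1\<^sub>m m) B" and ?B' = "kron (1\<^sub>m m) B'"
    have c: "?A \<in> carrier_mat ?N ?N" "?A' \<in> carrier_mat ?N ?N" "?B \<in> carrier_mat ?N ?N" "?B' \<in> carrier_mat ?N ?N"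
      using that by simp_all
    have "(?A + ?B) * (?A' + ?B') = ?A * (?A' + ?B') + ?B * (?A' + ?B')"
      by (rule add_mult_distrib_mat[OF c(1,3) add_carrier_mat[OF c(4)]])
    also have "\<dots> = (?A * ?A' + ?A * ?B') + (?B * ?A' + ?B * ?B')"
      using mult_add_distrib_mat[OF c(1,2,4)] mult_add_distrib_mat[OF c(3,2,4)] by simp
    finally show ?thesis using that by (simp add: kron_mult[of _ m _ n])
  qed
  show "kron (\<sigma> (loop_bracket X Y)) (1\<^sub>m n) + kron (1\<^sub>m m) (\<tau> (loop_bracket X Y)) =
    (kron (\<sigma> X) (1\<^sub>m n) + kron (1\<^sub>m m) (\<tau> X)) * (kron (\<sigma> Y) (1\<^sub>m n) + kron (1\<^sub>m m) (\<tau> Y)) -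
    (kron (\<sigma> Y) (1\<^sub>m n) + kron (1\<^sub>m m) (\<tau> Y)) * (kron (\<sigma> X) (1\<^sub>m n) + kron (1\<^sub>m m) (\<tau> X))"
    unfolding br mult[OF c(1,2,3,4)] mult[OF c(2,1,4,3)]
    unfolding kron_diff_left[OF mult_carrier_mat[OF c(1,2)] mult_carrier_mat[OF c(2,1)] one_carrier_mat]
      kron_diff_right[OF one_carrier_mat mult_carrier_mat[OF c(3,4)] mult_carrier_mat[OF c(4,3)]]
    using c by (intro add_diff_swap_mat[of _ "m * n" "m * n"]) auto
qed

lemma tensor_rep_is_sl_rep:
  assumes "\<And>a m. (a, m) \<in> set L \<Longrightarrow> a \<noteq> 0"
  shows "is_sl_rep (prod_list (map snd L)) (tensor_rep L)"
  using assms
proof (induction L)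
  case Nil
  have "mat_trace (0\<^sub>m 1 1) = 0" by (simp add: mat_trace_def)
  then show ?case by (auto simp: is_sl_rep_def intro!: eq_matI)
next
  case (Cons am L)
  obtain a m where am: "am = (a, m)" by force
  have "is_sl_rep m (ev_rep m a)" using Cons.prems am by (intro ev_rep_is_sl_rep) auto
  moreover have "is_sl_rep (prod_list (map snd L)) (tensor_rep L)" using Cons by auto
  ultimately have "is_sl_rep (m * prod_list (map snd L))
     (\<lambda>X. kron (ev_rep m a X) (1\<^sub>m (prod_list (map snd L))) + kron (1\<^sub>m m) (tensor_rep L X))"
    by (rule tensor_product_is_sl_rep)
  moreover have "tensor_rep (am # L) =
     (\<lambda>X. kron (ev_rep m a X) (1\<^sub>m (prod_list (map snd L))) + kron (1\<^sub>m m) (tensor_rep L X))"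
    unfolding am by (rule ext) simp
  ultimately show ?case unfolding am by simp
qed

section \<open>Block coordinates and irreducibility of tensor products\<close>

definition blk :: "nat \<Rightarrow> complex vec \<Rightarrow> nat \<Rightarrow> complex vec" where
  "blk n w k = vec n (\<lambda>j. w $ (k * n + j))"

text \<open>Index k n + j stands for the basis tensor v_k \<otimes> w_j: \<open>blk n w k\<close> is
  the coefficient of v_k in w, and \<open>emb m n k u\<close> is the pure tensor v_k \<otimes>
  u.\<close>

definition emb :: "nat \<Rightarrow> nat \<Rightarrow> nat \<Rightarrow> complex vec \<Rightarrow> complex vec" where
  "emb m n k u = vec (m * n) (\<lambda>i. if i div n = k then u $ (i mod n) else 0)"

lemma blk_carrier [simp]: "blk n w k \<in> carrier_vec n" and blk_dim [simp]: "dim_vec (blk n w k) = n"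
  by (simp_all add: blk_def)

lemma emb_carrier [simp]: "emb m n k u \<in> carrier_vec (m * n)"
  by (simp add: emb_def)

lemma emb_dim [simp]: "dim_vec (emb m n k u) = m * n"
  by (simp add: emb_def)

lemma blk_index: "j < n \<Longrightarrow> blk n w k $ j = w $ (k * n + j)"
  by (simp add: blk_def)

lemma blk_eqI:
  assumes "w \<in> carrier_vec (m * n)" "w' \<in> carrier_vec (m * n)" "\<And>k. k < m \<Longrightarrow> blk n w k = blk n w' k"
  shows "w = w'"
proof (rule eq_vecI)
  fix i assume "i < dim_vec w'"
  then have "i < m * n" using assms by simp
  then show "w $ i = w' $ i" using assms(3) by (metis blk_index block_index_cases)
qed (use assms in simp)

lemma blk_zero: "k < m \<Longrightarrow> blk n (0\<^sub>v (m * n)) k = 0\<^sub>v n"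
  by (intro eq_vecI) (auto simp: blk_index block_index_less)

lemma blk_add: "u \<in> carrier_vec (m * n) \<Longrightarrow> v \<in> carrier_vec (m * n) \<Longrightarrow> k < m \<Longrightarrow>
    blk n (u + v) k = blk n u k + blk n v k"
  by (intro eq_vecI) (auto simp: blk_index block_index_less)

lemma blk_emb: "u \<in> carrier_vec n \<Longrightarrow> l < m \<Longrightarrow> blk n (emb m n k u) l = (if l = k then u else 0\<^sub>v n)"
  by (intro eq_vecI) (auto simp: blk_index emb_def block_index_less)

lemma emb_add: "u \<in> carrier_vec n \<Longrightarrow> v \<in> carrier_vec n \<Longrightarrow> emb m n k (u + v) = emb m n k u + emb m n k v"
  by (intro eq_vecI) (auto simp: emb_def mod_div_less)

lemma emb_smult: "u \<in> carrier_vec n \<Longrightarrow> emb m n k (c \<cdot>\<^sub>v u) = c \<cdot>\<^sub>v emb m n k u"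
  by (intro eq_vecI) (auto simp: emb_def mod_div_less)

lemma emb_zero: "emb m n k (0\<^sub>v n) = 0\<^sub>v (m * n)"
  by (intro eq_vecI) (auto simp: emb_def mod_div_less)

lemma kron_mult_vec_index:
  assumes A: "A \<in> carrier_mat m m" and B: "B \<in> carrier_mat n n" and w: "w \<in> carrier_vec (m * n)"
    and k: "k < m" and j: "j < n"
  shows "(kron A B *\<^sub>v w) $ (k * n + j) = (\<Sum>l<m. A $$ (k, l) * (B *\<^sub>v blk n w l) $ j)"
proof -
  have kj: "k * n + j < m * n" using block_index_less[OF k j] .
  have "(kron A B *\<^sub>v w) $ (k * n + j) = (\<Sum>i<m * n. kron A B $$ (k * n + j, i) * w $ i)"
    using A B w kj by (simp add: scalar_prod_def atLeast0LessThan)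
  also have "\<dots> = (\<Sum>i<m * n. A $$ (k, i div n) * B $$ (j, i mod n) * w $ (i div n * n + i mod n))"
    using A B kj j by (intro sum.cong) (auto simp: kron_index[of _ m _ n])
  also have "\<dots> = (\<Sum>l<m. \<Sum>r<n. A $$ (k, l) * B $$ (j, r) * w $ (l * n + r))"
    by (rule sum_div_mod)
  also have "\<dots> = (\<Sum>l<m. A $$ (k, l) * (B *\<^sub>v blk n w l) $ j)"
    using B j by (intro sum.cong) (auto simp: scalar_prod_def atLeast0LessThan blk_index sum_distrib_left mult.assoc)
  finally show ?thesis .
qed

lemma blk_kron_right:
  assumes B: "B \<in> carrier_mat n n" and w: "w \<in> carrier_vec (m * n)" and k: "k < m"
  shows "blk n (kron (1\<^sub>m m) B *\<^sub>v w) k = B *\<^sub>v blk n w k"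
proof (rule eq_vecI)
  fix j assume "j < dim_vec (B *\<^sub>v blk n w k)"
  then have j: "j < n" using B by simp
  have "(kron (1\<^sub>m m) B *\<^sub>v w) $ (k * n + j) = (\<Sum>l<m. if l = k then (B *\<^sub>v blk n w k) $ j else 0)"
    using k unfolding kron_mult_vec_index[OF one_carrier_mat B w k j]
    by (intro sum.cong) (auto simp del: index_mult_mat_vec)
  then show "blk n (kron (1\<^sub>m m) B *\<^sub>v w) k $ j = (B *\<^sub>v blk n w k) $ j"
    using j k by (simp add: blk_index del: index_mult_mat_vec)
qed (use B in simp)

lemma blk_kron_E:
  assumes w: "w \<in> carrier_vec (m * n)" and k: "k < m"
  shows "blk n (kron (sl2_E m) (1\<^sub>m n) *\<^sub>v w) k =
    (if Suc k < m then of_nat (Suc k * (m - Suc k)) \<cdot>\<^sub>v blk n w (Suc k) else 0\<^sub>v n)"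
proof (rule eq_vecI)
  fix j assume "j < dim_vec (if Suc k < m then of_nat (Suc k * (m - Suc k)) \<cdot>\<^sub>v blk n w (Suc k) else 0\<^sub>v n)"
  then have j: "j < n" by (simp split: if_splits)
  have "(kron (sl2_E m) (1\<^sub>m n) *\<^sub>v w) $ (k * n + j) =
      (\<Sum>l<m. if l = Suc k then of_nat (Suc k * (m - Suc k)) * blk n w (Suc k) $ j else 0)"
    unfolding kron_mult_vec_index[OF sl2_carrier(1) one_carrier_mat w k j]
    using k j by (intro sum.cong) (auto simp: sl2_E_def)
  then show "blk n (kron (sl2_E m) (1\<^sub>m n) *\<^sub>v w) k $ j =
    (if Suc k < m then of_nat (Suc k * (m - Suc k)) \<cdot>\<^sub>v blk n w (Suc k) else 0\<^sub>v n) $ j"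
    using j by (simp add: blk_index del: index_mult_mat_vec of_nat_mult mult_Suc)
qed simp

lemma blk_kron_F:
  assumes w: "w \<in> carrier_vec (m * n)" and k: "k < m"
  shows "blk n (kron (sl2_F m) (1\<^sub>m n) *\<^sub>v w) k = (if k = 0 then 0\<^sub>v n else blk n w (k - 1))"
proof (rule eq_vecI)
  fix j assume "j < dim_vec (if k = 0 then 0\<^sub>v n else blk n w (k - 1))"
  then have j: "j < n" by (simp split: if_splits)
  have "(kron (sl2_F m) (1\<^sub>m n) *\<^sub>v w) $ (k * n + j) =
      (\<Sum>l<m. if l = k - 1 then (if k = 0 then 0 else blk n w (k - 1) $ j) else 0)"
    unfolding kron_mult_vec_index[OF sl2_carrier(2) one_carrier_mat w k j]
    using k j by (intro sum.cong) (auto simp: sl2_F_def)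
  then show "blk n (kron (sl2_F m) (1\<^sub>m n) *\<^sub>v w) k $ j = (if k = 0 then 0\<^sub>v n else blk n w (k - 1)) $ j"
    using j k less_imp_diff_less[OF k, of 1] by (simp add: blk_index del: index_mult_mat_vec)
qed simp

lemma irreducible_set_mono: "irreducible_set d G \<Longrightarrow> G \<subseteq> G' \<Longrightarrow> irreducible_set d G'"
  unfolding irreducible_set_def by blast

text \<open>E lowers the block index, so it moves a nonzero vector of W down to a pure tensor v_0
  \<otimes> u. Irreducibility of S then puts all of v_0 \<otimes> C^n into W, and F carries this
  copy through the other blocks.\<close>

lemma irreducible_tensor_sl2:
  assumes m: "m > 0" and irr: "irreducible_set n S" and S: "S \<subseteq> carrier_mat n n"
  shows "irreducible_set (m * n) ({kron (sl2_E m) (1\<^sub>m n), kron (sl2_F m) (1\<^sub>m n)} \<union> kron (1\<^sub>m m) ` S)"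
  unfolding irreducible_set_def
proof (intro conjI allI impI)
  have n: "n > 0" using irr unfolding irreducible_set_def by simp
  then show "m * n > 0" using m by simp
  fix W assume "is_subspace (m * n) W \<and> (\<forall>Y\<in>{kron (sl2_E m) (1\<^sub>m n), kron (sl2_F m) (1\<^sub>m n)} \<union> kron (1\<^sub>m m) ` S. \<forall>v\<in>W. Y *\<^sub>v v \<in> W)"
  then have W: "is_subspace (m * n) W" and
    E: "\<And>v. v \<in> W \<Longrightarrow> kron (sl2_E m) (1\<^sub>m n) *\<^sub>v v \<in> W" and
    F: "\<And>v. v \<in> W \<Longrightarrow> kron (sl2_F m) (1\<^sub>m n) *\<^sub>v v \<in> W" and
    R: "\<And>B v. B \<in> S \<Longrightarrow> v \<in> W \<Longrightarrow> kron (1\<^sub>m m) B *\<^sub>v v \<in> W" by auto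
  note Wc = is_subspaceD(1)[OF W]
  show "W = {0\<^sub>v (m * n)} \<or> W = carrier_vec (m * n)"
  proof (rule disjCI)
    assume "W \<noteq> carrier_vec (m * n)"
    show "W = {0\<^sub>v (m * n)}"
    proof (rule ccontr)
      assume "W \<noteq> {0\<^sub>v (m * n)}"
      then obtain w0 where w0: "w0 \<in> W" "w0 \<noteq> 0\<^sub>v (m * n)" using is_subspaceD(2)[OF W] by blast
      \<comment> \<open>If block k + 1 is the highest nonzero one, E puts a multiple of it into
        block k and empties everything above. The multiple (k + 1)(m - k - 1) is nonzero since k + 1
        < m.\<close>
      have low: "\<exists>w\<in>W. w \<noteq> 0\<^sub>v (m * n) \<and> (\<forall>l. k < l \<and> l < m \<longrightarrow> blk n w l = 0\<^sub>v n)" if "k \<le> m" for k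
        using that
      proof (induction rule: inc_induct)
        case base
        show ?case using w0 by auto
      next
        case (step k)
        then obtain w where w: "w \<in> W" "w \<noteq> 0\<^sub>v (m * n)" "\<And>l. Suc k < l \<Longrightarrow> l < m \<Longrightarrow> blk n w l = 0\<^sub>v n"
          by blast
        show ?case
        proof (cases "Suc k < m \<and> blk n w (Suc k) \<noteq> 0\<^sub>v n")
          case False
          have "blk n w l = 0\<^sub>v n" if "k < l" "l < m" for l
            using w(3)[of l] False that by (cases "l = Suc k") auto
          then show ?thesis using w(1,2) by blast
        next
          case True
          let ?w = "kron (sl2_E m) (1\<^sub>m n) *\<^sub>v w"
          have blkE: "blk n ?w l = (if Suc l < m then of_nat (Suc l * (m - Suc l)) \<cdot>\<^sub>v blk n w (Suc l) else 0\<^sub>v n)"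
            if "l < m" for l using Wc[OF w(1)] that by (rule blk_kron_E)
          have "blk n ?w l = 0\<^sub>v n" if "k < l" "l < m" for l
            using that w(3)[of "Suc l"] by (simp add: blkE smult_zero_vec_right)
          moreover have "?w \<noteq> 0\<^sub>v (m * n)"
          proof
            assume 0: "?w = 0\<^sub>v (m * n)"
            have "of_nat (Suc k * (m - Suc k)) \<cdot>\<^sub>v blk n w (Suc k) = 0\<^sub>v n"
              using blkE[of k] True blk_zero[of k m n] unfolding 0 by simp
            moreover have "(of_nat (Suc k * (m - Suc k)) :: complex) \<noteq> 0" using True by (simp del: of_nat_mult mult_Suc)
            moreover obtain j where "j < n" "blk n w (Suc k) $ j \<noteq> 0"
              using True by (metis blk_dim eq_vecI index_zero_vec(1,2))
            ultimately show False
              by (metis blk_dim index_smult_vec(1) index_zero_vec(1) mult_eq_0_iff)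
          qed
          ultimately show ?thesis using E[OF w(1)] by blast
        qed
      qed
      then obtain w where w: "w \<in> W" "w \<noteq> 0\<^sub>v (m * n)" "\<And>l. 0 < l \<Longrightarrow> l < m \<Longrightarrow> blk n w l = 0\<^sub>v n"
        by blast
      define u where "u = blk n w 0"
      have wu: "w = emb m n 0 u"
      proof (rule blk_eqI[of _ m n])
        fix k assume "k < m"
        then show "blk n w k = blk n (emb m n 0 u) k" using w(3)[of k] by (simp add: blk_emb u_def)
      qed (use Wc w in auto)
      have uc: "u \<in> carrier_vec n" by (simp add: u_def)
      have "u \<noteq> 0\<^sub>v n"
      proof
        assume 0: "u = 0\<^sub>v n"
        from wu have "w = 0\<^sub>v (m * n)" unfolding 0 emb_zero .
        with w(2) show False by contradiction
      qed
      note u = uc this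
      define U where "U = {v \<in> carrier_vec n. emb m n 0 v \<in> W}"
      have "U = carrier_vec n"
      proof (rule irreducible_setD[OF irr _ _ _ u(2)])
        show "is_subspace n U" unfolding is_subspace_def U_def
          using is_subspaceD(2-4)[OF W] by (auto simp: emb_add emb_smult emb_zero)
        show "u \<in> U" using u(1) w(1) wu unfolding U_def by (metis (mono_tags) mem_Collect_eq)
        fix Y v assume "Y \<in> S" "v \<in> U"
        then have Yv: "Y \<in> carrier_mat n n" "v \<in> carrier_vec n" "kron (1\<^sub>m m) Y *\<^sub>v emb m n 0 v \<in> W"
          using S R unfolding U_def by auto
        have "kron (1\<^sub>m m) Y *\<^sub>v emb m n 0 v = emb m n 0 (Y *\<^sub>v v)"
          using Yv Wc[OF Yv(3)] by - (rule blk_eqI[of _ m n], auto simp: blk_kron_right blk_emb)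
        then show "Y *\<^sub>v v \<in> U" unfolding U_def using Yv by simp
      qed
      then have emb0: "emb m n 0 v \<in> W" if "v \<in> carrier_vec n" for v using that unfolding U_def by blast
      have embk: "emb m n k v \<in> W" if "v \<in> carrier_vec n" "k < m" for k v
        using that(2)
      proof (induction k)
        case 0 then show ?case using emb0 that by simp
      next
        case (Suc k)
        have "kron (sl2_F m) (1\<^sub>m n) *\<^sub>v emb m n k v = emb m n (Suc k) v"
          using that(1) Suc.prems
          by - (rule blk_eqI[of _ m n], auto simp: mult_mat_vec_carrier[OF kron_carrier[OF sl2_carrier(2) one_carrier_mat]] simp: blk_kron_F blk_emb)
        then show ?case using F[of "emb m n k v"] Suc by simp
      qed
      \<comment> \<open>Induction on the number k of blocks that may be nonzero: the highest of them
        is subtracted, and it lies in W by \<open>embk\<close>.\<close>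
      have all: "w \<in> W" if "w \<in> carrier_vec (m * n)" "\<And>l. k \<le> l \<Longrightarrow> l < m \<Longrightarrow> blk n w l = 0\<^sub>v n" "k \<le> m" for k w
        using that
      proof (induction k arbitrary: w)
        case 0
        then have "w = 0\<^sub>v (m * n)" by - (rule blk_eqI[of _ m n], auto simp: blk_zero)
        then show ?case using is_subspaceD(2)[OF W] by simp
      next
        case (Suc k)
        define w' where "w' = w + emb m n k ((- 1) \<cdot>\<^sub>v blk n w k)"
        have "w' \<in> W"
        proof (rule Suc.IH)
          fix l assume l: "k \<le> l" "l < m"
          show "blk n w' l = 0\<^sub>v n"
          proof (cases "l = k")
            case True
            then show ?thesis using Suc.prems l unfolding w'_def
              by (simp add: blk_add blk_emb) (auto intro!: eq_vecI)
          next
            case False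
            then show ?thesis using Suc.prems l unfolding w'_def
              by (simp add: blk_add blk_emb)
          qed
        qed (use Suc.prems in \<open>auto simp: w'_def\<close>)
        then have "w' + emb m n k (blk n w k) \<in> W" using is_subspaceD(3)[OF W] embk Suc.prems by simp
        moreover have "w' + emb m n k (blk n w k) = w" using Suc.prems(1)
          by (auto simp: w'_def emb_smult intro!: eq_vecI)
        ultimately show ?case by simp
      qed
      have "W = carrier_vec (m * n)" using all[of _ m] Wc by auto
      then show False using \<open>W \<noteq> carrier_vec (m * n)\<close> by blast
    qed
  qed
qed

section \<open>Separation of the evaluation points\<close>

lemma tensor_rep_carrier: "tensor_rep L X \<in> carrier_mat (prod_list (map snd L)) (prod_list (map snd L))"
  by (induction L X rule: tensor_rep.induct) auto

lemma ev_rep_oa_cong: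
  "ev p a = ev p' a \<Longrightarrow> ev p (inverse a) = ev p' (inverse a) \<Longrightarrow> ev q a = ev q' a \<Longrightarrow>
   ev_rep m a (oa p q) = ev_rep m a (oa p' q')"
  by (simp add: ev_rep_oa)

lemma tensor_rep_oa_cong:
  assumes "\<And>a. a \<in> fst ` set L \<Longrightarrow> ev p a = ev p' a \<and> ev p (inverse a) = ev p' (inverse a) \<and> ev q a = ev q' a"
  shows "tensor_rep L (oa p q) = tensor_rep L (oa p' q')"
  using assms
proof (induction L)
  case (Cons am L)
  obtain a m where am: "am = (a, m)" by force
  have "ev_rep m a (oa p q) = ev_rep m a (oa p' q')" using Cons.prems[of a] am by (intro ev_rep_oa_cong) auto
  then show ?case using Cons am by simp
qed simp

lemma ev_rep_zero: "ev_rep m a (oa 0 0) = 0\<^sub>m m m"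
  unfolding ev_rep_oa by (intro eq_matI) auto

lemma tensor_rep_zero: "tensor_rep L (oa 0 0) = 0\<^sub>m (prod_list (map snd L)) (prod_list (map snd L))"
proof (induction L)
  case (Cons am L)
  then show ?case
    by (cases am) (simp add: ev_rep_zero kron_zero_left[OF one_carrier_mat] kron_zero_right[OF one_carrier_mat])
qed simp

lemma tensor_rep_vanish:
  assumes "\<And>a. a \<in> fst ` set L \<Longrightarrow> ev p a = 0 \<and> ev p (inverse a) = 0 \<and> ev q a = 0"
  shows "tensor_rep L (oa p q) = 0\<^sub>m (prod_list (map snd L)) (prod_list (map snd L))"
  using tensor_rep_oa_cong[of L p 0 q 0] assms tensor_rep_zero by simp

lemma ev_rep_E: "ev p a = 1 \<Longrightarrow> ev p (inverse a) = 0 \<Longrightarrow> ev q a = 0 \<Longrightarrow> ev_rep m a (oa p q) = sl2_E m"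
  unfolding ev_rep_oa by (intro eq_matI) auto

lemma ev_rep_F: "ev p a = 0 \<Longrightarrow> ev p (inverse a) = 1 \<Longrightarrow> ev q a = 0 \<Longrightarrow> ev_rep m a (oa p q) = sl2_F m"
  unfolding ev_rep_oa by (intro eq_matI) auto

text \<open>Evaluating \<open>e\<close> at all points \<open>b\<close> and \<open>1 / b\<close> turns \<open>oa e 0\<close> into the raising operator of the slot \<open>a\<close> alone.\<close>

lemma separating_laurent:
  assumes d: "distinct (as @ map inverse as)" and z: "0 \<notin> set as" and a: "a \<in> set as"
  obtains e where "ev e a = 1" "ev e (inverse a) = 0"
    "\<And>b. b \<in> set as \<Longrightarrow> b \<noteq> a \<Longrightarrow> ev e b = 0 \<and> ev e (inverse b) = 0"
proof -
  let ?B = "set (as @ map inverse as) - {a}"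
  obtain e where e: "ev e a = 1" "\<And>c. c \<in> ?B \<Longrightarrow> ev e c = 0"
  proof (rule interpolation[of ?B a])
    show "a \<noteq> 0" using z a by auto
    show "0 \<notin> ?B" using z by auto
  qed simp_all
  have "inverse a \<noteq> a" using d a by (metis (no_types) UnI2 disjoint_iff distinct_append image_eqI set_map)
  then have "inverse a \<in> ?B" using a by auto
  moreover have "b \<in> ?B" "inverse b \<in> ?B" if "b \<in> set as" "b \<noteq> a" for b
    using d a that by (auto simp: disjoint_iff)
  ultimately show ?thesis using that e by blast
qed

text \<open>With e separating the point a of the slot in front, \<open>oa e 0\<close> and
  \<open>oa (flip e) 0\<close> act as E and F in this slot and as 0 in the others. The symmetric
  multiplier 1 - e - flip e does the reverse: it switches this slot off and leaves the action of the
  others unchanged.\<close>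

lemma tensor_rep_irreducible:
  assumes "distinct (map fst L @ map (inverse \<circ> fst) L)" "0 \<notin> fst ` set L" "0 \<notin> snd ` set L"
  shows "irreducible_set (prod_list (map snd L)) (tensor_rep L ` OA)"
  using assms
proof (induction L)
  case Nil
  have "W = {0\<^sub>v 1} \<or> W = carrier_vec 1" if W: "is_subspace 1 W" for W
  proof (rule disjCI)
    assume "W \<noteq> carrier_vec 1"
    show "W = {0\<^sub>v 1}"
    proof (rule ccontr)
      assume "W \<noteq> {0\<^sub>v 1}"
      then obtain w where w: "w \<in> W" "w \<noteq> 0\<^sub>v 1" using is_subspaceD(2)[OF W] by blast
      have wc: "w \<in> carrier_vec 1" using is_subspaceD(1)[OF W w(1)] .
      have w0: "w $ 0 \<noteq> 0" using w(2) wc by (auto intro!: eq_vecI)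
      have "v \<in> W" if v: "v \<in> carrier_vec 1" for v
      proof -
        have "v = (v $ 0 / w $ 0) \<cdot>\<^sub>v w" using v wc w0 by (intro eq_vecI) auto
        then show ?thesis using is_subspaceD(4)[OF W w(1)] by metis
      qed
      then show False using \<open>W \<noteq> carrier_vec 1\<close> is_subspaceD(1)[OF W] by blast
    qed
  qed
  then show ?case unfolding irreducible_set_def by simp
next
  case (Cons am L)
  obtain a m where am: "am = (a, m)" by force
  let ?n = "prod_list (map snd L)" and ?as = "map fst (am # L)"
  have d: "distinct (?as @ map inverse ?as)" using Cons.prems(1) by (simp add: comp_def)
  have z: "0 \<notin> set ?as" "a \<in> set ?as" using Cons.prems am by auto
  have aL: "b \<in> set ?as \<and> b \<noteq> a" if "b \<in> fst ` set L" for b using that d am by auto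
  obtain e where e: "ev e a = 1" "ev e (inverse a) = 0"
    "\<And>b. b \<in> set ?as \<Longrightarrow> b \<noteq> a \<Longrightarrow> ev e b = 0 \<and> ev e (inverse b) = 0"
    using separating_laurent[OF d z] by blast
  have a0: "a \<noteq> 0" "m > 0" using Cons.prems am by auto
  have "irreducible_set ?n (tensor_rep L ` OA)" using Cons by auto
  then have "irreducible_set (m * ?n) ({kron (sl2_E m) (1\<^sub>m ?n), kron (sl2_F m) (1\<^sub>m ?n)} \<union> kron (1\<^sub>m m) ` (tensor_rep L ` OA))"
    using a0 tensor_rep_carrier by (intro irreducible_tensor_sl2) auto
  moreover have "kron (sl2_E m) (1\<^sub>m ?n) \<in> tensor_rep (am # L) ` OA"
  proof -
    have "tensor_rep L (oa e 0) = 0\<^sub>m ?n ?n" using aL e by (intro tensor_rep_vanish) simp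
    then have "tensor_rep (am # L) (oa e 0) = kron (sl2_E m) (1\<^sub>m ?n)"
      using e am by (simp add: ev_rep_E kron_zero_right[of _ m])
    then show ?thesis by (intro image_eqI[of _ _ "oa e 0"]) simp_all
  qed
  moreover have "kron (sl2_F m) (1\<^sub>m ?n) \<in> tensor_rep (am # L) ` OA"
  proof -
    have "tensor_rep L (oa (flip e) 0) = 0\<^sub>m ?n ?n" using aL e by (intro tensor_rep_vanish) simp
    then have "tensor_rep (am # L) (oa (flip e) 0) = kron (sl2_F m) (1\<^sub>m ?n)"
      using e am by (simp add: ev_rep_F kron_zero_right[of _ m])
    then show ?thesis by (intro image_eqI[of _ _ "oa (flip e) 0"]) simp_all
  qed
  moreover have "kron (1\<^sub>m m) (tensor_rep L X) \<in> tensor_rep (am # L) ` OA" if X: "X \<in> OA" for X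
  proof -
    obtain p q where X: "X = oa p q" "flip q = - q" using OA_cases[OF X] by blast
    define s where "s = 1 - (e + flip e)"
    have fs: "flip s = s" by (simp add: s_def)
    have sa: "ev s a = 0" "ev s (inverse a) = 0" using e a0 by (simp_all add: s_def)
    have sL: "ev s b = 1" "ev s (inverse b) = 1" if "b \<in> fst ` set L" for b
      using aL[OF that] e(3)[of b] by (simp_all add: s_def)
    have "ev_rep m a (oa (s * p) (s * q)) = ev_rep m a (oa 0 0)"
      using sa a0 by (intro ev_rep_oa_cong) auto
    moreover have "tensor_rep L (oa (s * p) (s * q)) = tensor_rep L X" unfolding X
    proof (rule tensor_rep_oa_cong)
      fix b assume b: "b \<in> fst ` set L"
      then have "b \<noteq> 0" using Cons.prems by auto
      then show "ev (s * p) b = ev p b \<and> ev (s * p) (inverse b) = ev p (inverse b) \<and> ev (s * q) b = ev q b"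
        using sL[OF b] by simp
    qed
    ultimately have "tensor_rep (am # L) (oa (s * p) (s * q)) = kron (1\<^sub>m m) (tensor_rep L X)"
      using am tensor_rep_carrier[of L X] by (simp add: ev_rep_zero kron_zero_left[OF one_carrier_mat])
    moreover have "oa (s * p) (s * q) \<in> OA" using X(2) fs by simp
    ultimately show ?thesis by (intro image_eqI[of _ _ "oa (s * p) (s * q)"]) simp_all
  qed
  ultimately have "irreducible_set (m * ?n) (tensor_rep (am # L) ` OA)"
    by (elim irreducible_set_mono) auto
  then show ?case using am by simp
qed

section \<open>Commuting sl2-triples and highest weight vectors\<close>

definition sl2_triple :: "nat \<Rightarrow> complex mat \<Rightarrow> complex mat \<Rightarrow> complex mat \<Rightarrow> bool" where
  "sl2_triple d E F H \<longleftrightarrow> E \<in> carrier_mat d d \<and> F \<in> carrier_mat d d \<and> H \<in> carrier_mat d d \<and>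
     E * F - F * E = H \<and> H * E - E * H = 2 \<cdot>\<^sub>m E \<and> H * F - F * H = (- 2) \<cdot>\<^sub>m F"

lemma commutator_mult:
  fixes A B C :: "complex mat"
  assumes "A \<in> carrier_mat d d" "B \<in> carrier_mat d d" "M \<in> carrier_mat d n" "A * B - B * A = C"
  shows "A * (B * M) = B * (A * M) + C * M"
proof -
  have c: "A * B \<in> carrier_mat d d" "B * A \<in> carrier_mat d d" using assms by auto
  have "C * M = A * B * M - B * A * M"
    unfolding assms(4)[symmetric] by (rule minus_mult_distrib_mat[OF c assms(3)])
  also have "\<dots> = A * (B * M) - B * (A * M)" using assms(1-3) by (simp add: assoc_mult_mat[of _ d d _ d])
  finally show ?thesis using assms(1-3) by (auto intro!: eq_matI simp del: index_mult_mat(1))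
qed

lemma sl2_ladder_aux:
  assumes t: "sl2_triple d E F H" and M: "M \<in> carrier_mat d n"
  shows "E * (F * M) = F * (E * M) + H * M" "H * (F * M) = F * (H * M) + (- 2) \<cdot>\<^sub>m (F * M)"
    "H * (E * M) = E * (H * M) + 2 \<cdot>\<^sub>m (E * M)"
  using t M commutator_mult[of E d F M n H] commutator_mult[of H d F M n "(- 2) \<cdot>\<^sub>m F"]
    commutator_mult[of H d E M n "2 \<cdot>\<^sub>m E"]
  unfolding sl2_triple_def by (simp_all add: mult_smult_assoc_mat[of _ d d _ n])

lemma zero_smult_mat: "A \<in> carrier_mat n m \<Longrightarrow> (0 :: complex) \<cdot>\<^sub>m A = 0\<^sub>m n m"
  by (intro eq_matI) auto

text \<open>Iterated left multiplication lets F act on a rectangular block of columns; a single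
  vector is the case of one column.\<close>

definition lpow :: "complex mat \<Rightarrow> nat \<Rightarrow> complex mat \<Rightarrow> complex mat" where
  "lpow F k M = ((\<lambda>M. F * M) ^^ k) M"

lemma lpow_simps [simp]: "lpow F 0 M = M" "lpow F (Suc k) M = F * lpow F k M"
  by (simp_all add: lpow_def)

lemma lpow_carrier [simp]: "F \<in> carrier_mat d d \<Longrightarrow> M \<in> carrier_mat d n \<Longrightarrow> lpow F k M \<in> carrier_mat d n"
  by (induction k) auto

lemma lpow_smult:
  "F \<in> carrier_mat d d \<Longrightarrow> M \<in> carrier_mat d n \<Longrightarrow> lpow F k (c \<cdot>\<^sub>m M) = c \<cdot>\<^sub>m lpow F k M"
  by (induction k) (auto simp: mult_smult_distrib[of _ d d _ n])

lemma lpow_mult: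
  "F \<in> carrier_mat d d \<Longrightarrow> M \<in> carrier_mat d n \<Longrightarrow> N \<in> carrier_mat n n' \<Longrightarrow> lpow F k (M * N) = lpow F k M * N"
  by (induction k) (auto simp: assoc_mult_mat[of _ d d _ n _ n'])

lemma lpow_commute:
  assumes "B \<in> carrier_mat d d" "F \<in> carrier_mat d d" "M \<in> carrier_mat d n" "B * F = F * B"
  shows "B * lpow F k M = lpow F k (B * M)"
proof (induction k)
  case (Suc k)
  have c: "lpow F k M \<in> carrier_mat d n" using assms by simp
  have "B * (F * lpow F k M) = F * (B * lpow F k M)"
    using assoc_mult_mat[OF assms(1,2) c] assoc_mult_mat[OF assms(2,1) c] assms(4) by simp
  then show ?case using Suc by simp
qed simp

text \<open>The columns of M are killed by E and have weight \<nu>. Moving E past one more F adds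
  the current weight, so the coefficient is the sum of \<nu> - 2 i over i \<le> k, which is (k +
  1)(\<nu> - k).\<close>

lemma sl2_ladder:
  assumes t: "sl2_triple d E F H" and M: "M \<in> carrier_mat d n"
    and EM: "E * M = 0\<^sub>m d n" and HM: "H * M = \<nu> \<cdot>\<^sub>m M"
  shows "H * lpow F k M = (\<nu> - 2 * of_nat k) \<cdot>\<^sub>m lpow F k M"
    and "E * lpow F (Suc k) M = (of_nat (Suc k) * (\<nu> - of_nat k)) \<cdot>\<^sub>m lpow F k M"
proof -
  have c: "E \<in> carrier_mat d d" "F \<in> carrier_mat d d" "H \<in> carrier_mat d d"
    using t unfolding sl2_triple_def by auto
  have lc: "lpow F k M \<in> carrier_mat d n" for k using c M by simp
  have H: "H * lpow F k M = (\<nu> - 2 * of_nat k) \<cdot>\<^sub>m lpow F k M" for k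
  proof (induction k)
    case (Suc k)
    have "H * lpow F (Suc k) M = F * (H * lpow F k M) + (- 2) \<cdot>\<^sub>m (F * lpow F k M)"
      using sl2_ladder_aux(2)[OF t lc] by simp
    also have "F * (H * lpow F k M) = (\<nu> - 2 * of_nat k) \<cdot>\<^sub>m (F * lpow F k M)"
      unfolding Suc by (rule mult_smult_distrib[OF c(2) lc])
    finally show ?case using c(2) lc[of k]
      by (auto intro!: eq_matI simp: algebra_simps simp del: index_mult_mat(1))
  qed (simp add: HM)
  show "H * lpow F k M = (\<nu> - 2 * of_nat k) \<cdot>\<^sub>m lpow F k M" by (rule H)
  show "E * lpow F (Suc k) M = (of_nat (Suc k) * (\<nu> - of_nat k)) \<cdot>\<^sub>m lpow F k M"
  proof (induction k)
    case 0
    have "E * lpow F (Suc 0) M = F * (E * M) + H * M" using sl2_ladder_aux(1)[OF t M] by simp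
    then show ?case using c M by (simp add: EM HM)
  next
    case (Suc k)
    have "E * lpow F (Suc (Suc k)) M = F * (E * lpow F (Suc k) M) + H * lpow F (Suc k) M"
      using sl2_ladder_aux(1)[OF t lc[of "Suc k"]] by simp
    also have "F * (E * lpow F (Suc k) M) = (of_nat (Suc k) * (\<nu> - of_nat k)) \<cdot>\<^sub>m lpow F (Suc k) M"
      unfolding Suc using mult_smult_distrib[OF c(2) lc] by simp
    finally show ?case unfolding H using lc[of "Suc k"]
      by (auto intro!: eq_matI simp: algebra_simps simp del: index_mult_mat(1) lpow_simps)
  qed
qed

text \<open>The operator on the target space that has to match \<open>tensor_rep L (oa p q)\<close>:
  each point contributes the evaluated element in its own triple. For the triples coming from \<rho>
  it equals \<open>T p q\<close>.\<close>

definition rsum :: "nat \<Rightarrow> (complex \<Rightarrow> complex mat) \<Rightarrow> (complex \<Rightarrow> complex mat) \<Rightarrow> (complex \<Rightarrow> complex mat) \<Rightarrow>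
    complex list \<Rightarrow> laurent \<Rightarrow> laurent \<Rightarrow> complex mat" where
  "rsum d E F H as p q =
     foldr (\<lambda>a M. (ev p a \<cdot>\<^sub>m E a + ev p (inverse a) \<cdot>\<^sub>m F a + ev q a \<cdot>\<^sub>m H a) + M) as (0\<^sub>m d d)"

lemma rsum_simps [simp]: "rsum d E F H [] p q = 0\<^sub>m d d"
  "rsum d E F H (a # as) p q =
     (ev p a \<cdot>\<^sub>m E a + ev p (inverse a) \<cdot>\<^sub>m F a + ev q a \<cdot>\<^sub>m H a) + rsum d E F H as p q"
  by (simp_all add: rsum_def)

definition commuting_triples :: "nat \<Rightarrow> (complex \<Rightarrow> complex mat) \<Rightarrow> (complex \<Rightarrow> complex mat) \<Rightarrow>
    (complex \<Rightarrow> complex mat) \<Rightarrow> complex set \<Rightarrow> bool" where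
  "commuting_triples d E F H S \<longleftrightarrow> (\<forall>a\<in>S. sl2_triple d (E a) (F a) (H a)) \<and>
     (\<forall>a\<in>S. \<forall>b\<in>S. a \<noteq> b \<longrightarrow> (\<forall>X\<in>{E a, F a, H a}. \<forall>Y\<in>{E b, F b, H b}. X * Y = Y * X))"

lemma commuting_triplesD:
  assumes "commuting_triples d E F H S" "a \<in> S"
  shows "sl2_triple d (E a) (F a) (H a)"
    "E a \<in> carrier_mat d d" "F a \<in> carrier_mat d d" "H a \<in> carrier_mat d d"
  using assms unfolding commuting_triples_def sl2_triple_def by auto

lemma commuting_triples_comm:
  assumes "commuting_triples d E F H S" "a \<in> S" "b \<in> S" "a \<noteq> b"
    "X \<in> {E a, F a, H a}" "Y \<in> {E b, F b, H b}"
  shows "X * Y = Y * X"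
  using assms unfolding commuting_triples_def by blast

lemma commuting_triples_mono:
  assumes "commuting_triples d E F H S" "S' \<subseteq> S"
  shows "commuting_triples d E F H S'"
  unfolding commuting_triples_def using assms commuting_triplesD(1)[OF assms(1)]
    commuting_triples_comm[OF assms(1)] by (meson subsetD)

lemma rsum_carrier:
  assumes "commuting_triples d E F H S" "set as \<subseteq> S"
  shows "rsum d E F H as p q \<in> carrier_mat d d"
  using assms(2) by (induction as) (auto dest: commuting_triplesD[OF assms(1)])

lemma rsum_commute:
  assumes S: "commuting_triples d E F H S" "set as \<subseteq> S" and b: "b \<in> S" "b \<notin> set as"
  shows "rsum d E F H as p q * F b = F b * rsum d E F H as p q"
  using assms(2) b(2)
proof (induction as)
  case Nil
  then show ?case using commuting_triplesD(3)[OF S(1) b(1)] by simp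
next
  case (Cons a as)
  note c = commuting_triplesD(2-4)[OF S(1), of a] commuting_triplesD(3)[OF S(1) b(1)]
  have aS: "a \<in> S" "a \<noteq> b" using Cons.prems by auto
  note ca = c(1-3)[OF aS(1)]
  have R: "rsum d E F H as p q \<in> carrier_mat d d" using rsum_carrier[OF S(1)] Cons.prems by simp
  have comm: "E a * F b = F b * E a" "F a * F b = F b * F a" "H a * F b = F b * H a"
    using commuting_triples_comm[OF S(1) aS(1) b(1) aS(2)] by auto
  have IH: "rsum d E F H as p q * F b = F b * rsum d E F H as p q" using Cons by simp
  let ?e = "ev p a \<cdot>\<^sub>m E a" and ?f = "ev p (inverse a) \<cdot>\<^sub>m F a" and ?h = "ev q a \<cdot>\<^sub>m H a"
  have c': "?e \<in> carrier_mat d d" "?f \<in> carrier_mat d d" "?h \<in> carrier_mat d d" using ca by auto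
  note pc = c'[THEN mult_carrier_mat, OF c(4)] mult_carrier_mat[OF R c(4)]
  have "(?e + ?f + ?h + rsum d E F H as p q) * F b = ?e * F b + ?f * F b + ?h * F b + rsum d E F H as p q * F b"
    using c' R c(4) pc by (simp add: add_mult_distrib_mat[of _ d d _ _ d] del: assoc_add_mat)
  also have "\<dots> = F b * ?e + F b * ?f + F b * ?h + F b * rsum d E F H as p q"
    using ca c(4) comm IH by (simp add: mult_smult_assoc_mat[of _ d d] mult_smult_distrib[of _ d d])
  also have "\<dots> = F b * (?e + ?f + ?h + rsum d E F H as p q)"
    using c' R c(4) by (simp add: mult_add_distrib_mat[of _ d d _ d] del: assoc_add_mat)
  finally show ?case by simp
qed

text \<open>Vectors as one-column matrices, so that the ladder identities for column blocks also
  cover a single highest weight vector.\<close>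

definition colmat :: "complex vec \<Rightarrow> complex mat" where
  "colmat v = mat (dim_vec v) 1 (\<lambda>(i, j). v $ i)"

lemma colmat_carrier [simplified, simp]: "v \<in> carrier_vec d \<Longrightarrow> colmat v \<in> carrier_mat d 1"
  by (simp add: colmat_def)

lemma mult_colmat: "A \<in> carrier_mat d d \<Longrightarrow> v \<in> carrier_vec d \<Longrightarrow> A * colmat v = colmat (A *\<^sub>v v)"
  by (intro eq_matI) (auto simp: colmat_def scalar_prod_def)

lemma colmat_smult: "colmat (c \<cdot>\<^sub>v v) = c \<cdot>\<^sub>m colmat v"
  by (intro eq_matI) (auto simp: colmat_def)

lemma colmat_zero: "colmat (0\<^sub>v d) = 0\<^sub>m d 1"
  by (intro eq_matI) (auto simp: colmat_def)

lemma colmat_eq_zero: "v \<in> carrier_vec d \<Longrightarrow> colmat v = 0\<^sub>m d 1 \<longleftrightarrow> v = 0\<^sub>v d"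
proof
  assume v: "v \<in> carrier_vec d" and 0: "colmat v = 0\<^sub>m d 1"
  show "v = 0\<^sub>v d"
  proof (rule eq_vecI)
    fix i assume "i < dim_vec (0\<^sub>v d :: complex vec)"
    then show "v $ i = 0\<^sub>v d $ i" using arg_cong[OF 0, of "\<lambda>M. M $$ (i, 0)"] v by (simp add: colmat_def)
  qed (use v in simp)
qed (simp add: colmat_zero)

text \<open>A highest weight vector generates the tensor module. The last clause, by which a joint
  eigenvector condition on \<open>v\<close> passes to the whole image, is what makes the induction work: it is
  applied to the generators belonging to the tensor factor that is added next.\<close>

lemma intertwiner_exists:
  assumes "commuting_triples d E F H (fst ` set L)" "distinct (map fst L)" "v \<in> carrier_vec d"
    "\<And>a m. (a, m) \<in> set L \<Longrightarrow> m > 0 \<and> E a *\<^sub>v v = 0\<^sub>v d \<and> H a *\<^sub>v v = (of_nat m - 1) \<cdot>\<^sub>v v \<and>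
        lpow (F a) m (colmat v) = 0\<^sub>m d 1"
  shows "\<exists>P. P \<in> carrier_mat d (prod_list (map snd L)) \<and> col P 0 = v \<and>
    (\<forall>p q. P * tensor_rep L (oa p q) = rsum d E F H (map fst L) p q * P) \<and>
    (\<forall>B \<mu>. B \<in> carrier_mat d d \<longrightarrow> (\<forall>a\<in>fst ` set L. B * F a = F a * B) \<longrightarrow>
       B * colmat v = \<mu> \<cdot>\<^sub>m colmat v \<longrightarrow> B * P = \<mu> \<cdot>\<^sub>m P)"
  using assms
proof (induction L)
  case Nil
  have "col (colmat v) 0 = v" by (intro eq_vecI) (auto simp: colmat_def)
  moreover have "colmat v \<in> carrier_mat d 1" using Nil by simp
  moreover from this have "colmat v * 0\<^sub>m 1 1 = 0\<^sub>m d 1" by (rule right_mult_zero_mat)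
  ultimately show ?case using Nil by (intro exI[of _ "colmat v"]) (auto simp: left_mult_zero_mat[of _ d 1])
next
  case (Cons am L)
  obtain a m where am: "am = (a, m)" by force
  let ?n = "prod_list (map snd L)" and ?S = "fst ` set (am # L)"
  let ?R = "rsum d E F H (map fst L)"
  note S = Cons.prems(1)
  have sub: "fst ` set L \<subseteq> ?S" and aS: "a \<in> ?S" using am by auto
  have SL: "commuting_triples d E F H (fst ` set L)"
    using S sub by (rule commuting_triples_mono)
  note t = commuting_triplesD[OF S aS]
  have hwa: "m > 0" "E a *\<^sub>v v = 0\<^sub>v d" "H a *\<^sub>v v = (of_nat m - 1) \<cdot>\<^sub>v v" "lpow (F a) m (colmat v) = 0\<^sub>m d 1"
    using Cons.prems(4)[of a m] am by auto
  have aL: "a \<notin> fst ` set L" using Cons.prems(2) am by auto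
  obtain P0 where P0: "P0 \<in> carrier_mat d ?n" "col P0 0 = v"
    "\<And>p q. P0 * tensor_rep L (oa p q) = ?R p q * P0"
    "\<And>B \<mu>. B \<in> carrier_mat d d \<Longrightarrow> (\<And>b. b \<in> fst ` set L \<Longrightarrow> B * F b = F b * B) \<Longrightarrow>
       B * colmat v = \<mu> \<cdot>\<^sub>m colmat v \<Longrightarrow> B * P0 = \<mu> \<cdot>\<^sub>m P0"
  proof -
    have dL: "distinct (map fst L)" using Cons.prems(2) by simp
    have hL: "b > 0 \<and> E a *\<^sub>v v = 0\<^sub>v d \<and> H a *\<^sub>v v = (of_nat b - 1) \<cdot>\<^sub>v v \<and>
        lpow (F a) b (colmat v) = 0\<^sub>m d 1" if "(a, b) \<in> set L" for a b
      using that by (intro Cons.prems(4)) simp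
    show ?thesis
      by (rule exE[OF Cons.IH[OF SL dL Cons.prems(3)]], erule hL, elim conjE, rule that, assumption+)
        blast+
  qed
  have Lm: "k > 0" if "k \<in> snd ` set L" for k
  proof -
    from that obtain x where "x \<in> set L" "k = snd x" by blast
    then show ?thesis using Cons.prems(4)[of "fst x" "snd x"] by simp
  qed
  have n: "?n > 0" using Lm by (induction L) auto
  have vc: "v \<in> carrier_vec d" by fact
  have cab: "X * F b = F b * X" if "b \<in> fst ` set L" "X \<in> {E a, F a, H a}" for b X
    using commuting_triples_comm[OF S aS, of b X "F b"] that aL sub by auto
  \<comment> \<open>The eigenvector clause for L is used with B = E a and eigenvalue 0; E a commutes
    with the lowering operators of the other points.\<close>
  have EP0: "E a * P0 = 0\<^sub>m d ?n"
  proof -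
    have "E a * P0 = 0 \<cdot>\<^sub>m P0"
      using t cab hwa vc by (intro P0(4)) (auto simp: mult_colmat colmat_zero zero_smult_mat[OF colmat_carrier])
    then show ?thesis using zero_smult_mat[OF P0(1)] by simp
  qed
  have HP0: "H a * P0 = (of_nat m - 1) \<cdot>\<^sub>m P0"
    using t cab hwa vc by (intro P0(4)) (auto simp: mult_colmat colmat_smult)
  \<comment> \<open>\<open>Q k\<close> becomes the k-th column block of P, the image of v_k tensored
    with the remaining factors.\<close>
  define Q where "Q k = lpow (F a) k P0" for k
  have Qc: "Q k \<in> carrier_mat d ?n" for k unfolding Q_def using t P0 by simp
  have Q0: "Q 0 = P0" by (simp add: Q_def)
  have FQ: "F a * Q k = Q (Suc k)" for k by (simp add: Q_def)
  have HQ: "H a * Q k = (of_nat m - 1 - 2 * of_nat k) \<cdot>\<^sub>m Q k" for k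
    unfolding Q_def by (rule sl2_ladder(1)[OF t(1) P0(1) EP0 HP0])
  have EQ: "E a * Q (Suc k) = (of_nat (Suc k) * (of_nat m - 1 - of_nat k)) \<cdot>\<^sub>m Q k" for k
    unfolding Q_def by (rule sl2_ladder(2)[OF t(1) P0(1) EP0 HP0])
  have lpow_one: "lpow (F a) k M = lpow (F a) k (1\<^sub>m d) * M" if "M \<in> carrier_mat d n'" for k M n'
    using lpow_mult[OF t(3) one_carrier_mat that, of k] that by simp
  \<comment> \<open>The string must end on the whole image of P0, not only on v. The m-th power of F
    a kills v and commutes with the other lowering operators, so the eigenvector clause applies with
    eigenvalue 0.\<close>
  have Qm: "Q m = 0\<^sub>m d ?n"
  proof -
    let ?B = "lpow (F a) m (1\<^sub>m d)"
    have "?B * P0 = 0 \<cdot>\<^sub>m P0"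
    proof (rule P0(4))
      show "?B \<in> carrier_mat d d" using t by simp
      show "?B * colmat v = 0 \<cdot>\<^sub>m colmat v"
        using lpow_one[OF colmat_carrier[OF vc], of m] hwa(4) zero_smult_mat[OF colmat_carrier[OF vc]] by simp
      fix b assume b: "b \<in> fst ` set L"
      then have Fb: "F b \<in> carrier_mat d d" using commuting_triplesD(3)[OF S] sub by blast
      have "?B * F b = lpow (F a) m (F b)" using lpow_one[OF Fb] by simp
      also have "\<dots> = F b * ?B"
        using lpow_commute[OF Fb t(3) one_carrier_mat cab[OF b, of "F a", symmetric], of m] Fb by simp
      finally show "?B * F b = F b * ?B" .
    qed
    then show ?thesis using lpow_one[OF P0(1), of m] zero_smult_mat[OF P0(1)] unfolding Q_def by simp
  qed
  have RQ: "?R p q * Q k = Q k * tensor_rep L (oa p q)" for p q k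
  proof -
    have Rc: "?R p q \<in> carrier_mat d d" by (rule rsum_carrier[OF SL]) simp
    have "?R p q * F a = F a * ?R p q"
      using rsum_commute[OF S _ aS] sub aL by simp
    from lpow_commute[OF Rc t(3) P0(1) this, of k]
    have "?R p q * Q k = lpow (F a) k (P0 * tensor_rep L (oa p q))" unfolding Q_def P0(3) .
    also have "\<dots> = Q k * tensor_rep L (oa p q)"
      unfolding Q_def by (rule lpow_mult[OF t(3) P0(1) tensor_rep_carrier])
    finally show ?thesis .
  qed
  define P where "P = mat d (m * ?n) (\<lambda>(i, l). Q (l div ?n) $$ (i, l mod ?n))"
  have Pc: "P \<in> carrier_mat d (m * ?n)" by (simp add: P_def)
  have Pi: "P $$ (i, k * ?n + j) = Q k $$ (i, j)" if "i < d" "k < m" "j < ?n" for i k j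
    using that block_index_less[OF that(2,3)] by (simp add: P_def)
  have MP: "(M * P) $$ (i, k * ?n + j) = (M * Q k) $$ (i, j)"
    if "M \<in> carrier_mat d d" "i < d" "k < m" "j < ?n" for M i k j
  proof -
    have "(M * P) $$ (i, k * ?n + j) = (\<Sum>r<d. M $$ (i, r) * P $$ (r, k * ?n + j))"
      using that Pc block_index_less[OF that(3,4)] by (simp add: scalar_prod_def atLeast0LessThan)
    also have "\<dots> = (\<Sum>r<d. M $$ (i, r) * Q k $$ (r, j))" using that by (simp add: Pi)
    also have "\<dots> = (M * Q k) $$ (i, j)"
      using that Qc[of k] by (simp add: scalar_prod_def atLeast0LessThan)
    finally show ?thesis .
  qed
  have PK: "(P * kron A B) $$ (i, k * ?n + j) = (\<Sum>l<m. A $$ (l, k) * (Q l * B) $$ (i, j))"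
    if "A \<in> carrier_mat m m" "B \<in> carrier_mat ?n ?n" "i < d" "k < m" "j < ?n" for A B i k j
  proof -
    have kj: "k * ?n + j < m * ?n" using block_index_less that by blast
    have "(P * kron A B) $$ (i, k * ?n + j) = (\<Sum>r<m * ?n. P $$ (i, r) * kron A B $$ (r, k * ?n + j))"
      using that Pc kj by (simp add: scalar_prod_def atLeast0LessThan)
    also have "\<dots> = (\<Sum>r<m * ?n. Q (r div ?n) $$ (i, r mod ?n) * (A $$ (r div ?n, k) * B $$ (r mod ?n, j)))"
      using that kj by (intro sum.cong) (auto simp: kron_index[of _ m _ ?n] P_def)
    also have "\<dots> = (\<Sum>l<m. \<Sum>s<?n. Q l $$ (i, s) * (A $$ (l, k) * B $$ (s, j)))"
      by (rule sum_div_mod)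
    also have "\<dots> = (\<Sum>l<m. A $$ (l, k) * (Q l * B) $$ (i, j))"
      using that Qc by (intro sum.cong) (auto simp: scalar_prod_def atLeast0LessThan sum_distrib_left carrier_matD[OF Qc] ac_simps)
    finally show ?thesis .
  qed
  have col0: "col P 0 = v"
  proof (rule eq_vecI)
    fix i assume "i < dim_vec v"
    then have i: "i < d" using vc by simp
    have "col P 0 $ i = Q 0 $$ (i, 0)" using i Pc n hwa(1) Pi[of i 0 0] by simp
    also have "\<dots> = col P0 0 $ i" unfolding Q0 using i n P0(1) by simp
    finally show "col P 0 $ i = v $ i" using P0(2) by simp
  qed (use Pc vc in simp)
  have eig: "B * P = \<mu> \<cdot>\<^sub>m P" if B: "B \<in> carrier_mat d d" and BF: "\<And>b. b \<in> ?S \<Longrightarrow> B * F b = F b * B"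
    and Bv: "B * colmat v = \<mu> \<cdot>\<^sub>m colmat v" for B \<mu>
  proof (rule eq_matI)
    have BP0: "B * P0 = \<mu> \<cdot>\<^sub>m P0" using B BF Bv sub by (intro P0(4)) auto
    have BQ: "B * Q k = \<mu> \<cdot>\<^sub>m Q k" for k
      unfolding Q_def using lpow_commute[OF B t(3) P0(1) BF[OF aS], of k] lpow_smult[OF t(3) P0(1)]
      by (simp add: BP0)
    fix i l assume il: "i < dim_row (\<mu> \<cdot>\<^sub>m P)" "l < dim_col (\<mu> \<cdot>\<^sub>m P)"
    then obtain k j where kj: "k < m" "j < ?n" "l = k * ?n + j" "i < d"
      using Pc by (auto elim: block_index_cases)
    have "(B * P) $$ (i, l) = (B * Q k) $$ (i, j)" unfolding kj(3) by (rule MP[OF B kj(4,1,2)])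
    also have "\<dots> = \<mu> * Q k $$ (i, j)" unfolding BQ using kj Qc[of k] by simp
    finally show "(B * P) $$ (i, l) = (\<mu> \<cdot>\<^sub>m P) $$ (i, l)"
      using kj Pi[OF kj(4,1,2)] Pc block_index_less[OF kj(1,2)] by simp
  qed (use B Pc in auto)
  have inter: "P * tensor_rep (am # L) (oa p q) = rsum d E F H (map fst (am # L)) p q * P" for p q
  proof (rule eq_matI)
    let ?T = "tensor_rep L (oa p q)" and ?A = "ev_rep m a (oa p q)"
    let ?M = "ev p a \<cdot>\<^sub>m E a + ev p (inverse a) \<cdot>\<^sub>m F a + ev q a \<cdot>\<^sub>m H a"
    have Tc: "?T \<in> carrier_mat ?n ?n" by (rule tensor_rep_carrier)
    have Rc: "?R p q \<in> carrier_mat d d" by (rule rsum_carrier[OF SL]) simp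
    have Mc: "?M \<in> carrier_mat d d" using t by simp
    have rs: "rsum d E F H (map fst (am # L)) p q = ?M + ?R p q" using am by simp
    have tr: "tensor_rep (am # L) (oa p q) = kron ?A (1\<^sub>m ?n) + kron (1\<^sub>m m) ?T" using am by simp
    have kc: "kron ?A (1\<^sub>m ?n) \<in> carrier_mat (m * ?n) (m * ?n)" "kron (1\<^sub>m m) ?T \<in> carrier_mat (m * ?n) (m * ?n)"
      using Tc by simp_all
    fix i l assume "i < dim_row (rsum d E F H (map fst (am # L)) p q * P)"
      "l < dim_col (rsum d E F H (map fst (am # L)) p q * P)"
    then have il: "i < d" "l < m * ?n" unfolding rs using Pc Mc Rc by auto
    then obtain k j where kj: "k < m" "j < ?n" "l = k * ?n + j" by (auto elim: block_index_cases)
    note ikj = il(1) kj(1,2)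
    have Qij: "(Q k * 1\<^sub>m ?n) $$ (i, j) = Q k $$ (i, j)" for k using Qc[of k] by simp
    have l: "(P * tensor_rep (am # L) (oa p q)) $$ (i, l) =
        (\<Sum>r<m. ?A $$ (r, k) * Q r $$ (i, j)) + (Q k * ?T) $$ (i, j)"
    proof -
      have "P * tensor_rep (am # L) (oa p q) = P * kron ?A (1\<^sub>m ?n) + P * kron (1\<^sub>m m) ?T"
        unfolding tr by (rule mult_add_distrib_mat[OF Pc kc])
      then have "(P * tensor_rep (am # L) (oa p q)) $$ (i, l) =
          (P * kron ?A (1\<^sub>m ?n)) $$ (i, l) + (P * kron (1\<^sub>m m) ?T) $$ (i, l)"
        using Pc il carrier_matD[OF Tc] by (simp del: index_mult_mat(1))
      also have "(P * kron ?A (1\<^sub>m ?n)) $$ (i, l) = (\<Sum>r<m. ?A $$ (r, k) * Q r $$ (i, j))"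
        unfolding kj(3) PK[OF ev_rep_carrier one_carrier_mat ikj] Qij ..
      also have "(P * kron (1\<^sub>m m) ?T) $$ (i, l) = (\<Sum>r<m. if r = k then (Q k * ?T) $$ (i, j) else 0)"
        unfolding kj(3) PK[OF one_carrier_mat Tc ikj] using kj(1)
        by (intro sum.cong) (auto simp del: index_mult_mat(1))
      also have "\<dots> = (Q k * ?T) $$ (i, j)" using kj by simp
      finally show ?thesis .
    qed
    have r: "(rsum d E F H (map fst (am # L)) p q * P) $$ (i, l) =
        (?M * Q k) $$ (i, j) + (Q k * ?T) $$ (i, j)"
    proof -
      have "rsum d E F H (map fst (am # L)) p q * P = ?M * P + ?R p q * P"
        unfolding rs by (rule add_mult_distrib_mat[OF Mc Rc Pc])
      then have "(rsum d E F H (map fst (am # L)) p q * P) $$ (i, l) = (?M * P) $$ (i, l) + (?R p q * P) $$ (i, l)"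
        using Pc Mc Rc il by (simp del: index_mult_mat(1))
      then show ?thesis unfolding kj(3) MP[OF Mc ikj] MP[OF Rc ikj] RQ .
    qed
    have "?M * Q k = ev p a \<cdot>\<^sub>m (E a * Q k) + ev p (inverse a) \<cdot>\<^sub>m (F a * Q k) + ev q a \<cdot>\<^sub>m (H a * Q k)"
      using t Qc[of k] by (simp add: add_mult_distrib_mat[of _ d d _ _ ?n] mult_smult_assoc_mat[of _ d d _ ?n])
    then have M: "(?M * Q k) $$ (i, j) = ev p a * (E a * Q k) $$ (i, j) + ev p (inverse a) * Q (Suc k) $$ (i, j)
        + ev q a * ((of_nat m - 1 - 2 * of_nat k) * Q k $$ (i, j))"
      unfolding FQ HQ using t Qc[of k] Qc[of "Suc k"] ikj by (simp del: index_mult_mat(1))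
    have "(\<Sum>r<m. ?A $$ (r, k) * Q r $$ (i, j)) = (\<Sum>r<m. ev p a * (sl2_E m $$ (r, k) * Q r $$ (i, j)))
        + (\<Sum>r<m. ev p (inverse a) * (sl2_F m $$ (r, k) * Q r $$ (i, j)))
        + (\<Sum>r<m. ev q a * (sl2_H m $$ (r, k) * Q r $$ (i, j)))"
      unfolding ev_rep_oa sum.distrib[symmetric] using kj(1) by (intro sum.cong) (auto simp: algebra_simps)
    also have "(\<Sum>r<m. ev p a * (sl2_E m $$ (r, k) * Q r $$ (i, j))) = ev p a * (E a * Q k) $$ (i, j)"
    proof (cases k)
      case 0
      have "(E a * Q 0) $$ (i, j) = 0" unfolding Q0 EP0 using ikj by simp
      moreover have "(\<Sum>r<m. ev p a * (sl2_E m $$ (r, k) * Q r $$ (i, j))) = 0"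
        using 0 kj(1) by (intro sum.neutral) (auto simp: sl2_E_def)
      ultimately show ?thesis using 0 by simp
    next
      case (Suc k')
      have "(\<Sum>r<m. ev p a * (sl2_E m $$ (r, k) * Q r $$ (i, j))) =
        (\<Sum>r<m. if r = k' then ev p a * (of_nat (k * (m - k)) * Q k' $$ (i, j)) else 0)"
        using Suc kj(1) by (intro sum.cong) (auto simp: sl2_E_def)
      also have "\<dots> = ev p a * (of_nat (k * (m - k)) * Q k' $$ (i, j))" using Suc kj(1) by simp
      \<comment> \<open>Here the entry k (m - k) of \<open>sl2_E\<close> meets the ladder
        coefficient (k' + 1)(m - 1 - k') for k = k' + 1.\<close>
      also have "(of_nat (k * (m - k)) :: complex) = of_nat (Suc k') * (of_nat m - 1 - of_nat k')"
      proof -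
        obtain c where "m = Suc (k + c)" using kj(1) less_iff_Suc_add by blast
        then show ?thesis using Suc by (simp add: algebra_simps)
      qed
      finally show ?thesis unfolding Suc EQ using Qc[of k'] ikj by simp
    qed
    also have "(\<Sum>r<m. ev p (inverse a) * (sl2_F m $$ (r, k) * Q r $$ (i, j))) = ev p (inverse a) * Q (Suc k) $$ (i, j)"
    proof -
      have "(\<Sum>r<m. ev p (inverse a) * (sl2_F m $$ (r, k) * Q r $$ (i, j))) =
        (\<Sum>r<m. if r = Suc k then ev p (inverse a) * Q (Suc k) $$ (i, j) else 0)"
        using kj(1) by (intro sum.cong) (auto simp: sl2_F_def)
      \<comment> \<open>At the bottom, k + 1 = m, the model has no further basis vector; both sides
        agree because Q m = 0.\<close>
      also have "\<dots> = ev p (inverse a) * Q (Suc k) $$ (i, j)"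
      proof (cases "Suc k < m")
        case False
        then have "Suc k = m" using kj(1) by simp
        then have "Q (Suc k) $$ (i, j) = 0" using Qm ikj by simp
        then show ?thesis using False by simp
      qed simp
      finally show ?thesis .
    qed
    also have "(\<Sum>r<m. ev q a * (sl2_H m $$ (r, k) * Q r $$ (i, j))) =
        ev q a * ((of_nat m - 1 - 2 * of_nat k) * Q k $$ (i, j))"
    proof -
      have "(\<Sum>r<m. ev q a * (sl2_H m $$ (r, k) * Q r $$ (i, j))) =
        (\<Sum>r<m. if r = k then ev q a * ((of_nat m - 1 - 2 * of_nat k) * Q k $$ (i, j)) else 0)"
        using kj(1) by (intro sum.cong) (auto simp: sl2_H_def)
      then show ?thesis using kj(1) by simp
    qed
    finally show "(P * tensor_rep (am # L) (oa p q)) $$ (i, l) =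
        (rsum d E F H (map fst (am # L)) p q * P) $$ (i, l)"
      unfolding l r M by simp
  next
    show "dim_row (P * tensor_rep (am # L) (oa p q)) = dim_row (rsum d E F H (map fst (am # L)) p q * P)"
      using Pc carrier_matD[OF rsum_carrier[OF S, of "map fst (am # L)" p q]] by (simp del: rsum_simps)
    show "dim_col (P * tensor_rep (am # L) (oa p q)) = dim_col (rsum d E F H (map fst (am # L)) p q * P)"
      using Pc carrier_matD[OF tensor_rep_carrier[of L "oa p q"]] am by simp
  qed
  show ?case
  proof (intro exI[of _ P] conjI allI impI)
    show "P \<in> carrier_mat d (prod_list (map snd (am # L)))" using Pc am by simp
    show "col P 0 = v" by (rule col0)
    show "P * tensor_rep (am # L) (oa p q) = rsum d E F H (map fst (am # L)) p q * P" for p q by (rule inter)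
    show "B * P = \<mu> \<cdot>\<^sub>m P" if "B \<in> carrier_mat d d" "\<forall>b\<in>?S. B * F b = F b * B" "B * colmat v = \<mu> \<cdot>\<^sub>m colmat v" for B \<mu>
      using that by (intro eig) auto
  qed
qed

lemma mult_col: "A \<in> carrier_mat d d \<Longrightarrow> M \<in> carrier_mat d n \<Longrightarrow> j < n \<Longrightarrow> col (A * M) j = A *\<^sub>v col M j"
  by (intro eq_vecI) auto

section \<open>Ending of strings and highest weights\<close>

lemma eigenvalue_of_mat:
  fixes A :: "complex mat"
  assumes A: "A \<in> carrier_mat d d" and M: "M \<in> carrier_mat d n" "M \<noteq> 0\<^sub>m d n" and AM: "A * M = e \<cdot>\<^sub>m M"
  shows "e \<in> spectrum A"
proof -
  obtain i j where ij: "i < d" "j < n" "M $$ (i, j) \<noteq> 0"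
    using M by (metis carrier_matD eq_matI index_zero_mat)
  have "A *\<^sub>v col M j = e \<cdot>\<^sub>v col M j"
    using mult_col[OF A M(1) ij(2)] M(1) ij unfolding AM by simp
  moreover have "col M j \<noteq> 0\<^sub>v d"
  proof
    assume "col M j = 0\<^sub>v d"
    then have "col M j $ i = 0" using ij by simp
    then show False using ij M(1) by simp
  qed
  ultimately show ?thesis using A M(1) ij
    unfolding spectrum_def eigenvalue_def eigenvector_def by (auto intro!: exI[of _ "col M j"])
qed

text \<open>If no M k were 0, all e + c k would be eigenvalues of A. They are pairwise distinct
  because c \<noteq> 0, but the spectrum is finite.\<close>

lemma ladder_terminates:
  fixes A :: "complex mat"
  assumes A: "A \<in> carrier_mat d d" and M: "\<And>k. M k \<in> carrier_mat d n"
    and AM: "\<And>k. A * M k = (e + c * of_nat k) \<cdot>\<^sub>m M k" and c: "c \<noteq> 0"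
  shows "\<exists>k. M k = 0\<^sub>m d n"
proof (rule ccontr)
  assume "\<not> ?thesis"
  then have "e + c * of_nat k \<in> spectrum A" for k
    using eigenvalue_of_mat[OF A M _ AM] by blast
  then have "range (\<lambda>k. e + c * of_nat k) \<subseteq> spectrum A" by blast
  moreover have "finite (spectrum A)" using card_finite_spectrum[OF A] by simp
  ultimately have "finite (range (\<lambda>k. e + c * of_nat k))" by (rule finite_subset)
  moreover have "inj (\<lambda>k :: nat. e + c * of_nat k)" using c by (auto simp: inj_on_def)
  ultimately show False using finite_imageD by blast
qed

lemma Least_Suc_zero:
  assumes "\<exists>k. f k = z" "f 0 \<noteq> z"
  obtains k :: nat where "f (Suc k) = z" "f k \<noteq> z"
proof -
  define n where "n = (LEAST k. f k = z)"
  have n: "f n = z" unfolding n_def using assms(1) by (rule LeastI_ex)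
  then obtain k where k: "n = Suc k" using assms(2) by (cases n) auto
  have "f k \<noteq> z" using not_less_Least[of k "\<lambda>k. f k = z"] k n_def by simp
  then show ?thesis using that n k by simp
qed

text \<open>E raises weights by 2, so the string is finite. The witness is given as a power of E
  applied to u, because it has to stay in every E-invariant subspace containing u.\<close>

lemma sl2_raise_to_highest:
  assumes t: "sl2_triple d E F H" and u: "u \<in> carrier_vec d" "u \<noteq> 0\<^sub>v d" "H *\<^sub>v u = e \<cdot>\<^sub>v u"
  obtains k e' where "((*\<^sub>v) E ^^ k) u \<noteq> 0\<^sub>v d" "E *\<^sub>v (((*\<^sub>v) E ^^ k) u) = 0\<^sub>v d"
    "H *\<^sub>v (((*\<^sub>v) E ^^ k) u) = e' \<cdot>\<^sub>v (((*\<^sub>v) E ^^ k) u)"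
proof -
  have c: "E \<in> carrier_mat d d" "H \<in> carrier_mat d d" using t unfolding sl2_triple_def by auto
  let ?w = "\<lambda>k. ((*\<^sub>v) E ^^ k) u"
  have wc: "?w k \<in> carrier_vec d" for k using c u by (simp add: funpow_mult_carrier)
  have H: "H * colmat (?w k) = (e + 2 * of_nat k) \<cdot>\<^sub>m colmat (?w k)" for k
  proof (induction k)
    case 0
    then show ?case using c u by (simp add: mult_colmat colmat_smult)
  next
    case (Suc k)
    have E: "E * colmat (?w k) = colmat (?w (Suc k))" using c wc by (simp add: mult_colmat)
    have "H * colmat (?w (Suc k)) = E * (H * colmat (?w k)) + 2 \<cdot>\<^sub>m colmat (?w (Suc k))"
      using sl2_ladder_aux(3)[OF t colmat_carrier[OF wc[of k]]] unfolding E .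
    also have "E * (H * colmat (?w k)) = (e + 2 * of_nat k) \<cdot>\<^sub>m colmat (?w (Suc k))"
      unfolding Suc mult_smult_distrib[OF c(1) colmat_carrier[OF wc]] E ..
    finally show ?case using colmat_carrier[OF wc[of "Suc k"]]
      by (auto intro!: eq_matI simp: algebra_simps simp del: funpow.simps)
  qed
  have "\<exists>k. colmat (?w k) = 0\<^sub>m d (Suc 0)"
    by (rule ladder_terminates[OF c(2) colmat_carrier[OF wc] H]) simp
  then have "\<exists>k. ?w k = 0\<^sub>v d" using wc colmat_eq_zero by auto
  then obtain k where k: "?w (Suc k) = 0\<^sub>v d" "?w k \<noteq> 0\<^sub>v d"
    using Least_Suc_zero[of ?w "0\<^sub>v d"] u by auto
  have "colmat (H *\<^sub>v ?w k) = colmat ((e + 2 * of_nat k) \<cdot>\<^sub>v ?w k)"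
    using H[of k] mult_colmat[OF c(2) wc] by (simp add: colmat_smult)
  then have "H *\<^sub>v ?w k = (e + 2 * of_nat k) \<cdot>\<^sub>v ?w k"
  proof (intro eq_vecI)
    fix i assume eq: "colmat (H *\<^sub>v ?w k) = colmat ((e + 2 * of_nat k) \<cdot>\<^sub>v ?w k)"
      and "i < dim_vec ((e + 2 * of_nat k) \<cdot>\<^sub>v ?w k)"
    then have i: "i < d" using wc[of k] by simp
    show "(H *\<^sub>v ?w k) $ i = ((e + 2 * of_nat k) \<cdot>\<^sub>v ?w k) $ i"
      using arg_cong[OF eq, of "\<lambda>M. M $$ (i, 0)"] i wc[of k] c
      by (simp add: colmat_def del: index_mult_mat_vec)
  qed (use c wc[of k] in auto)
  then show ?thesis using that[of k] k by simp
qed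

text \<open>The vectors that are highest, with the weights found so far, for the points already
  treated form a subspace. E b and H b of the next point preserve it, as they commute with the
  earlier triples; so H b has an eigenvector in it, which E b raises inside it.\<close>

lemma joint_highest_weight:
  assumes S: "commuting_triples d E F H S" and d: "d > 0"
  shows "set as \<subseteq> S \<Longrightarrow> distinct as \<Longrightarrow>
    \<exists>v \<mu>. v \<in> carrier_vec d \<and> v \<noteq> 0\<^sub>v d \<and> (\<forall>a\<in>set as. E a *\<^sub>v v = 0\<^sub>v d \<and> H a *\<^sub>v v = \<mu> a \<cdot>\<^sub>v v)"
proof (induction as)
  case Nil
  show ?case using d by (intro exI[of _ "unit_vec d 0"]) auto
next
  case (Cons b as)
  then obtain v \<mu> where v: "v \<in> carrier_vec d" "v \<noteq> 0\<^sub>v d"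
    "\<And>a. a \<in> set as \<Longrightarrow> E a *\<^sub>v v = 0\<^sub>v d \<and> H a *\<^sub>v v = \<mu> a \<cdot>\<^sub>v v" by auto
  have bS: "b \<in> S" and bas: "b \<notin> set as" and sub: "set as \<subseteq> S" using Cons.prems by auto
  note c = commuting_triplesD[OF S]
  define W where "W = {w \<in> carrier_vec d. \<forall>a\<in>set as. E a *\<^sub>v w = 0\<^sub>v d \<and> H a *\<^sub>v w = \<mu> a \<cdot>\<^sub>v w}"
  have W: "is_subspace d W" unfolding is_subspace_def
  proof (intro conjI ballI allI)
    show "W \<subseteq> carrier_vec d" unfolding W_def by auto
    show "0\<^sub>v d \<in> W" unfolding W_def using c sub by (auto simp: smult_zero_vec_right subset_iff)
    fix u w assume "u \<in> W" "w \<in> W"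
    then show "u + w \<in> W" unfolding W_def using c sub
      by (auto simp: mult_add_distrib_mat_vec[of _ d d] subset_iff smult_add_distrib_vec)
  next
    fix x w assume "w \<in> W"
    then show "x \<cdot>\<^sub>v w \<in> W" unfolding W_def using c sub
      by (auto simp: mult_mat_vec[of _ d d] subset_iff smult_zero_vec_right smult_smult_assoc mult.commute)
  qed
  have inv: "X *\<^sub>v w \<in> W" if X: "X \<in> {E b, H b}" and w: "w \<in> W" for X w
  proof -
    have Xc: "X \<in> carrier_mat d d" using X c[OF bS] by auto
    have wc: "w \<in> carrier_vec d" using w unfolding W_def by simp
    have "E a *\<^sub>v (X *\<^sub>v w) = 0\<^sub>v d \<and> H a *\<^sub>v (X *\<^sub>v w) = \<mu> a \<cdot>\<^sub>v (X *\<^sub>v w)" if a: "a \<in> set as" for a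
    proof -
      have aS: "a \<in> S" "a \<noteq> b" using a sub bas by auto
      have comm: "E a * X = X * E a" "H a * X = X * H a"
        using commuting_triples_comm[OF S aS(1) bS aS(2)] X by auto
      have "Y *\<^sub>v (X *\<^sub>v w) = X *\<^sub>v (Y *\<^sub>v w)" if "Y * X = X * Y" "Y \<in> carrier_mat d d" for Y
        using assoc_mult_mat_vec[OF that(2) Xc wc] assoc_mult_mat_vec[OF Xc that(2) wc] that(1) by simp
      then have "E a *\<^sub>v (X *\<^sub>v w) = X *\<^sub>v (E a *\<^sub>v w)" "H a *\<^sub>v (X *\<^sub>v w) = X *\<^sub>v (H a *\<^sub>v w)"
        using comm c(2,4)[OF aS(1)] by blast+
      then show ?thesis using w a Xc wc unfolding W_def by (auto simp: mult_mat_vec)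
    qed
    then show ?thesis unfolding W_def using Xc wc by auto
  qed
  have vW: "v \<in> W" unfolding W_def using v by auto
  obtain u e where u: "u \<in> W" "u \<noteq> 0\<^sub>v d" "H b *\<^sub>v u = e \<cdot>\<^sub>v u"
    using invariant_subspace_eigenvector[OF c(4)[OF bS] W vW v(2)] inv by blast
  have uc: "u \<in> carrier_vec d" using u(1) is_subspaceD(1)[OF W] by blast
  obtain k e' where w: "((*\<^sub>v) (E b) ^^ k) u \<noteq> 0\<^sub>v d" "E b *\<^sub>v (((*\<^sub>v) (E b) ^^ k) u) = 0\<^sub>v d"
    "H b *\<^sub>v (((*\<^sub>v) (E b) ^^ k) u) = e' \<cdot>\<^sub>v (((*\<^sub>v) (E b) ^^ k) u)"
    using sl2_raise_to_highest[OF c(1)[OF bS] uc u(2,3)] by blast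
  let ?w = "((*\<^sub>v) (E b) ^^ k) u"
  have "?w \<in> W" by (induction k) (use u inv in auto)
  then have wW: "?w \<in> carrier_vec d" "\<And>a. a \<in> set as \<Longrightarrow> E a *\<^sub>v ?w = 0\<^sub>v d \<and> H a *\<^sub>v ?w = \<mu> a \<cdot>\<^sub>v ?w"
    unfolding W_def by blast+
  show ?case
  proof (intro exI[of _ ?w] exI[of _ "\<mu>(b := e')"] conjI ballI)
    fix a assume a: "a \<in> set (b # as)"
    then show "E a *\<^sub>v ?w = 0\<^sub>v d" using w wW by auto
    show "H a *\<^sub>v ?w = (\<mu>(b := e')) a \<cdot>\<^sub>v ?w" using a w wW bas by (cases "a = b") auto
  qed (use w wW in auto)
qed

text \<open>Let F^k v be the last nonzero vector of the string. Then 0 = E F^(k+1) v = (k + 1)(e -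
  k) F^k v forces e = k, and m = k + 1 is the length of the string.\<close>

lemma highest_weight_integral:
  assumes t: "sl2_triple d E F H" and v: "v \<in> carrier_vec d" "v \<noteq> 0\<^sub>v d"
    and E: "E *\<^sub>v v = 0\<^sub>v d" and H: "H *\<^sub>v v = e \<cdot>\<^sub>v v"
  shows "\<exists>m>0. e = of_nat m - 1 \<and> lpow F m (colmat v) = 0\<^sub>m d 1"
proof -
  have c: "E \<in> carrier_mat d d" "F \<in> carrier_mat d d" "H \<in> carrier_mat d d"
    using t unfolding sl2_triple_def by auto
  have vc: "colmat v \<in> carrier_mat d 1" using v by simp
  have EM: "E * colmat v = 0\<^sub>m d 1" using mult_colmat[OF c(1) v(1)] E by (simp add: colmat_zero)
  have HM: "H * colmat v = e \<cdot>\<^sub>m colmat v" using mult_colmat[OF c(3) v(1)] H by (simp add: colmat_smult)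
  note ladder = sl2_ladder[OF t vc EM HM]
  let ?M = "\<lambda>k. lpow F k (colmat v)"
  have Mc: "?M k \<in> carrier_mat d 1" for k using c vc by simp
  have "\<exists>k. ?M k = 0\<^sub>m d 1"
  proof (rule ladder_terminates[OF c(3) Mc])
    show "H * ?M k = (e + (- 2) * of_nat k) \<cdot>\<^sub>m ?M k" for k using ladder(1)[of k] by simp
  qed simp
  moreover have "?M 0 \<noteq> 0\<^sub>m d 1" using v colmat_eq_zero[OF v(1)] by simp
  ultimately obtain k where k: "?M (Suc k) = 0\<^sub>m d 1" "?M k \<noteq> 0\<^sub>m d 1"
    using Least_Suc_zero[of ?M "0\<^sub>m d 1"] by blast
  have z: "(of_nat (Suc k) * (e - of_nat k)) \<cdot>\<^sub>m ?M k = 0\<^sub>m d 1"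
    using ladder(2)[of k] c unfolding k(1) by simp
  obtain i j where ij: "i < d" "j < 1" "?M k $$ (i, j) \<noteq> 0"
    using Mc[of k] k(2) by (metis carrier_matD eq_matI index_zero_mat)
  have "of_nat (Suc k) * (e - of_nat k) * ?M k $$ (i, j) = 0"
    using arg_cong[OF z, of "\<lambda>M. M $$ (i, j)"] ij Mc[of k] by simp
  then have "e = of_nat k" using ij by (simp del: of_nat_Suc)
  then show ?thesis using k(1) by (intro exI[of _ "Suc k"]) simp
qed

text \<open>Kernel and image of P are invariant, so P is injective and onto. As P is not known to be
  square, the equality d = n is derived from these facts by counting dependences.\<close>

lemma schur_equiv:
  assumes irr: "irreducible_set d (\<rho> ` OA)" and irr': "irreducible_set n (\<sigma> ` OA)"
    and c: "\<And>X. X \<in> OA \<Longrightarrow> \<rho> X \<in> carrier_mat d d" "\<And>X. X \<in> OA \<Longrightarrow> \<sigma> X \<in> carrier_mat n n"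
    and P: "P \<in> carrier_mat d n" "P \<noteq> 0\<^sub>m d n" and inter: "\<And>X. X \<in> OA \<Longrightarrow> P * \<sigma> X = \<rho> X * P"
  shows "equiv_rep d \<rho> n \<sigma>"
proof -
  have PX: "P *\<^sub>v (\<sigma> X *\<^sub>v v) = \<rho> X *\<^sub>v (P *\<^sub>v v)" if "X \<in> OA" "v \<in> carrier_vec n" for X v
    using assoc_mult_mat_vec[OF P(1) c(2)[OF that(1)] that(2)] assoc_mult_mat_vec[OF c(1)[OF that(1)] P(1) that(2)]
      inter[OF that(1)] by simp
  have inj: "v = 0\<^sub>v n" if v: "v \<in> carrier_vec n" "P *\<^sub>v v = 0\<^sub>v d" for v
  proof (rule ccontr)
    assume nz: "v \<noteq> 0\<^sub>v n"
    have "{w \<in> carrier_vec n. P *\<^sub>v w = 0\<^sub>v d} = carrier_vec n"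
    proof (rule irreducible_setD[OF irr' _ _ _ nz])
      show "is_subspace n {w \<in> carrier_vec n. P *\<^sub>v w = 0\<^sub>v d}" unfolding is_subspace_def
        using P(1) by (auto simp: mult_add_distrib_mat_vec[of _ d n] mult_mat_vec[of _ d n] smult_zero_vec_right)
      fix Y w assume "Y \<in> \<sigma> ` OA" "w \<in> {w \<in> carrier_vec n. P *\<^sub>v w = 0\<^sub>v d}"
      then obtain X where X: "X \<in> OA" "Y = \<sigma> X" and w: "w \<in> carrier_vec n" "P *\<^sub>v w = 0\<^sub>v d" by blast
      then show "Y *\<^sub>v w \<in> {w \<in> carrier_vec n. P *\<^sub>v w = 0\<^sub>v d}"
        using PX[OF X(1) w(1)] c(1,2)[OF X(1)] by auto
    qed (use v in simp)
    then have "P *\<^sub>v w = 0\<^sub>v d" if "w \<in> carrier_vec n" for w using that by blast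
    then show False using mat_eq_zeroI[OF P(1)] P(2) by blast
  qed
  have surj: "\<exists>v\<in>carrier_vec n. P *\<^sub>v v = w" if w: "w \<in> carrier_vec d" for w
  proof -
    obtain v0 where v0: "v0 \<in> carrier_vec n" "P *\<^sub>v v0 \<noteq> 0\<^sub>v d" using mat_eq_zeroI[OF P(1)] P(2) by blast
    have "(\<lambda>v. P *\<^sub>v v) ` carrier_vec n = carrier_vec d"
    proof (rule irreducible_setD[OF irr _ _ _ v0(2)])
      show "is_subspace d ((\<lambda>v. P *\<^sub>v v) ` carrier_vec n)" unfolding is_subspace_def
      proof (intro conjI ballI allI)
        show "0\<^sub>v d \<in> (\<lambda>v. P *\<^sub>v v) ` carrier_vec n" using P(1) by (intro image_eqI[of _ _ "0\<^sub>v n"]) auto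
        fix u v assume "u \<in> (\<lambda>v. P *\<^sub>v v) ` carrier_vec n" "v \<in> (\<lambda>v. P *\<^sub>v v) ` carrier_vec n"
        then obtain u' v' where "u = P *\<^sub>v u'" "v = P *\<^sub>v v'" "u' \<in> carrier_vec n" "v' \<in> carrier_vec n" by blast
        then show "u + v \<in> (\<lambda>v. P *\<^sub>v v) ` carrier_vec n"
          using P(1) by (intro image_eqI[of _ _ "u' + v'"]) (auto simp: mult_add_distrib_mat_vec[of _ d n])
      next
        fix x v assume "v \<in> (\<lambda>v. P *\<^sub>v v) ` carrier_vec n"
        then obtain v' where "v = P *\<^sub>v v'" "v' \<in> carrier_vec n" by blast
        then show "x \<cdot>\<^sub>v v \<in> (\<lambda>v. P *\<^sub>v v) ` carrier_vec n"
          using P(1) by (intro image_eqI[of _ _ "x \<cdot>\<^sub>v v'"]) (auto simp: mult_mat_vec[of _ d n])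
      qed (use P(1) in auto)
      fix Y w assume "Y \<in> \<rho> ` OA" "w \<in> (\<lambda>v. P *\<^sub>v v) ` carrier_vec n"
      then obtain X v where X: "X \<in> OA" "Y = \<rho> X" "v \<in> carrier_vec n" "w = P *\<^sub>v v" by blast
      then have "Y *\<^sub>v w = P *\<^sub>v (\<sigma> X *\<^sub>v v)" using PX by simp
      moreover have "\<sigma> X *\<^sub>v v \<in> carrier_vec n" using c(2)[OF X(1)] X(3) by simp
      ultimately show "Y *\<^sub>v w \<in> (\<lambda>v. P *\<^sub>v v) ` carrier_vec n" by blast
    qed (use v0 in simp)
    then show ?thesis using w by (metis (no_types, lifting) imageE)
  qed
  have "n \<le> d"
  proof (rule ccontr)
    assume nd: "\<not> n \<le> d"
    obtain x where x: "\<exists>k\<le>d. x k \<noteq> 0" "\<And>i. i < d \<Longrightarrow> (\<Sum>k\<le>d. x k * P $$ (i, k)) = 0"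
      using linear_dependence[of d "\<lambda>k i. P $$ (i, k)"] by blast
    define v where "v = vec n (\<lambda>k. if k \<le> d then x k else 0)"
    have "P *\<^sub>v v = 0\<^sub>v d"
    proof (rule eq_vecI)
      fix i assume "i < dim_vec (0\<^sub>v d :: complex vec)"
      then have i: "i < d" by simp
      have "(P *\<^sub>v v) $ i = (\<Sum>k<n. P $$ (i, k) * (if k \<le> d then x k else 0))"
        using i P(1) by (simp add: v_def scalar_prod_def atLeast0LessThan)
      also have "\<dots> = (\<Sum>k\<le>d. P $$ (i, k) * (if k \<le> d then x k else 0))"
        using nd by (intro sum.mono_neutral_right) auto
      also have "\<dots> = 0" using x(2)[OF i] by (simp add: mult.commute)
      finally show "(P *\<^sub>v v) $ i = 0\<^sub>v d $ i" using i by simp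
    qed (use P in simp)
    then have v0: "v = 0\<^sub>v n" using inj by (simp add: v_def)
    obtain k where k: "k \<le> d" "x k \<noteq> 0" using x(1) by blast
    have "v $ k = 0" using k nd unfolding v0 by simp
    then show False using k nd by (simp add: v_def)
  qed
  moreover have "d \<le> n"
  proof (rule ccontr)
    assume nd: "\<not> d \<le> n"
    \<comment> \<open>A dependence among rows 0, ..., n of P is a linear form vanishing on the
      image; but the unit vectors, which include one where the form is nonzero, lie in the
      image.\<close>
    obtain x where x: "\<exists>k\<le>n. x k \<noteq> 0" "\<And>i. i < n \<Longrightarrow> (\<Sum>k\<le>n. x k * P $$ (k, i)) = 0"
      using linear_dependence[of n "\<lambda>k i. P $$ (k, i)"] by blast
    obtain k where k: "k \<le> n" "x k \<noteq> 0" using x(1) by blast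
    obtain v where v: "v \<in> carrier_vec n" "P *\<^sub>v v = unit_vec d k" using surj[of "unit_vec d k"] by auto
    have "x k = (\<Sum>l\<le>n. x l * unit_vec d k $ l)"
    proof -
      have "(\<Sum>l\<le>n. x l * unit_vec d k $ l) = (\<Sum>l\<le>n. if l = k then x k else 0)"
        using nd k by (intro sum.cong) auto
      then show ?thesis using k by simp
    qed
    also have "\<dots> = (\<Sum>l\<le>n. x l * (\<Sum>i<n. P $$ (l, i) * v $ i))"
      unfolding v(2)[symmetric] using P(1) v(1) nd
      by (intro sum.cong) (auto simp: scalar_prod_def atLeast0LessThan)
    also have "\<dots> = (\<Sum>i<n. (\<Sum>l\<le>n. x l * P $$ (l, i)) * v $ i)"
      by (simp add: sum_distrib_left sum_distrib_right sum.swap[of _ "{..n}"] mult.assoc)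
    also have "\<dots> = 0" using x(2) by simp
    finally show False using k by simp
  qed
  ultimately have nd: "n = d" by simp
  have Pd: "P \<in> carrier_mat d d" using P(1) nd by simp
  have "invertible_mat P" using inj unfolding nd by (intro invertible_matI[OF Pd]) auto
  then obtain Q where Q: "Q \<in> carrier_mat d d" "P * Q = 1\<^sub>m d" "Q * P = 1\<^sub>m d"
    using invertible_mat_inverse[OF Pd] by blast
  \<comment> \<open>P leads from \<sigma> to \<rho>, while \<open>equiv_rep\<close> asks for the
    direction from \<rho> to \<sigma>; hence the inverse.\<close>
  have "invertible_mat Q" using Q Pd unfolding invertible_mat_def inverts_mat_def by auto
  moreover have "Q * \<rho> X = \<sigma> X * Q" if "X \<in> OA" for X
    using c[OF that] nd by (intro intertwiner_inverse[OF Pd Q _ _ inter[OF that]]) auto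
  ultimately show ?thesis unfolding equiv_rep_def using nd Q(1) by auto
qed

section \<open>Reduction of an irreducible representation to a tensor module\<close>

context oa_irrep begin

lemma T_eq_on:
  assumes k: "kills (set as)" and q: "flip q = - q" "flip q' = - q'"
    and "\<And>a. a \<in> set as \<Longrightarrow> ev p a = ev p' a \<and> ev p (inverse a) = ev p' (inverse a) \<and> ev q a = ev q' a"
  shows "T p q = T p' q'"
proof -
  have "flip (q - q') = - (q - q')" using q by simp
  then have "T (p - p') (q - q') = 0\<^sub>m d d" using k assms(4) unfolding kills_def by simp
  then have "T ((p - p') + p') ((q - q') + q') = 0\<^sub>m d d + T p' q'" using q by (subst T_add) simp_all
  then show ?thesis using T_carrier[OF q(2)] by simp
qed

text \<open>\<open>T\<close> depends only on values at the points and their inverses, so the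
  separating elements yield commuting sl2-triples of which every \<open>T p q\<close> is a
  combination. The weights of a joint highest weight vector prescribe the dimensions
  \<open>ms\<close>.\<close>

lemma tensor_form:
  assumes d: "distinct (as @ map inverse as)" and z: "0 \<notin> set as" and k: "kills (set as)"
  shows "\<exists>ms. length ms = length as \<and> (\<forall>m\<in>set ms. m > 0) \<and>
    equiv_rep d \<rho> (prod_list ms) (tensor_rep (zip as ms))"
proof -
  have "\<forall>a\<in>set as. \<exists>e. ev e a = 1 \<and> ev e (inverse a) = 0 \<and>
      (\<forall>b\<in>set as. b \<noteq> a \<longrightarrow> ev e b = 0 \<and> ev e (inverse b) = 0)"
  proof
    fix a assume a: "a \<in> set as"
    obtain e where "ev e a = 1" "ev e (inverse a) = 0"
      "\<And>b. b \<in> set as \<Longrightarrow> b \<noteq> a \<Longrightarrow> ev e b = 0 \<and> ev e (inverse b) = 0"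
      using separating_laurent[OF d z a] by blast
    then show "\<exists>e. ev e a = 1 \<and> ev e (inverse a) = 0 \<and>
      (\<forall>b\<in>set as. b \<noteq> a \<longrightarrow> ev e b = 0 \<and> ev e (inverse b) = 0)" by (intro exI[of _ e]) simp
  qed
  from bchoice[OF this] obtain e where "\<forall>a\<in>set as. ev (e a) a = 1 \<and> ev (e a) (inverse a) = 0 \<and>
      (\<forall>b\<in>set as. b \<noteq> a \<longrightarrow> ev (e a) b = 0 \<and> ev (e a) (inverse b) = 0)" ..
  then have e: "\<And>a. a \<in> set as \<Longrightarrow> ev (e a) a = 1" "\<And>a. a \<in> set as \<Longrightarrow> ev (e a) (inverse a) = 0"
    "\<And>a b. a \<in> set as \<Longrightarrow> b \<in> set as \<Longrightarrow> b \<noteq> a \<Longrightarrow> ev (e a) b = 0"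
    "\<And>a b. a \<in> set as \<Longrightarrow> b \<in> set as \<Longrightarrow> b \<noteq> a \<Longrightarrow> ev (e a) (inverse b) = 0"
    by simp_all
  have nz: "a \<noteq> 0" if "a \<in> set as" for a using that z by auto
  \<comment> \<open>Its values are 1 at a, -1 at 1/a and 0 at the other points, as for e^2 - (flip
    e)^2, the h-coordinate of the bracket of E a and F a.\<close>
  define h where "h a = e a - flip (e a)" for a
  have fh: "flip (h a) = - h a" for a by (simp add: h_def)
  define E where "E a = T (e a) 0" for a
  define F where "F a = T (flip (e a)) 0" for a
  define H where "H a = T 0 (h a)" for a
  have T2: "c \<cdot>\<^sub>m T p 0 = T (cst c * p) 0" "c \<cdot>\<^sub>m T 0 (h a) = T 0 (cst c * h a)" for c p a
    using T_cst[of 0 c p] T_cst[OF fh, of c 0 a] by simp_all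
  note Teq = T_eq_on[OF k]
  have triples: "commuting_triples d E F H (set as)"
    unfolding commuting_triples_def
  proof (intro conjI ballI impI)
    fix a assume a: "a \<in> set as"
    note ea = e[OF a] nz[OF a]
    have vals: "ev (e a) c = (if c = a then 1 else 0)" "ev (e a) (inverse c) = 0" "c \<noteq> 0" if "c \<in> set as" for c
      using ea that nz by auto
    have "E a * F a - F a * E a = T (br_p (e a) 0 (flip (e a)) 0) (br_q (e a) (flip (e a)))"
      unfolding E_def F_def by (rule T_bracket[symmetric]) simp_all
    also have "\<dots> = H a"
      unfolding H_def by (rule Teq) (auto simp: br_p_def br_q_def fh vals h_def)
    finally have "E a * F a - F a * E a = H a" .
    moreover have "H a * E a - E a * H a = 2 \<cdot>\<^sub>m E a"
    proof -
      have "H a * E a - E a * H a = T (br_p 0 (h a) (e a) 0) (br_q 0 (e a))"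
        unfolding E_def H_def by (rule T_bracket[symmetric]) (simp_all add: fh)
      also have "\<dots> = 2 \<cdot>\<^sub>m E a"
        unfolding E_def T2 by (rule Teq) (auto simp: br_p_def br_q_def vals h_def)
      finally show ?thesis .
    qed
    moreover have "H a * F a - F a * H a = (- 2) \<cdot>\<^sub>m F a"
    proof -
      have "H a * F a - F a * H a = T (br_p 0 (h a) (flip (e a)) 0) (br_q 0 (flip (e a)))"
        unfolding F_def H_def by (rule T_bracket[symmetric]) (simp_all add: fh)
      also have "\<dots> = (- 2) \<cdot>\<^sub>m F a"
        unfolding F_def T2 by (rule Teq) (auto simp: br_p_def br_q_def vals h_def)
      finally show ?thesis .
    qed
    ultimately show "sl2_triple d (E a) (F a) (H a)"
      unfolding sl2_triple_def by (simp add: E_def F_def H_def fh)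
    fix b X Y assume b: "b \<in> set as" "a \<noteq> b" and X: "X \<in> {E a, F a, H a}" and Y: "Y \<in> {E b, F b, H b}"
    have valsb: "ev (e b) c = (if c = b then 1 else 0)" "ev (e b) (inverse c) = 0" if "c \<in> set as" for c
      using e[OF b(1)] that by auto
    obtain p q where pq: "X = T p q" "flip q = - q" "(p, q) \<in> {(e a, 0), (flip (e a), 0), (0, h a)}"
      using X fh unfolding E_def F_def H_def by auto
    obtain p' q' where pq': "Y = T p' q'" "flip q' = - q'" "(p', q') \<in> {(e b, 0), (flip (e b), 0), (0, h b)}"
      using Y fh unfolding E_def F_def H_def by auto
    have s: "ev p c = 0 \<and> ev p (inverse c) = 0 \<and> ev q c = 0" if "c \<in> set as" "c \<noteq> a" for c
      using pq(3) vals[OF that(1)] that by (auto simp: h_def)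
    have s': "ev p' c = 0 \<and> ev p' (inverse c) = 0 \<and> ev q' c = 0" if "c \<in> set as" "c \<noteq> b" for c
      using pq'(3) valsb[OF that(1)] that by (auto simp: h_def)
    have sq: "ev q (inverse c) = 0" if "c \<in> set as" "c \<noteq> a" for c
      using ev_flip[of q c] pq(2) s[OF that] by simp
    have sq': "ev q' (inverse c) = 0" if "c \<in> set as" "c \<noteq> b" for c
      using ev_flip[of q' c] pq'(2) s'[OF that] by simp
    \<comment> \<open>Since a and b are different, at every point one of the two elements has only
      the values 0.\<close>
    have "T (br_p p q p' q') (br_q p p') = T 0 0"
    proof (rule Teq)
      fix c assume c: "c \<in> set as"
      show "ev (br_p p q p' q') c = ev 0 c \<and> ev (br_p p q p' q') (inverse c) = ev 0 (inverse c) \<and> ev (br_q p p') c = ev 0 c"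
      proof (cases "c = a")
        case True
        then have "c \<noteq> b" using b by simp
        then show ?thesis using s'[OF c] sq'[OF c] nz[OF c] by (simp add: br_p_def br_q_def)
      next
        case False
        then show ?thesis using s[OF c] sq[OF c] nz[OF c] by (simp add: br_p_def br_q_def)
      qed
    qed simp_all
    then have "X * Y - Y * X = 0\<^sub>m d d" using T_bracket[OF pq(2) pq'(2)] pq(1) pq'(1) by simp
    moreover have "X \<in> carrier_mat d d" "Y \<in> carrier_mat d d" using pq pq' by simp_all
    ultimately show "X * Y = Y * X" by (intro commute_of_commutator_zero)
  qed
  have dpos: "d > 0" using irreducible_image unfolding irreducible_set_def by simp
  have das: "distinct as" using d by simp
  obtain v \<mu> where v: "v \<in> carrier_vec d" "v \<noteq> 0\<^sub>v d"
    "\<And>a. a \<in> set as \<Longrightarrow> E a *\<^sub>v v = 0\<^sub>v d \<and> H a *\<^sub>v v = \<mu> a \<cdot>\<^sub>v v"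
    using joint_highest_weight[OF triples dpos subset_refl das] by blast
  have "\<forall>a\<in>set as. \<exists>m>0. \<mu> a = of_nat m - 1 \<and> lpow (F a) m (colmat v) = 0\<^sub>m d 1"
    using highest_weight_integral[OF commuting_triplesD(1)[OF triples] v(1,2)] v(3) by blast
  from bchoice[OF this] obtain m where "\<forall>a\<in>set as. m a > 0 \<and> \<mu> a = of_nat (m a) - 1 \<and>
      lpow (F a) (m a) (colmat v) = 0\<^sub>m d 1" by blast
  then have m: "\<And>a. a \<in> set as \<Longrightarrow> m a > 0 \<and> \<mu> a = of_nat (m a) - 1 \<and> lpow (F a) (m a) (colmat v) = 0\<^sub>m d 1"
    by simp
  define L where "L = zip as (map m as)"
  have L: "map fst L = as" "map snd L = map m as" by (simp_all add: L_def)
  have fL: "fst ` set L = set as" using L(1) by (metis set_map)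
  have mem: "a \<in> set as \<and> k = m a" if "(a, k) \<in> set L" for a k
    using that unfolding L_def zip_map2 zip_same_conv_map by auto
  have "\<exists>P. P \<in> carrier_mat d (prod_list (map snd L)) \<and> col P 0 = v \<and>
    (\<forall>p q. P * tensor_rep L (oa p q) = rsum d E F H (map fst L) p q * P) \<and>
    (\<forall>B \<mu>. B \<in> carrier_mat d d \<longrightarrow> (\<forall>a\<in>fst ` set L. B * F a = F a * B) \<longrightarrow>
       B * colmat v = \<mu> \<cdot>\<^sub>m colmat v \<longrightarrow> B * P = \<mu> \<cdot>\<^sub>m P)"
  proof (rule intertwiner_exists)
    show "commuting_triples d E F H (fst ` set L)" unfolding fL by (rule triples)
    show "distinct (map fst L)" unfolding L by (rule das)
    fix a k assume "(a, k) \<in> set L"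
    then have "a \<in> set as" "k = m a" using mem by auto
    then show "k > 0 \<and> E a *\<^sub>v v = 0\<^sub>v d \<and> H a *\<^sub>v v = (of_nat k - 1) \<cdot>\<^sub>v v \<and> lpow (F a) k (colmat v) = 0\<^sub>m d 1"
      using v(3) m by simp
  qed (use v in simp)
  then obtain P where P: "P \<in> carrier_mat d (prod_list (map m as))" "col P 0 = v"
    "\<And>p q. P * tensor_rep L (oa p q) = rsum d E F H as p q * P"
    unfolding L by blast
  have npos: "prod_list (map m as) > 0" using m by (induction as) auto
  \<comment> \<open>On the support p agrees with the sum of p(a) e_a + p(1/a) flip e_a, and q with
    the sum of q(a) h_a.\<close>
  have rsT: "rsum d E F H as p q = T p q" if q: "flip q = - q" for p q
  proof -
    define Ps where "Ps bs = (\<Sum>a\<leftarrow>bs. cst (ev p a) * e a + cst (ev p (inverse a)) * flip (e a))" for bs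
    define Qs where "Qs bs = (\<Sum>a\<leftarrow>bs. cst (ev q a) * h a)" for bs
    have fQ: "flip (Qs bs) = - Qs bs" for bs unfolding Qs_def by (induction bs) (auto simp: fh)
    have "rsum d E F H bs p q = T (Ps bs) (Qs bs)" for bs
    proof (induction bs)
      case Nil
      then show ?case by (simp add: Ps_def Qs_def)
    next
      case (Cons a bs)
      have "T (Ps (a # bs)) (Qs (a # bs)) =
        T ((cst (ev p a) * e a + cst (ev p (inverse a)) * flip (e a) + 0) + Ps bs) ((0 + 0 + cst (ev q a) * h a) + Qs bs)"
        by (simp add: Ps_def Qs_def)
      also have "\<dots> = T (cst (ev p a) * e a) 0 + T (cst (ev p (inverse a)) * flip (e a)) 0 + T 0 (cst (ev q a) * h a)
          + T (Ps bs) (Qs bs)"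
        by (subst T_add, simp add: fh, rule fQ, subst T_add, simp, simp add: fh, subst T_add) simp_all
      finally show ?case using Cons by (simp add: E_def F_def H_def T2)
    qed
    then have "rsum d E F H as p q = T (Ps as) (Qs as)" .
    also have "\<dots> = T p q"
    proof (rule Teq[OF fQ q])
      fix c assume c: "c \<in> set as"
      note cz = nz[OF c]
      have "ev (Ps bs) c = (if c \<in> set bs then ev p c else 0) \<and>
          ev (Ps bs) (inverse c) = (if c \<in> set bs then ev p (inverse c) else 0) \<and>
          ev (Qs bs) c = (if c \<in> set bs then ev q c else 0)" if "set bs \<subseteq> set as" "distinct bs" for bs
        using that
      proof (induction bs)
        case Nil
        then show ?case by (simp add: Ps_def Qs_def)
      next
        case (Cons a bs)
        have a: "a \<in> set as" using Cons.prems by simp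
        have step: "Ps (a # bs) = cst (ev p a) * e a + cst (ev p (inverse a)) * flip (e a) + Ps bs"
          "Qs (a # bs) = cst (ev q a) * h a + Qs bs" by (simp_all add: Ps_def Qs_def)
        show ?case
        proof (cases "c = a")
          case True
          then show ?thesis using Cons e(1,2)[OF a] cz unfolding step by (simp add: h_def)
        next
          case False
          then show ?thesis using Cons e(3,4)[OF a c] cz unfolding step by (simp add: h_def)
        qed
      qed
      from this[of as] show "ev (Ps as) c = ev p c \<and> ev (Ps as) (inverse c) = ev p (inverse c) \<and> ev (Qs as) c = ev q c"
        using c das by simp
    qed
    finally show ?thesis .
  qed
  have "equiv_rep d \<rho> (prod_list (map snd L)) (tensor_rep L)"
  proof (rule schur_equiv[OF irreducible_image])
    show "irreducible_set (prod_list (map snd L)) (tensor_rep L ` OA)"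
    proof (rule tensor_rep_irreducible)
      show "distinct (map fst L @ map (inverse \<circ> fst) L)" using d L(1) by (metis map_map)
      show "0 \<notin> fst ` set L" unfolding fL by (rule z)
      have "snd ` set L = m ` set as" using L(2) by (metis set_map)
      then show "0 \<notin> snd ` set L" using m by force
    qed
    show "\<rho> X \<in> carrier_mat d d" if "X \<in> OA" for X using that rep unfolding is_sl_rep_def by blast
    show "tensor_rep L X \<in> carrier_mat (prod_list (map snd L)) (prod_list (map snd L))" for X
      by (rule tensor_rep_carrier)
    show "P \<in> carrier_mat d (prod_list (map snd L))" using P(1) L by simp
    show "P \<noteq> 0\<^sub>m d (prod_list (map snd L))"
    proof
      assume "P = 0\<^sub>m d (prod_list (map snd L))"
      then have "v = 0\<^sub>v d" using P(2) npos L by auto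
      then show False using v(2) by contradiction
    qed
    fix X assume "X \<in> OA"
    then obtain p q where "X = oa p q" "flip q = - q" by (rule OA_cases)
    then show "P * tensor_rep L X = \<rho> X * P" using P(3)[of p q] rsT[of q p] unfolding T_def by simp
  qed
  then have "equiv_rep d \<rho> (prod_list (map m as)) (tensor_rep (zip as (map m as)))" unfolding L by (simp add: L_def)
  then show ?thesis using m by (intro exI[of _ "map m as"]) auto
qed

end

section \<open>Multiplicities\<close>

lemma kron_one_right_zero_iff:
  assumes A: "A \<in> carrier_mat m m" and n: "n > 0"
  shows "kron A (1\<^sub>m n) = 0\<^sub>m (m * n) (m * n) \<longleftrightarrow> A = 0\<^sub>m m m"
proof
  assume 0: "kron A (1\<^sub>m n) = 0\<^sub>m (m * n) (m * n)"
  show "A = 0\<^sub>m m m"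
  proof (rule eq_matI)
    fix i j assume "i < dim_row (0\<^sub>m m m :: complex mat)" "j < dim_col (0\<^sub>m m m :: complex mat)"
    then have ij: "i < m" "j < m" by auto
    have "kron A (1\<^sub>m n) $$ (i * n + 0, j * n + 0) = A $$ (i, j)"
      using A ij n block_index_less[OF ij(1) n] block_index_less[OF ij(2) n]
      by (subst kron_index[of _ m _ n]) auto
    then show "A $$ (i, j) = 0\<^sub>m m m $$ (i, j)"
      unfolding 0 using ij n block_index_less[OF ij(1) n] block_index_less[OF ij(2) n] by simp
  qed (use A in auto)
qed (simp add: kron_zero_left[OF one_carrier_mat])

lemma kron_one_left_zero_iff:
  assumes B: "B \<in> carrier_mat n n" and m: "m > 0"
  shows "kron (1\<^sub>m m) B = 0\<^sub>m (m * n) (m * n) \<longleftrightarrow> B = 0\<^sub>m n n"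
proof
  assume 0: "kron (1\<^sub>m m) B = 0\<^sub>m (m * n) (m * n)"
  show "B = 0\<^sub>m n n"
  proof (rule eq_matI)
    fix i j assume "i < dim_row (0\<^sub>m n n :: complex mat)" "j < dim_col (0\<^sub>m n n :: complex mat)"
    then have ij: "i < n" "j < n" by auto
    have l: "0 * n + i < m * n" "0 * n + j < m * n" using ij m by (intro block_index_less; simp)+
    have "kron (1\<^sub>m m) B $$ (0 * n + i, 0 * n + j) = B $$ (i, j)"
      using B ij m l by (subst kron_index[of _ m _ n]) auto
    then show "B $$ (i, j) = 0\<^sub>m n n $$ (i, j)" unfolding 0 using ij l by simp
  qed (use B in auto)
qed (simp add: kron_zero_right[OF one_carrier_mat])

lemma kron_one: "kron (1\<^sub>m m) (1\<^sub>m n) = (1\<^sub>m (m * n) :: complex mat)"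
proof (rule eq_matI)
  fix i j assume "i < dim_row (1\<^sub>m (m * n) :: complex mat)" "j < dim_col (1\<^sub>m (m * n) :: complex mat)"
  then have ij: "i < m * n" "j < m * n" by auto
  have "i = j \<longleftrightarrow> i div n = j div n \<and> i mod n = j mod n" by (metis div_mult_mod_eq)
  then show "kron (1\<^sub>m m) (1\<^sub>m n) $$ (i, j) = (1\<^sub>m (m * n) :: complex mat) $$ (i, j)"
    using ij mod_div_less[OF ij(1)] mod_div_less[OF ij(2)] by (subst kron_index[of _ m _ n]) auto
qed auto

lemma kron_pow_left: "A \<in> carrier_mat m m \<Longrightarrow> kron A (1\<^sub>m n) ^\<^sub>m k = kron (A ^\<^sub>m k) (1\<^sub>m n)"
  by (induction k) (auto simp: kron_one kron_mult[of _ m _ n])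

lemma kron_pow_right: "B \<in> carrier_mat n n \<Longrightarrow> kron (1\<^sub>m m) B ^\<^sub>m k = kron (1\<^sub>m m) (B ^\<^sub>m k)"
  by (induction k) (auto simp: kron_one kron_mult[of _ m _ n])

lemma tensor_rep_zero_of_ev_rep:
  assumes "\<And>a m. (a, m) \<in> set L \<Longrightarrow> ev_rep m a X = 0\<^sub>m m m"
  shows "tensor_rep L X = 0\<^sub>m (prod_list (map snd L)) (prod_list (map snd L))"
  using assms
proof (induction L)
  case (Cons am L)
  obtain a m where am: "am = (a, m)" by force
  have "tensor_rep L X = 0\<^sub>m (prod_list (map snd L)) (prod_list (map snd L))" using Cons by simp
  moreover have "ev_rep m a X = 0\<^sub>m m m" using Cons.prems am by simp
  ultimately show ?case
    unfolding am by (simp add: kron_zero_left[OF one_carrier_mat] kron_zero_right[OF one_carrier_mat])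
qed simp

text \<open>An element acting in one slot only is represented by that operator tensored with
  identities, and so are its powers; their vanishing can be read off in the slot.\<close>

lemma tensor_rep_slot_pow:
  assumes "j < length L" "\<And>i. i < length L \<Longrightarrow> i \<noteq> j \<Longrightarrow> ev_rep (snd (L ! i)) (fst (L ! i)) X = 0\<^sub>m (snd (L ! i)) (snd (L ! i))"
    "0 \<notin> snd ` set L"
  shows "tensor_rep L X ^\<^sub>m k = 0\<^sub>m (prod_list (map snd L)) (prod_list (map snd L)) \<longleftrightarrow>
    ev_rep (snd (L ! j)) (fst (L ! j)) X ^\<^sub>m k = 0\<^sub>m (snd (L ! j)) (snd (L ! j))"
  using assms
proof (induction L arbitrary: j)
  case (Cons am L)
  obtain a m where am: "am = (a, m)" by force
  let ?n = "prod_list (map snd L)"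
  have m: "m > 0" using Cons.prems(3) am by auto
  have n: "?n > 0" using Cons.prems(3) by (induction L) auto
  show ?case
  proof (cases j)
    case 0
    have "ev_rep k b X = 0\<^sub>m k k" if mem: "(b, k) \<in> set L" for b k
    proof -
      obtain i where i: "i < length L" "L ! i = (b, k)" using mem by (metis in_set_conv_nth)
      then show ?thesis using Cons.prems(2)[of "Suc i"] 0 by simp
    qed
    then have "tensor_rep L X = 0\<^sub>m ?n ?n" by (rule tensor_rep_zero_of_ev_rep)
    then have "tensor_rep (am # L) X = kron (ev_rep m a X) (1\<^sub>m ?n)"
      using am by (simp add: kron_zero_right[OF one_carrier_mat])
    moreover have "ev_rep m a X ^\<^sub>m k \<in> carrier_mat m m" by (rule pow_carrier_mat) simp
    ultimately show ?thesis using 0 am n by (simp add: kron_pow_left[of _ m] kron_one_right_zero_iff)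
  next
    case (Suc j')
    have "ev_rep m a X = 0\<^sub>m m m" using Cons.prems(2)[of 0] Suc am by simp
    then have "tensor_rep (am # L) X = kron (1\<^sub>m m) (tensor_rep L X)"
      using am tensor_rep_carrier[of L X] by (simp add: kron_zero_left[OF one_carrier_mat])
    moreover have "tensor_rep L X ^\<^sub>m k = 0\<^sub>m ?n ?n \<longleftrightarrow>
        ev_rep (snd (L ! j')) (fst (L ! j')) X ^\<^sub>m k = 0\<^sub>m (snd (L ! j')) (snd (L ! j'))"
    proof (rule Cons.IH)
      show "j' < length L" using Cons.prems(1) Suc by simp
      show "0 \<notin> snd ` set L" using Cons.prems(3) by auto
      fix i assume "i < length L" "i \<noteq> j'"
      then show "ev_rep (snd (L ! i)) (fst (L ! i)) X = 0\<^sub>m (snd (L ! i)) (snd (L ! i))"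
        using Cons.prems(2)[of "Suc i"] Suc by simp
    qed
    moreover have "tensor_rep L X ^\<^sub>m k \<in> carrier_mat ?n ?n" by (rule pow_carrier_mat) (rule tensor_rep_carrier)
    ultimately show ?thesis
      using Suc am m tensor_rep_carrier[of L X] by (simp add: kron_pow_right[of _ ?n] kron_one_left_zero_iff)
  qed
qed simp

lemma sl2_E_pow_index:
  "i < m \<Longrightarrow> j < m \<Longrightarrow> (sl2_E m ^\<^sub>m k) $$ (i, j) \<noteq> 0 \<longleftrightarrow> j = i + k"
proof (induction k arbitrary: j)
  case (Suc k)
  have c: "sl2_E m ^\<^sub>m k \<in> carrier_mat m m" by (rule pow_carrier_mat) simp
  have "(sl2_E m ^\<^sub>m Suc k) $$ (i, j) = (\<Sum>l<m. (sl2_E m ^\<^sub>m k) $$ (i, l) * sl2_E m $$ (l, j))"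
    using mult_index_sum[OF c sl2_carrier(1) Suc.prems] by simp
  also have "\<dots> = (\<Sum>l<m. if l = j - 1 then (if j = 0 then 0 else (sl2_E m ^\<^sub>m k) $$ (i, j - 1) * of_nat (j * (m - j))) else 0)"
    using Suc.prems by (intro sum.cong) (auto simp: sl2_E_def)
  also have "\<dots> = (if j = 0 then 0 else (sl2_E m ^\<^sub>m k) $$ (i, j - 1) * of_nat (j * (m - j)))"
    using Suc.prems by simp
  finally have *: "(sl2_E m ^\<^sub>m Suc k) $$ (i, j) = \<dots>" .
  show ?case
  proof (cases j)
    case 0
    then show ?thesis using * by simp
  next
    case (Suc j')
    then have "(of_nat (j * (m - j)) :: complex) \<noteq> 0" using Suc.prems by (simp del: of_nat_mult mult_Suc)
    then show ?thesis using * Suc Suc.IH[of j'] Suc.prems by (simp del: pow_mat.simps of_nat_mult mult_Suc)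
  qed
qed auto

lemma sl2_F_pow_index:
  "i < m \<Longrightarrow> j < m \<Longrightarrow> (sl2_F m ^\<^sub>m k) $$ (i, j) \<noteq> 0 \<longleftrightarrow> i = j + k"
proof (induction k arbitrary: j)
  case (Suc k)
  have c: "sl2_F m ^\<^sub>m k \<in> carrier_mat m m" by (rule pow_carrier_mat) simp
  have "(sl2_F m ^\<^sub>m Suc k) $$ (i, j) = (\<Sum>l<m. (sl2_F m ^\<^sub>m k) $$ (i, l) * sl2_F m $$ (l, j))"
    using mult_index_sum[OF c sl2_carrier(2) Suc.prems] by simp
  also have "\<dots> = (\<Sum>l<m. if l = Suc j then (sl2_F m ^\<^sub>m k) $$ (i, Suc j) else 0)"
    using Suc.prems by (intro sum.cong) (auto simp: sl2_F_def)
  also have "\<dots> = (if Suc j < m then (sl2_F m ^\<^sub>m k) $$ (i, Suc j) else 0)" by simp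
  finally show ?case using Suc.IH[of "Suc j"] Suc.prems by (auto simp del: pow_mat.simps)
qed auto

lemma mat_nonzero_index:
  assumes "A \<in> carrier_mat m m"
  shows "A = 0\<^sub>m m m \<longleftrightarrow> (\<forall>i<m. \<forall>j<m. A $$ (i, j) = 0)"
  using assms by (auto intro!: eq_matI)

text \<open>For k < m the entry (0, k) of the k-th power is nonzero, so the nilpotency index is the
  dimension.\<close>

lemma sl2_E_pow_zero: "sl2_E m ^\<^sub>m k = 0\<^sub>m m m \<longleftrightarrow> m \<le> k"
proof -
  have "sl2_E m ^\<^sub>m k \<in> carrier_mat m m" by (rule pow_carrier_mat) simp
  then have "sl2_E m ^\<^sub>m k = 0\<^sub>m m m \<longleftrightarrow> (\<forall>i<m. \<forall>j<m. j \<noteq> i + k)"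
    using sl2_E_pow_index[of _ m _ k] unfolding mat_nonzero_index[OF \<open>sl2_E m ^\<^sub>m k \<in> carrier_mat m m\<close>] by blast
  also have "\<dots> \<longleftrightarrow> m \<le> k"
  proof
    assume *: "\<forall>i<m. \<forall>j<m. j \<noteq> i + k"
    show "m \<le> k"
    proof (rule ccontr)
      assume "\<not> m \<le> k"
      then show False using *[rule_format, of 0 k] by simp
    qed
  qed auto
  finally show ?thesis .
qed

lemma sl2_F_pow_zero: "sl2_F m ^\<^sub>m k = 0\<^sub>m m m \<longleftrightarrow> m \<le> k"
proof -
  have "sl2_F m ^\<^sub>m k \<in> carrier_mat m m" by (rule pow_carrier_mat) simp
  then have "sl2_F m ^\<^sub>m k = 0\<^sub>m m m \<longleftrightarrow> (\<forall>i<m. \<forall>j<m. i \<noteq> j + k)"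
    using sl2_F_pow_index[of _ m _ k] unfolding mat_nonzero_index[OF \<open>sl2_F m ^\<^sub>m k \<in> carrier_mat m m\<close>] by blast
  also have "\<dots> \<longleftrightarrow> m \<le> k"
  proof
    assume *: "\<forall>i<m. \<forall>j<m. i \<noteq> j + k"
    show "m \<le> k"
    proof (rule ccontr)
      assume "\<not> m \<le> k"
      then show False using *[rule_format, of k 0] by simp
    qed
  qed auto
  finally show ?thesis .
qed

section \<open>Nilpotency indices as invariants of equivalence\<close>

lemma intertwined_pow:
  fixes P :: "complex mat"
  assumes "P \<in> carrier_mat d d" "A \<in> carrier_mat d d" "B \<in> carrier_mat d d" "P * A = B * P"
  shows "P * A ^\<^sub>m k = B ^\<^sub>m k * P"
proof (induction k)
  case (Suc k)
  have c: "A ^\<^sub>m k \<in> carrier_mat d d" "B ^\<^sub>m k \<in> carrier_mat d d" using assms by (auto intro: pow_carrier_mat)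
  have "P * A ^\<^sub>m Suc k = P * A ^\<^sub>m k * A" using assms c by (simp add: assoc_mult_mat[of _ d d _ d _ d])
  also have "\<dots> = B ^\<^sub>m k * (P * A)" unfolding Suc using assms c by (simp add: assoc_mult_mat[of _ d d _ d _ d])
  also have "\<dots> = B ^\<^sub>m k * B * P" unfolding assms(4) using assms c by (simp add: assoc_mult_mat[of _ d d _ d _ d])
  finally show ?case by simp
qed (use assms in simp)

lemma equiv_rep_pow_zero:
  assumes e: "equiv_rep d \<rho> d' \<rho>'" and X: "X \<in> OA" and c: "\<rho> X \<in> carrier_mat d d" "\<rho>' X \<in> carrier_mat d' d'"
  shows "\<rho> X ^\<^sub>m k = 0\<^sub>m d d \<longleftrightarrow> \<rho>' X ^\<^sub>m k = 0\<^sub>m d' d'"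
proof -
  have dd: "d' = d" using e unfolding equiv_rep_def by simp
  obtain P where P: "P \<in> carrier_mat d d" "invertible_mat P" "P * \<rho> X = \<rho>' X * P"
    using e X unfolding equiv_rep_def by blast
  obtain Q where Qc: "Q \<in> carrier_mat d d" and Q: "P * Q = 1\<^sub>m d" and QP: "Q * P = 1\<^sub>m d"
    using invertible_mat_inverse[OF P(1,2)] by blast
  let ?A = "\<rho> X ^\<^sub>m k" and ?B = "\<rho>' X ^\<^sub>m k"
  have ABc: "?A \<in> carrier_mat d d" "?B \<in> carrier_mat d d" using c dd by (auto intro: pow_carrier_mat)
  have PA: "P * ?A = ?B * P" using intertwined_pow[OF P(1) c(1) _ P(3)] c(2) dd by simp
  have "?B = ?B * (P * Q)" unfolding Q by (rule right_mult_one_mat[OF ABc(2), symmetric])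
  also have "\<dots> = P * ?A * Q" unfolding PA using ABc P(1) Qc by (simp add: assoc_mult_mat[of _ d d _ d _ d])
  finally have B: "?B = P * ?A * Q" .
  have "?A = (Q * P) * ?A" unfolding QP by (rule left_mult_one_mat[OF ABc(1), symmetric])
  also have "\<dots> = Q * (?B * P)" unfolding PA[symmetric] using ABc P(1) Qc by (simp add: assoc_mult_mat[of _ d d _ d _ d])
  finally have A: "?A = Q * (?B * P)" .
  show ?thesis unfolding dd
  proof
    assume 0: "?A = 0\<^sub>m d d"
    show "?B = 0\<^sub>m d d" unfolding B 0 using P(1) Qc by simp
  next
    assume 0: "?B = 0\<^sub>m d d"
    show "?A = 0\<^sub>m d d" unfolding A 0 using P(1) Qc by simp
  qed
qed

text \<open>Disjointness from the list of inverses compares each a also with its own inverse, so 1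
  and -1 are excluded.\<close>

definition generic :: "complex list \<Rightarrow> bool" where
  "generic as \<longleftrightarrow> distinct (as @ map inverse as) \<and> 0 \<notin> set as"

lemma genericD:
  assumes "generic as" "i < length as" "j < length as"
  shows "as ! i \<noteq> 0" "as ! i \<noteq> inverse (as ! j)" "i \<noteq> j \<Longrightarrow> as ! i \<noteq> as ! j"
proof -
  have d: "distinct as" "set as \<inter> inverse ` set as = {}" "0 \<notin> set as"
    using assms(1) unfolding generic_def by auto
  show "as ! i \<noteq> 0" using d(3) assms(2) by (metis nth_mem)
  show "as ! i \<noteq> inverse (as ! j)" using d(2) nth_mem[OF assms(2)] nth_mem[OF assms(3)] by blast
  show "i \<noteq> j \<Longrightarrow> as ! i \<noteq> as ! j" using d(1) assms(2,3) by (simp add: nth_eq_iff_index_eq)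
qed

text \<open>The multiplicity attached to a point is the nilpotency index of the operator which evaluates
  to \<open>e\<close> at this point and to \<open>0\<close> at all others.\<close>

lemma multiplicity_invariant:
  assumes eq: "equiv_rep d (tensor_rep (zip as ms)) d' (tensor_rep (zip as' ms'))"
    and dims: "d = prod_list ms" "d' = prod_list ms'"
    and len: "length ms = length as" "length ms' = length as'"
    and gen: "generic as" "generic as'" and pos: "0 \<notin> set ms" "0 \<notin> set ms'"
    and j: "j < length as" "ms ! j \<ge> 2"
  shows "\<exists>k<length as'. (as' ! k = as ! j \<or> as' ! k = inverse (as ! j)) \<and> ms' ! k = ms ! j"
proof -
  let ?L = "zip as ms" and ?L' = "zip as' ms'" and ?a = "as ! j"
  have LL: "map snd ?L = ms" "map snd ?L' = ms'" using len by simp_all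
  \<comment> \<open>One element has to be isolated in both tensor modules, so e is prescribed on the
    points of both lists and their inverses: 1 at a and 0 elsewhere, in particular at 1/a.\<close>
  let ?B = "set (as @ map inverse as @ as' @ map inverse as') - {?a}"
  have z: "0 \<notin> ?B" "?a \<noteq> 0" using gen genericD(1)[OF gen(1) j(1) j(1)] unfolding generic_def by auto
  obtain e where e: "ev e ?a = 1" "\<And>c. c \<in> ?B \<Longrightarrow> ev e c = 0"
    using interpolation[of ?B ?a] z by auto
  let ?X = "oa e 0"
  have X: "?X \<in> OA" by simp
  have ev0: "ev_rep m b ?X = 0\<^sub>m m m" if "ev e b = 0" "ev e (inverse b) = 0" for m b
    using ev_rep_oa_cong[of e b 0 0 0 m] that ev_rep_zero by simp
  have e_inv: "ev e (inverse ?a) = 0"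
    using genericD(2)[OF gen(1) j(1) j(1)] j(1) by (intro e(2)) auto
  have other: "ev e b = 0 \<and> ev e (inverse b) = 0" if "b \<in> set as \<union> set as'" "b \<noteq> ?a" "inverse b \<noteq> ?a" for b
    using that by (auto intro!: e(2))
  have lj: "tensor_rep ?L ?X ^\<^sub>m k = 0\<^sub>m d d \<longleftrightarrow> ms ! j \<le> k" for k
  proof -
    have "tensor_rep ?L ?X ^\<^sub>m k = 0\<^sub>m (prod_list (map snd ?L)) (prod_list (map snd ?L)) \<longleftrightarrow>
      ev_rep (snd (?L ! j)) (fst (?L ! j)) ?X ^\<^sub>m k = 0\<^sub>m (snd (?L ! j)) (snd (?L ! j))"
    proof (rule tensor_rep_slot_pow)
      show "j < length ?L" using j len by simp
      show "0 \<notin> snd ` set ?L" using pos(1) LL by (metis set_map)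
      fix i assume i: "i < length ?L" "i \<noteq> j"
      then have i': "i < length as" using len by simp
      then have "ev e (as ! i) = 0 \<and> ev e (inverse (as ! i)) = 0"
        using genericD(2)[OF gen(1) j(1) i'] genericD(3)[OF gen(1) i' j(1) i(2)]
        by (intro other) auto
      then show "ev_rep (snd (?L ! i)) (fst (?L ! i)) ?X = 0\<^sub>m (snd (?L ! i)) (snd (?L ! i))" using i
        by (intro ev0) simp_all
    qed
    then show ?thesis unfolding LL dims[symmetric] using j len e(1) e_inv sl2_E_pow_zero by (simp add: ev_rep_E)
  qed
  have tr: "tensor_rep ?L ?X ^\<^sub>m k = 0\<^sub>m d d \<longleftrightarrow> tensor_rep ?L' ?X ^\<^sub>m k = 0\<^sub>m d' d'" for k
    using tensor_rep_carrier[of ?L ?X] tensor_rep_carrier[of ?L' ?X] unfolding LL dims[symmetric]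
    by (intro equiv_rep_pow_zero[OF eq X]) auto
  \<comment> \<open>Otherwise X would act by 0 on the second module, while on the first it is
    nonzero because slot j has dimension at least 2.\<close>
  have "\<exists>k<length as'. as' ! k = ?a \<or> as' ! k = inverse ?a"
  proof (rule ccontr)
    assume neg: "\<not> ?thesis"
    have "tensor_rep ?L' ?X = 0\<^sub>m (prod_list (map snd ?L')) (prod_list (map snd ?L'))"
    proof (rule tensor_rep_zero_of_ev_rep)
      fix b m assume "(b, m) \<in> set ?L'"
      then have b: "b \<in> set as'" by (rule set_zip_leftD)
      then obtain k where "k < length as'" "as' ! k = b" by (auto simp: in_set_conv_nth)
      then have "b \<noteq> ?a" "b \<noteq> inverse ?a" using neg by auto
      then have "b \<noteq> ?a" "inverse b \<noteq> ?a" by (simp, metis inverse_inverse_eq)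
      then have "ev e b = 0 \<and> ev e (inverse b) = 0" using b by (intro other) auto
      then show "ev_rep m b ?X = 0\<^sub>m m m" by (intro ev0) simp_all
    qed
    then have "tensor_rep ?L' ?X ^\<^sub>m 1 = 0\<^sub>m d' d'" unfolding LL dims by simp
    then show False using tr[of 1] lj[of 1] j(2) by simp
  qed
  then obtain k where k: "k < length as'" "as' ! k = ?a \<or> as' ! k = inverse ?a" by blast
  have lk: "tensor_rep ?L' ?X ^\<^sub>m r = 0\<^sub>m d' d' \<longleftrightarrow> ms' ! k \<le> r" for r
  proof -
    have "tensor_rep ?L' ?X ^\<^sub>m r = 0\<^sub>m (prod_list (map snd ?L')) (prod_list (map snd ?L')) \<longleftrightarrow>
      ev_rep (snd (?L' ! k)) (fst (?L' ! k)) ?X ^\<^sub>m r = 0\<^sub>m (snd (?L' ! k)) (snd (?L' ! k))"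
    proof (rule tensor_rep_slot_pow)
      show "k < length ?L'" using k len by simp
      show "0 \<notin> snd ` set ?L'" using pos(2) LL by (metis set_map)
      fix i assume i: "i < length ?L'" "i \<noteq> k"
      then have i': "i < length as'" using len by simp
      note g = genericD(2)[OF gen(2) i' k(1)] genericD(3)[OF gen(2) i' k(1) i(2)]
      have "as' ! i \<noteq> ?a" "inverse (as' ! i) \<noteq> ?a" using g k(2) by (metis inverse_inverse_eq)+
      then have "ev e (as' ! i) = 0 \<and> ev e (inverse (as' ! i)) = 0"
        using i' by (intro other) auto
      then show "ev_rep (snd (?L' ! i)) (fst (?L' ! i)) ?X = 0\<^sub>m (snd (?L' ! i)) (snd (?L' ! i))" using i
        by (intro ev0) simp_all
    qed
    \<comment> \<open>At 1/a the same element acts as F instead of E; both have the dimension as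
      nilpotency index.\<close>
    moreover have "ev_rep (ms' ! k) (as' ! k) ?X = sl2_E (ms' ! k) \<or> ev_rep (ms' ! k) (as' ! k) ?X = sl2_F (ms' ! k)"
      using k(2)
    proof
      assume "as' ! k = ?a"
      then show ?thesis using e(1) e_inv by (simp add: ev_rep_E)
    next
      assume "as' ! k = inverse ?a"
      then show ?thesis using e(1) e_inv by (simp add: ev_rep_F)
    qed
    ultimately show ?thesis unfolding LL dims[symmetric] using k len sl2_E_pow_zero sl2_F_pow_zero by auto
  qed
  have "ms ! j \<le> r \<longleftrightarrow> ms' ! k \<le> r" for r using lj lk tr by simp
  then have "ms' ! k = ms ! j" by (metis le_antisym order_refl)
  then show ?thesis using k by blast
qed

section \<open>Spins, and points on the unit circle\<close>

lemma pos_half_int_spin_dim: "pos_half_int s \<Longrightarrow> spin_dim s \<ge> 2 \<and> 2 * s = real (spin_dim s) - 1"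
proof -
  assume s: "pos_half_int s"
  then obtain n :: nat where n: "2 * s = of_nat n" unfolding pos_half_int_def Nats_def by auto
  then have "n > 0" using s unfolding pos_half_int_def by (cases n) auto
  moreover have "spin_dim s = n + 1" unfolding spin_dim_def n by simp
  ultimately show ?thesis using n by simp
qed

lemma spin_dim_inject: "pos_half_int s \<Longrightarrow> pos_half_int s' \<Longrightarrow> spin_dim s = spin_dim s' \<Longrightarrow> s = s'"
  using pos_half_int_spin_dim[of s] pos_half_int_spin_dim[of s'] by simp

lemma spin_of_dim: "m \<ge> 2 \<Longrightarrow> pos_half_int ((real m - 1) / 2) \<and> spin_dim ((real m - 1) / 2) = m"
proof -
  assume m: "m \<ge> 2"
  define n where "n = m - 1"
  have n: "m = n + 1" "n > 0" using m by (auto simp: n_def)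
  have "2 * ((real m - 1) / 2) = real n" using n by simp
  then show ?thesis using n unfolding pos_half_int_def spin_dim_def by simp
qed

lemma ahat_eq_iff:
  assumes "a \<noteq> 0" "b \<noteq> 0"
  shows "ahat a = ahat b \<longleftrightarrow> a = b \<or> a = inverse b"
proof -
  have "ahat a = ahat b \<longleftrightarrow> a + inverse a = b + inverse b"
    unfolding ahat_def by (simp only: divide_cancel_right) simp
  also have "\<dots> \<longleftrightarrow> (a - b) * (a * b - 1) = 0"
    using assms by (simp add: field_simps)
  also have "\<dots> \<longleftrightarrow> a = b \<or> a * b = 1" by simp
  also have "a * b = 1 \<longleftrightarrow> a = inverse b" using assms by (auto simp: field_simps)
  finally show ?thesis .
qed

text \<open>For c = \<open>ahat a\<close> and s^2 = 1 - c^2, the equation a^2 - 2 c a + 1 = 0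
  factors as (a - c - \<i> s)(a - c + \<i> s) = 0, so a has real part c and modulus 1.\<close>

lemma ahat_unit_circle:
  assumes "a \<noteq> 0" "ahat a \<in> complex_of_real ` {-1<..<1}"
  shows "cnj a = inverse a" "a \<noteq> 1" "a \<noteq> - 1"
proof -
  obtain c where c: "ahat a = of_real c" "-1 < c" "c < 1" using assms(2) by auto
  define s where "s = sqrt (1 - c\<^sup>2)"
  have "c\<^sup>2 < 1" using c by (simp add: abs_square_less_1)
  then have s: "s\<^sup>2 = 1 - c\<^sup>2" by (simp add: s_def)
  have "a + inverse a = 2 * of_real c" using c(1) by (simp add: ahat_def)
  then have "a * a - 2 * of_real c * a + 1 = 0" using assms(1) by (simp add: field_simps)
  moreover have "(a - of_real c - \<i> * of_real s) * (a - of_real c + \<i> * of_real s) =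
      a * a - 2 * of_real c * a + of_real (c\<^sup>2 + s\<^sup>2)"
    by (simp add: algebra_simps power2_eq_square)
  ultimately have "(a - of_real c - \<i> * of_real s) * (a - of_real c + \<i> * of_real s) = 0" using s by simp
  then have "a - of_real c - \<i> * of_real s = 0 \<or> a - of_real c + \<i> * of_real s = 0"
    by (simp only: mult_eq_0_iff)
  moreover have "a = (a - of_real c - \<i> * of_real s) + (of_real c + \<i> * of_real s)"
    "a = (a - of_real c + \<i> * of_real s) + (of_real c - \<i> * of_real s)" by simp_all
  ultimately have "a = of_real c + \<i> * of_real s \<or> a = of_real c - \<i> * of_real s"
    by (metis add_0)
  then have "Re a = c" "(Im a)\<^sup>2 = s\<^sup>2" by auto
  then have "a * cnj a = 1" using s by (simp add: complex_mult_cnj)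
  then show "cnj a = inverse a" by (metis inverse_unique)
  show "a \<noteq> 1" "a \<noteq> - 1" using \<open>Re a = c\<close> c by auto
qed

lemma unit_circle_ahat:
  assumes "cnj a = inverse a" "a \<noteq> 0" "a \<noteq> 1" "a \<noteq> - 1"
  shows "ahat a \<in> complex_of_real ` {-1<..<1}"
proof -
  have n: "(Re a)\<^sup>2 + (Im a)\<^sup>2 = 1"
  proof -
    have "a * cnj a = 1" using assms by simp
    then show ?thesis by (metis complex_mult_cnj of_real_eq_1_iff)
  qed
  have "Im a \<noteq> 0"
  proof
    assume im: "Im a = 0"
    then have "Re a = 1 \<or> Re a = - 1" using n by (simp add: power2_eq_1_iff)
    then show False using assms(3,4) im by (auto simp: complex_eq_iff)
  qed
  then have "(Im a)\<^sup>2 > 0" by simp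
  then have "(Re a)\<^sup>2 < 1" using n by linarith
  then have "\<bar>Re a\<bar> < 1" by (simp add: abs_square_less_1)
  moreover have "ahat a = of_real (Re a)"
    unfolding ahat_def assms(1)[symmetric] by (simp add: complex_add_cnj)
  ultimately show ?thesis by (intro image_eqI[of _ _ "Re a"]) (auto simp: abs_less_iff)
qed

text \<open>If a_j = 1/a_k, then the values of \<open>ahat\<close> agree, so j = k and a_j is 1 or
  -1, where \<open>ahat\<close> takes an endpoint of the interval.\<close>

lemma generic_of_ahat:
  assumes "\<And>j. j < length as \<Longrightarrow> as ! j \<noteq> 0 \<and> ahat (as ! j) \<in> complex_of_real ` {-1<..<1}"
    and dist: "\<And>j k. j < length as \<Longrightarrow> k < length as \<Longrightarrow> j \<noteq> k \<Longrightarrow> ahat (as ! j) \<noteq> ahat (as ! k)"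
  shows "generic as"
proof -
  have d: "distinct as" using dist by (metis distinct_conv_nth)
  have "as ! j \<noteq> inverse (as ! k)" if "j < length as" "k < length as" for j k
  proof
    assume eq: "as ! j = inverse (as ! k)"
    then have "ahat (as ! j) = ahat (as ! k)" by (simp add: ahat_def add.commute)
    then have "j = k" using dist that by blast
    then have "as ! j * as ! j = 1" using eq assms(1)[OF that(1)] by (metis right_inverse)
    then have "as ! j = 1 \<or> as ! j = - 1" by (simp add: square_eq_1_iff)
    then show False using ahat_unit_circle[of "as ! j"] assms(1)[OF that(1)] by blast
  qed
  then have "set as \<inter> inverse ` set as = {}" by (auto simp: in_set_conv_nth)
  moreover have "0 \<notin> set as" using assms(1) by (auto simp: in_set_conv_nth)
  ultimately show ?thesis using d unfolding generic_def by (auto simp: distinct_map inj_on_def)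
qed

section \<open>Hermitian representations\<close>

lemma conj_l_numeral [simp]: "conj_l (numeral n) = numeral n"
  using conj_l_simps(7)[of "numeral n"] by (simp add: cst_def)

lemma conj_l_one [simp]: "conj_l 1 = 1"
  using conj_l_simps(7)[of 1] by simp

lemma zero_mult_vec: "u \<in> carrier_vec m \<Longrightarrow> 0\<^sub>m n m *\<^sub>v u = (0\<^sub>v n :: complex vec)"
  by (intro eq_vecI) auto

lemma herm_innerD:
  assumes "herm_inner d ip"
  shows "u \<in> carrier_vec d \<Longrightarrow> v \<in> carrier_vec d \<Longrightarrow> w \<in> carrier_vec d \<Longrightarrow> ip (u + v) w = ip u w + ip v w"
    "u \<in> carrier_vec d \<Longrightarrow> w \<in> carrier_vec d \<Longrightarrow> ip (c \<cdot>\<^sub>v u) w = c * ip u w"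
    "u \<in> carrier_vec d \<Longrightarrow> v \<in> carrier_vec d \<Longrightarrow> ip u v = cnj (ip v u)"
    "v \<in> carrier_vec d \<Longrightarrow> v \<noteq> 0\<^sub>v d \<Longrightarrow> Re (ip v v) > 0"
  using assms unfolding herm_inner_def by blast+

lemma herm_inner_right:
  assumes h: "herm_inner d ip" and c: "u \<in> carrier_vec d" "v \<in> carrier_vec d" "w \<in> carrier_vec d"
  shows "ip u (v + w) = ip u v + ip u w" "ip u (x \<cdot>\<^sub>v v) = cnj x * ip u v"
    "ip u (v - w) = ip u v - ip u w" "ip (v - w) u = ip v u - ip w u" "ip u (0\<^sub>v d) = 0"
proof -
  have add: "ip u (v + w) = ip u v + ip u w" if "u \<in> carrier_vec d" "v \<in> carrier_vec d" "w \<in> carrier_vec d" for u v w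
    using that herm_innerD(3)[OF h, of u "v + w"] herm_innerD(3)[OF h, of u v] herm_innerD(3)[OF h, of u w]
    by (simp add: herm_innerD(1)[OF h])
  have smult: "ip u (x \<cdot>\<^sub>v v) = cnj x * ip u v" if "u \<in> carrier_vec d" "v \<in> carrier_vec d" for x u v
    using that herm_innerD(3)[OF h, of u "x \<cdot>\<^sub>v v"] herm_innerD(3)[OF h, of u v]
    by (simp add: herm_innerD(2)[OF h])
  show "ip u (v + w) = ip u v + ip u w" using c by (rule add)
  show "ip u (x \<cdot>\<^sub>v v) = cnj x * ip u v" using c(1,2) by (rule smult)
  have minus: "v - w = v + (- 1) \<cdot>\<^sub>v w" using c by (intro eq_vecI) auto
  show "ip u (v - w) = ip u v - ip u w" unfolding minus using c add[of u v "(- 1) \<cdot>\<^sub>v w"] smult[of u w "- 1"] by simp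
  show "ip (v - w) u = ip v u - ip w u" unfolding minus using c by (simp add: herm_innerD(1,2)[OF h])
  have "0\<^sub>v d = 0 \<cdot>\<^sub>v u" using c by (intro eq_vecI) auto
  then show "ip u (0\<^sub>v d) = 0" using smult[of u u 0] c by simp
qed

locale oa_hermitian = oa_irrep +
  fixes ip :: "complex vec \<Rightarrow> complex vec \<Rightarrow> complex"
  assumes herm: "herm_inner d ip"
    and sa0: "self_adjoint_wrt d ip (\<rho> (A_elt 0))" and sa1: "self_adjoint_wrt d ip (\<rho> (A_elt 1))"
begin

text \<open>The conjugate-linear anti-involution \<open>(p, q) \<mapsto> (conj p, - conj q)\<close> fixes every \<open>A\<^sub>m\<close>, and it is
  intertwined with taking adjoints.\<close>

definition adj :: "laurent \<Rightarrow> laurent \<Rightarrow> bool" where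
  "adj p q \<longleftrightarrow> (\<forall>u\<in>carrier_vec d. \<forall>v\<in>carrier_vec d.
     ip (T p q *\<^sub>v u) v = ip u (T (conj_l p) (- conj_l q) *\<^sub>v v))"

lemma adj_add:
  assumes "flip q = - q" "flip q' = - q'" "adj p q" "adj p' q'"
  shows "adj (p + p') (q + q')"
  unfolding adj_def
proof (intro ballI)
  fix u v :: "complex vec" assume uv: "u \<in> carrier_vec d" "v \<in> carrier_vec d"
  have f: "flip (- conj_l q) = - (- conj_l q)" "flip (- conj_l q') = - (- conj_l q')" using assms by simp_all
  have l: "T (p + p') (q + q') *\<^sub>v u = T p q *\<^sub>v u + T p' q' *\<^sub>v u"
    unfolding T_add[OF assms(1,2)] by (rule add_mult_distrib_mat_vec) (use assms uv in auto)
  have "T (conj_l (p + p')) (- conj_l (q + q')) = T (conj_l p) (- conj_l q) + T (conj_l p') (- conj_l q')"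
    using T_add[OF f] by simp
  then have r: "T (conj_l (p + p')) (- conj_l (q + q')) *\<^sub>v v =
      T (conj_l p) (- conj_l q) *\<^sub>v v + T (conj_l p') (- conj_l q') *\<^sub>v v"
    using f uv by (simp add: add_mult_distrib_mat_vec[of _ d d])
  have c: "T p q *\<^sub>v u \<in> carrier_vec d" "T p' q' *\<^sub>v u \<in> carrier_vec d"
    "T (conj_l p) (- conj_l q) *\<^sub>v v \<in> carrier_vec d" "T (conj_l p') (- conj_l q') *\<^sub>v v \<in> carrier_vec d"
    using uv assms f by (auto intro!: mult_mat_vec_carrier[of _ d d])
  show "ip (T (p + p') (q + q') *\<^sub>v u) v = ip u (T (conj_l (p + p')) (- conj_l (q + q')) *\<^sub>v v)"
    unfolding l r herm_innerD(1)[OF herm c(1,2) uv(2)] herm_inner_right(1)[OF herm uv(1) c(3,4)]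
    using assms(3,4) uv unfolding adj_def by simp
qed

lemma adj_cst:
  assumes "flip q = - q" "adj p q"
  shows "adj (cst c * p) (cst c * q)"
  unfolding adj_def
proof (intro ballI)
  fix u v :: "complex vec" assume uv: "u \<in> carrier_vec d" "v \<in> carrier_vec d"
  have f: "flip (- conj_l q) = - (- conj_l q)" using assms by simp
  have l: "T (cst c * p) (cst c * q) *\<^sub>v u = c \<cdot>\<^sub>v (T p q *\<^sub>v u)"
    unfolding T_cst[OF assms(1)] using T_carrier[OF assms(1), of p] uv
    by (intro eq_vecI) auto
  have "T (conj_l (cst c * p)) (- conj_l (cst c * q)) = cnj c \<cdot>\<^sub>m T (conj_l p) (- conj_l q)"
    using T_cst[OF f, of "cnj c" "conj_l p"] by simp
  then have r: "T (conj_l (cst c * p)) (- conj_l (cst c * q)) *\<^sub>v v = cnj c \<cdot>\<^sub>v (T (conj_l p) (- conj_l q) *\<^sub>v v)"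
    using T_carrier[OF f, of "conj_l p"] uv by (auto intro!: eq_vecI)
  have c: "T p q *\<^sub>v u \<in> carrier_vec d" "T (conj_l p) (- conj_l q) *\<^sub>v v \<in> carrier_vec d"
    using uv assms f by (auto intro!: mult_mat_vec_carrier[of _ d d])
  show "ip (T (cst c * p) (cst c * q) *\<^sub>v u) v = ip u (T (conj_l (cst c * p)) (- conj_l (cst c * q)) *\<^sub>v v)"
    unfolding l r herm_innerD(2)[OF herm c(1) uv(2)] herm_inner_right(2)[OF herm uv(1) c(2,2)]
    using assms(2) uv unfolding adj_def by simp
qed

lemma adj_bracket:
  assumes q: "flip q = - q" "flip q' = - q'" and a: "adj p q" "adj p' q'"
  shows "adj (br_p p q p' q') (br_q p p')"
  unfolding adj_def
proof (intro ballI)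
  fix u v :: "complex vec" assume uv: "u \<in> carrier_vec d" "v \<in> carrier_vec d"
  have f: "flip (- conj_l q) = - (- conj_l q)" "flip (- conj_l q') = - (- conj_l q')" using assms by simp_all
  let ?X = "T p q" and ?Y = "T p' q'" and ?X' = "T (conj_l p) (- conj_l q)" and ?Y' = "T (conj_l p') (- conj_l q')"
  have c: "?X \<in> carrier_mat d d" "?Y \<in> carrier_mat d d" "?X' \<in> carrier_mat d d" "?Y' \<in> carrier_mat d d"
    using q f by simp_all
  have comm: "(A * B - B * A) *\<^sub>v w = A *\<^sub>v (B *\<^sub>v w) - B *\<^sub>v (A *\<^sub>v w)"
    if "A \<in> carrier_mat d d" "B \<in> carrier_mat d d" "w \<in> carrier_vec d" for A B :: "complex mat" and w
    using that minus_mult_distrib_mat_vec[of "A * B" d d "B * A" w] by simp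
  have l: "T (br_p p q p' q') (br_q p p') *\<^sub>v u = ?X *\<^sub>v (?Y *\<^sub>v u) - ?Y *\<^sub>v (?X *\<^sub>v u)"
    unfolding T_bracket[OF q] using comm c uv by blast
  have "conj_l (br_p p q p' q') = br_p (conj_l p') (- conj_l q') (conj_l p) (- conj_l q)"
    "- conj_l (br_q p p') = br_q (conj_l p') (conj_l p)"
    by (simp_all add: br_p_def br_q_def mult.commute)
  then have r: "T (conj_l (br_p p q p' q')) (- conj_l (br_q p p')) *\<^sub>v v = ?Y' *\<^sub>v (?X' *\<^sub>v v) - ?X' *\<^sub>v (?Y' *\<^sub>v v)"
    using T_bracket[OF f(2,1), of "conj_l p'" "conj_l p"] comm[OF c(4,3) uv(2)] by simp
  have cu: "?X *\<^sub>v u \<in> carrier_vec d" "?Y *\<^sub>v u \<in> carrier_vec d" "?X *\<^sub>v (?Y *\<^sub>v u) \<in> carrier_vec d" "?Y *\<^sub>v (?X *\<^sub>v u) \<in> carrier_vec d"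
    "?X' *\<^sub>v v \<in> carrier_vec d" "?Y' *\<^sub>v v \<in> carrier_vec d" "?Y' *\<^sub>v (?X' *\<^sub>v v) \<in> carrier_vec d" "?X' *\<^sub>v (?Y' *\<^sub>v v) \<in> carrier_vec d"
    using c uv by (auto intro!: mult_mat_vec_carrier[of _ d d])
  have aX: "ip (?X *\<^sub>v x) y = ip x (?X' *\<^sub>v y)" and aY: "ip (?Y *\<^sub>v x) y = ip x (?Y' *\<^sub>v y)"
    if "x \<in> carrier_vec d" "y \<in> carrier_vec d" for x y
    using a that unfolding adj_def by auto
  show "ip (T (br_p p q p' q') (br_q p p') *\<^sub>v u) v = ip u (T (conj_l (br_p p q p' q')) (- conj_l (br_q p p')) *\<^sub>v v)"
    unfolding l r herm_inner_right(4)[OF herm uv(2) cu(3,4)] herm_inner_right(3)[OF herm uv(1) cu(7,8)]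
    using aX aY cu uv by simp
qed

lemma adj_scale_iff: "flip q = - q \<Longrightarrow> c \<noteq> 0 \<Longrightarrow> adj (cst c * p) (cst c * q) \<Longrightarrow> adj p q"
  using adj_cst[of "cst c * q" "cst c * p" "inverse c"] by (simp add: mult.assoc[symmetric])

text \<open>Only A_0 and A_1 are given as self-adjoint. The bracket of A_1 with A_0 is 4 (t - 1/t)
  h, and bracketing this with A_l gives 8 (A_(l+1) - A_(l-1)); so the property passes from two
  neighbouring indices to the next one on either side.\<close>

lemma adj_A: "adj (single k 2) 0"
proof -
  have base: "adj (single 0 2) 0" "adj (single 1 2) 0"
    using sa0 sa1 unfolding self_adjoint_wrt_def adj_def T_def by (simp_all add: A_elt_oa)
  have "adj (br_p (single 1 2) 0 (single 0 2) 0) (br_q (single 1 2) (single 0 2))"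
    by (rule adj_bracket) (simp_all add: base base[simplified])
  moreover have "br_p (single 1 2) 0 (single 0 2) 0 = 0" "br_q (single 1 2) (single 0 2) = single 1 4 - single (- 1) 4"
    by (simp_all add: br_p_def br_q_def mult_single del: single_numeral)
  ultimately have w: "adj 0 (single 1 4 - single (- 1) 4)" by simp
  have diff: "adj (single (l + 1) 2 - single (l - 1) 2) 0" if "adj (single l 2) 0" for l
  proof -
    have "adj (br_p 0 (single 1 4 - single (- 1) 4) (single l 2) 0) (br_q 0 (single l 2))"
      by (rule adj_bracket) (simp_all add: w that)
    moreover have "br_q 0 (single l 2) = cst 8 * 0" by (simp add: br_q_def)
    moreover have "br_p 0 (single 1 4 - single (- 1) 4) (single l 2) 0 = cst 8 * (single (l + 1) 2 - single (l - 1) 2)"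
    proof -
      have "numeral n * single i x = single i (numeral n * x :: complex)" for n and i :: int and x
        using mult_single[of 0 "numeral n" i x] by simp
      then show ?thesis
        by (simp add: br_p_def left_diff_distrib right_diff_distrib mult_single cst_def add.commute)
    qed
    ultimately have "adj (cst 8 * (single (l + 1) 2 - single (l - 1) 2)) (cst 8 * 0)" by simp
    then show ?thesis by (rule adj_scale_iff[rotated 2]) simp_all
  qed
  have up: "adj (single (l + 1) 2) 0" if "adj (single l 2) 0" "adj (single (l - 1) 2) 0" for l
    using adj_add[OF _ _ diff[OF that(1)] that(2)] by simp
  have down: "adj (single (l - 1) 2) 0" if "adj (single l 2) 0" "adj (single (l + 1) 2) 0" for l
  proof -
    have "adj (cst (- 1) * (single (l + 1) 2 - single (l - 1) 2)) (cst (- 1) * 0)"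
      using adj_cst[OF _ diff[OF that(1)], of "- 1"] by simp
    then have "adj (single (l - 1) 2 - single (l + 1) 2) 0" by (simp add: cst_minus)
    from adj_add[OF _ _ this that(2)] show ?thesis by simp
  qed
  have "adj (single (int n) 2) 0 \<and> adj (single (int n + 1) 2) 0" for n
  proof (induction n)
    case (Suc n)
    then show ?case using up[of "int n + 1"] by (simp add: add.commute)
  qed (simp add: base base[simplified])
  moreover have "adj (single (- int n) 2) 0 \<and> adj (single (- int n + 1) 2) 0" for n
  proof (induction n)
    case (Suc n)
    moreover have "- int (Suc n) = - int n - 1" "- int n - 1 + 1 = - int n" by simp_all
    ultimately show ?case using down[of "- int n"] by (simp only: simp_thms)
  qed (simp add: base base[simplified])
  ultimately show ?thesis by (metis int_cases2)
qed

lemma adj_p: "adj p 0"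
proof (induction p rule: laurent_induct)
  case (single k c)
  have "adj (cst (c / 2) * single k 2) (cst (c / 2) * 0)" by (rule adj_cst) (simp_all add: adj_A)
  then show ?case by (simp add: cst_def mult_single)
next
  case (add p q)
  then show ?case using adj_add[of 0 0 p q] by simp
qed

lemma adj_all:
  assumes q: "flip q = - q"
  shows "adj p q"
proof -
  obtain r where r: "flip r - r = q" using half_skew[OF q] by blast
  have "adj (br_p (- r) 0 1 0) (br_q (- r) 1)" by (rule adj_bracket) (simp_all add: adj_p)
  then have "adj 0 q" using r by (simp add: br_p_def br_q_def)
  then show ?thesis using adj_add[of 0 q p 0] adj_p[of p] q by simp
qed

text \<open>If X X u = 0 and w = X u, then normality gives <Y w, Y w> = <w, Y X w> = 0, and hence
  <w, w> = <u, Y w> = 0. This lowers the exponent in X^k u = 0 down to 1.\<close>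

lemma normal_nilpotent_zero:
  assumes X: "X \<in> carrier_mat d d" and Y: "Y \<in> carrier_mat d d" and comm: "X * Y = Y * X"
    and adjX: "\<And>u v. u \<in> carrier_vec d \<Longrightarrow> v \<in> carrier_vec d \<Longrightarrow> ip (X *\<^sub>v u) v = ip u (Y *\<^sub>v v)"
    and nil: "X ^\<^sub>m k = 0\<^sub>m d d"
  shows "X = 0\<^sub>m d d"
proof (rule mat_eq_zeroI[OF X])
  have adjY: "ip (Y *\<^sub>v u) v = ip u (X *\<^sub>v v)" if "u \<in> carrier_vec d" "v \<in> carrier_vec d" for u v
    using that X Y herm_innerD(3)[OF herm, of "Y *\<^sub>v u" v] herm_innerD(3)[OF herm, of u "X *\<^sub>v v"] adjX[of v u]
    by auto
  have zero: "w = 0\<^sub>v d" if "w \<in> carrier_vec d" "ip w w = 0" for w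
    using herm_innerD(4)[OF herm that(1)] that(2) by (metis less_irrefl zero_complex.simps(1))
  have sq: "X *\<^sub>v u = 0\<^sub>v d" if u: "u \<in> carrier_vec d" "X *\<^sub>v (X *\<^sub>v u) = 0\<^sub>v d" for u
  proof -
    let ?w = "X *\<^sub>v u"
    have w: "?w \<in> carrier_vec d" using X u by simp
    have Yw: "Y *\<^sub>v ?w \<in> carrier_vec d" using Y w by simp
    have "X *\<^sub>v (Y *\<^sub>v ?w) = Y *\<^sub>v (X *\<^sub>v ?w)"
      using assoc_mult_mat_vec[OF X Y w] assoc_mult_mat_vec[OF Y X w] comm by simp
    then have "ip (Y *\<^sub>v ?w) (Y *\<^sub>v ?w) = 0"
      using adjY[OF w Yw] u(2) Y herm_inner_right(5)[OF herm w w w] by simp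
    then have "Y *\<^sub>v ?w = 0\<^sub>v d" using zero Yw by blast
    then have "ip ?w ?w = 0" using adjX[OF u(1) w] herm_inner_right(5)[OF herm u(1) u(1) u(1)] by simp
    then show ?thesis using zero w by blast
  qed
  have pow: "X ^\<^sub>m k *\<^sub>v u = ((*\<^sub>v) X ^^ k) u" if "u \<in> carrier_vec d" for u k
    using that
  proof (induction k arbitrary: u)
    case (Suc k)
    have "X ^\<^sub>m Suc k *\<^sub>v u = X ^\<^sub>m k *\<^sub>v (X *\<^sub>v u)"
      using assoc_mult_mat_vec[OF pow_carrier_mat[OF X, of k] X Suc.prems] by simp
    also have "\<dots> = ((*\<^sub>v) X ^^ k) (X *\<^sub>v u)" using X Suc.prems by (intro Suc.IH) simp
    finally show ?case by (simp only: funpow_Suc_right comp_apply)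
  qed (use X in simp)
  fix u :: "complex vec" assume u: "u \<in> carrier_vec d"
  have "((*\<^sub>v) X ^^ k) u = 0\<^sub>v d"
    using pow[OF u, of k] u unfolding nil by (simp add: zero_mult_vec)
  then show "X *\<^sub>v u = 0\<^sub>v d"
  proof (induction k)
    case 0
    then show ?case using X by simp
  next
    case (Suc k)
    show ?case
    proof (cases k)
      case 0
      then show ?thesis using Suc.prems by simp
    next
      case (Suc k')
      have c: "((*\<^sub>v) X ^^ k') u \<in> carrier_vec d" using X u by (rule funpow_mult_carrier)
      have "X *\<^sub>v (X *\<^sub>v ((*\<^sub>v) X ^^ k') u) = 0\<^sub>v d" using Suc.prems Suc by simp
      then have "((*\<^sub>v) X ^^ k) u = 0\<^sub>v d" using sq[OF c] Suc by simp
      then show ?thesis by (rule Suc.IH)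
    qed
  qed
qed

text \<open>If \<open>|a| \<noteq> 1\<close>, the adjoint of the raising operator at \<open>a\<close> lives at the other point \<open>1 / cnj a\<close>
  and hence commutes with it; but a normal nilpotent operator vanishes.\<close>

lemma support_on_unit_circle:
  assumes gen: "generic as" and k: "kills (set as)" and len: "length ms = length as"
    and pos: "\<And>m. m \<in> set ms \<Longrightarrow> m \<ge> 2" and eq: "equiv_rep d \<rho> (prod_list ms) (tensor_rep (zip as ms))"
    and j: "j < length as"
  shows "cnj (as ! j) = inverse (as ! j)"
proof (rule ccontr)
  let ?a = "as ! j" and ?L = "zip as ms"
  assume neq: "cnj ?a \<noteq> inverse ?a"
  have az: "?a \<noteq> 0" using genericD(1)[OF gen j j] .
  \<comment> \<open>The value of \<open>conj_l e\<close> at 1/a is the conjugate of e(1 / cnj a).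
    That point differs from a because a is off the unit circle, so a zero can be prescribed
    there.\<close>
  let ?B = "set (as @ map inverse as @ [inverse (cnj ?a)]) - {?a}"
  have z: "0 \<notin> ?B" using gen az unfolding generic_def by auto
  obtain e where e: "ev e ?a = 1" "\<And>c. c \<in> ?B \<Longrightarrow> ev e c = 0"
    using interpolation[of ?B ?a] z az by auto
  have "inverse (cnj ?a) \<noteq> ?a" using neq by (metis inverse_inverse_eq)
  then have e_c: "ev e (inverse (cnj ?a)) = 0" by (intro e(2)) auto
  have e_inv: "ev e (inverse ?a) = 0"
    using genericD(2)[OF gen j j] j by (intro e(2)) auto
  have other: "ev e b = 0 \<and> ev e (inverse b) = 0" if b: "b \<in> set as" "b \<noteq> ?a" for b
  proof -
    obtain i where i: "i < length as" "b = as ! i" using b(1) by (auto simp: in_set_conv_nth)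
    then have "inverse b \<noteq> ?a" using genericD(2)[OF gen j i(1)] by auto
    then show ?thesis using b by (auto intro!: e(2))
  qed
  have LL: "map snd ?L = ms" using len by simp
  let ?X = "T e 0" and ?Y = "T (conj_l e) 0"
  have pow: "?X ^\<^sub>m r = 0\<^sub>m d d \<longleftrightarrow> ms ! j \<le> r" for r
  proof -
    have "tensor_rep ?L (oa e 0) ^\<^sub>m r = 0\<^sub>m (prod_list (map snd ?L)) (prod_list (map snd ?L)) \<longleftrightarrow>
      ev_rep (snd (?L ! j)) (fst (?L ! j)) (oa e 0) ^\<^sub>m r = 0\<^sub>m (snd (?L ! j)) (snd (?L ! j))"
    proof (rule tensor_rep_slot_pow)
      show "j < length ?L" using j len by simp
      have "snd ` set ?L = set ms" using LL by (metis set_map)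
      then show "0 \<notin> snd ` set ?L" using pos by force
      fix i assume i: "i < length ?L" "i \<noteq> j"
      then have i': "i < length as" using len by simp
      then have "ev e (as ! i) = 0 \<and> ev e (inverse (as ! i)) = 0"
        using genericD(3)[OF gen i' j i(2)] by (intro other) auto
      then have "ev_rep m (as ! i) (oa e 0) = 0\<^sub>m m m" for m
        using ev_rep_oa_cong[of e "as ! i" 0 0 0 m] ev_rep_zero by simp
      then show "ev_rep (snd (?L ! i)) (fst (?L ! i)) (oa e 0) = 0\<^sub>m (snd (?L ! i)) (snd (?L ! i))" using i
        by simp
    qed
    also have "\<dots> \<longleftrightarrow> ms ! j \<le> r" using j len e(1) e_inv sl2_E_pow_zero by (simp add: ev_rep_E)
    finally have "tensor_rep ?L (oa e 0) ^\<^sub>m r = 0\<^sub>m (prod_list ms) (prod_list ms) \<longleftrightarrow> ms ! j \<le> r" unfolding LL .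
    moreover have "\<rho> (oa e 0) ^\<^sub>m r = 0\<^sub>m d d \<longleftrightarrow> tensor_rep ?L (oa e 0) ^\<^sub>m r = 0\<^sub>m (prod_list ms) (prod_list ms)"
      using tensor_rep_carrier[of ?L "oa e 0"] T_carrier[of 0 e] unfolding LL T_def
      by (intro equiv_rep_pow_zero[OF eq]) simp_all
    ultimately show ?thesis unfolding T_def by simp
  qed
  \<comment> \<open>At a the h-coordinate is e(a) cnj (e(1 / cnj a)) - e(1/a) cnj (e(cnj a)). The
    products vanish by the choice at 1 / cnj a and by e(1/a) = 0, whatever e(cnj a) is.\<close>
  have "T (br_p e 0 (conj_l e) 0) (br_q e (conj_l e)) = T 0 0"
  proof (rule T_eq_on[OF k])
    fix b assume b: "b \<in> set as"
    then have bz: "b \<noteq> 0" using gen unfolding generic_def by auto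
    show "ev (br_p e 0 (conj_l e) 0) b = ev 0 b \<and> ev (br_p e 0 (conj_l e) 0) (inverse b) = ev 0 (inverse b) \<and>
        ev (br_q e (conj_l e)) b = ev 0 b"
    proof (cases "b = ?a")
      case True
      then show ?thesis using bz e_inv e_c by (simp add: br_p_def br_q_def)
    next
      case False
      then show ?thesis using bz other[OF b] by (simp add: br_p_def br_q_def)
    qed
  qed simp_all
  then have "?X * ?Y = ?Y * ?X"
    using T_bracket[of 0 0 e "conj_l e"] by (intro commute_of_commutator_zero) simp_all
  moreover have "ip (?X *\<^sub>v u) v = ip u (?Y *\<^sub>v v)" if "u \<in> carrier_vec d" "v \<in> carrier_vec d" for u v
    using adj_all[of 0 e] that unfolding adj_def by simp
  moreover have "?X ^\<^sub>m (ms ! j) = 0\<^sub>m d d" using pow by simp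
  ultimately have "?X = 0\<^sub>m d d" by (intro normal_nilpotent_zero[of ?X ?Y]) simp_all
  then have "?X ^\<^sub>m 1 = 0\<^sub>m d d" by simp
  moreover have "ms ! j \<ge> 2" using pos j len by simp
  ultimately show False using pow[of 1] by simp
qed

end

section \<open>Diagonal Hermitian forms on tensor modules\<close>

definition diag_adjoint :: "nat \<Rightarrow> (nat \<Rightarrow> real) \<Rightarrow> complex mat \<Rightarrow> bool" where
  "diag_adjoint n W A \<longleftrightarrow> (\<forall>i<n. \<forall>j<n. of_real (W i) * A $$ (i, j) = of_real (W j) * cnj (A $$ (j, i)))"

text \<open>The relation is self-adjointness for an orthogonal basis with squared norms W, and the
  squared norms of pure tensors multiply.\<close>

lemma diag_adjoint_kron:
  assumes A: "A \<in> carrier_mat m m" "diag_adjoint m V A" and B: "B \<in> carrier_mat n n" "diag_adjoint n W B"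
  shows "diag_adjoint (m * n) (\<lambda>i. V (i div n) * W (i mod n)) (kron A B)"
  unfolding diag_adjoint_def
proof (intro allI impI)
  fix i j assume ij: "i < m * n" "j < m * n"
  note l = mod_div_less[OF ij(1)] mod_div_less[OF ij(2)]
  have "of_real (V (i div n)) * A $$ (i div n, j div n) = of_real (V (j div n)) * cnj (A $$ (j div n, i div n))"
    "of_real (W (i mod n)) * B $$ (i mod n, j mod n) = of_real (W (j mod n)) * cnj (B $$ (j mod n, i mod n))"
    using A(2) B(2) l unfolding diag_adjoint_def by blast+
  then have "(of_real (V (i div n)) * A $$ (i div n, j div n)) * (of_real (W (i mod n)) * B $$ (i mod n, j mod n)) =
    (of_real (V (j div n)) * cnj (A $$ (j div n, i div n))) * (of_real (W (j mod n)) * cnj (B $$ (j mod n, i mod n)))"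
    by simp
  then show "of_real (V (i div n) * W (i mod n)) * kron A B $$ (i, j) =
    of_real (V (j div n) * W (j mod n)) * cnj (kron A B $$ (j, i))"
    using kron_index[OF A(1) B(1) ij] kron_index[OF A(1) B(1) ij(2,1)] by (simp add: ac_simps)
qed

lemma diag_adjoint_one: "diag_adjoint n W (1\<^sub>m n)"
  by (simp add: diag_adjoint_def)

lemma diag_adjoint_add:
  "A \<in> carrier_mat n n \<Longrightarrow> B \<in> carrier_mat n n \<Longrightarrow> diag_adjoint n W A \<Longrightarrow> diag_adjoint n W B \<Longrightarrow> diag_adjoint n W (A + B)"
  by (simp add: diag_adjoint_def distrib_left)

text \<open>The weights are the squared norms of the basis vectors of \<open>V(s)\<close> in the unitary structure of
  the compact form, normalised by \<open>\<parallel>v\<^sub>0\<parallel> = 1\<close>.\<close>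

lemma diag_adjoint_ev_rep:
  assumes a: "cnj a = inverse a"
  shows "diag_adjoint m (\<lambda>k. \<Prod>i<k. real (Suc i * (m - Suc i))) (ev_rep m a (A_elt r))"
  unfolding diag_adjoint_def
proof (intro allI impI)
  let ?W = "\<lambda>k. \<Prod>i<k. real (Suc i * (m - Suc i))"
  have A: "ev_rep m a (A_elt r) $$ (i, j) = 2 * a powi r * sl2_E m $$ (i, j) + 2 * inverse a powi r * sl2_F m $$ (i, j)"
    if "i < m" "j < m" for i j
    using that unfolding A_elt_oa ev_rep_oa by simp
  have cp: "cnj (x powi k) = cnj x powi k" for x k by (simp add: power_int_def)
  have ca: "inverse (cnj a) = a" using a by simp
  fix i j assume ij: "i < m" "j < m"
  consider "j = Suc i" | "i = Suc j" | "j \<noteq> Suc i" "i \<noteq> Suc j" by blast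
  then show "of_real (?W i) * ev_rep m a (A_elt r) $$ (i, j) = of_real (?W j) * cnj (ev_rep m a (A_elt r) $$ (j, i))"
  proof cases
    \<comment> \<open>For j = i + 1 the weights satisfy W j = j (m - j) W i, which balances the
      entry j (m - j) of E against the entry 1 of F; conjugation exchanges a and 1/a.\<close>
    case 1
    then show ?thesis unfolding A[OF ij] A[OF ij(2,1)] using ij
      by (simp add: sl2_E_def sl2_F_def cp ca del: of_nat_mult mult_Suc)
  next
    case 2
    then show ?thesis unfolding A[OF ij] A[OF ij(2,1)] using ij
      by (simp add: sl2_E_def sl2_F_def cp a del: of_nat_mult mult_Suc)
  next
    case 3
    then show ?thesis unfolding A[OF ij] A[OF ij(2,1)] using ij by (simp add: sl2_E_def sl2_F_def)
  qed
qed

lemma diag_adjoint_tensor_rep: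
  assumes "\<And>a. a \<in> fst ` set L \<Longrightarrow> cnj a = inverse a"
  shows "\<exists>W. (\<forall>i<prod_list (map snd L). W i > 0) \<and>
    (\<forall>r. diag_adjoint (prod_list (map snd L)) W (tensor_rep L (A_elt r)))"
  using assms
proof (induction L)
  case Nil
  show ?case by (intro exI[of _ "\<lambda>_. 1"]) (auto simp: diag_adjoint_def)
next
  case (Cons am L)
  obtain a m where am: "am = (a, m)" by force
  let ?n = "prod_list (map snd L)"
  obtain W where W: "\<And>i. i < ?n \<Longrightarrow> W i > 0" "\<And>r. diag_adjoint ?n W (tensor_rep L (A_elt r))"
    using Cons by auto
  have a: "cnj a = inverse a" using Cons.prems am by auto
  define V where "V k = (\<Prod>i<k. real (Suc i * (m - Suc i)))" for k
  have V: "V k > 0" if "k < m" for k unfolding V_def using that by (intro prod_pos) (auto simp del: of_nat_mult mult_Suc)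
  have dV: "diag_adjoint m V (ev_rep m a (A_elt r))" for r
    using diag_adjoint_ev_rep[OF a] unfolding V_def .
  show ?case
  proof (intro exI[of _ "\<lambda>i. V (i div ?n) * W (i mod ?n)"] conjI allI impI)
    fix i assume "i < prod_list (map snd (am # L))"
    then have "i < m * ?n" using am by simp
    from mod_div_less[OF this] show "V (i div ?n) * W (i mod ?n) > 0" using V W(1) by simp
  next
    fix r
    have "diag_adjoint (m * ?n) (\<lambda>i. V (i div ?n) * W (i mod ?n))
       (kron (ev_rep m a (A_elt r)) (1\<^sub>m ?n) + kron (1\<^sub>m m) (tensor_rep L (A_elt r)))"
      using tensor_rep_carrier[of L "A_elt r"] dV W(2)
      by (intro diag_adjoint_add diag_adjoint_kron diag_adjoint_one kron_carrier) auto
    then show "diag_adjoint (prod_list (map snd (am # L))) (\<lambda>i. V (i div ?n) * W (i mod ?n)) (tensor_rep (am # L) (A_elt r))"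
      using am by simp
  qed
qed

lemma herm_inner_diag:
  assumes W: "\<And>i. i < n \<Longrightarrow> W i > 0"
  shows "herm_inner n (\<lambda>u v. \<Sum>i<n. of_real (W i) * u $ i * cnj (v $ i))"
  unfolding herm_inner_def
proof (intro conjI ballI allI impI)
  fix v :: "complex vec" assume v: "v \<in> carrier_vec n" "v \<noteq> 0\<^sub>v n"
  have eq: "Re (\<Sum>i<n. of_real (W i) * v $ i * cnj (v $ i)) = (\<Sum>i<n. W i * (cmod (v $ i))\<^sup>2)"
    by (simp add: mult.assoc complex_norm_square[symmetric] of_real_mult[symmetric] of_real_power[symmetric]
        del: of_real_mult of_real_power)
  obtain i where i: "i < n" "v $ i \<noteq> 0" using v by (metis carrier_vecD eq_vecI index_zero_vec(1,2))
  have "(\<Sum>i<n. W i * (cmod (v $ i))\<^sup>2) > 0"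
    using W i by (intro sum_pos2[of _ i]) (auto intro!: mult_nonneg_nonneg less_imp_le[OF W])
  then show "Re (\<Sum>i<n. of_real (W i) * v $ i * cnj (v $ i)) > 0" unfolding eq .
qed (auto simp: sum.distrib algebra_simps sum_distrib_left)

lemma self_adjoint_diag:
  assumes A: "A \<in> carrier_mat n n" and d: "diag_adjoint n W A"
  shows "self_adjoint_wrt n (\<lambda>u v. \<Sum>i<n. of_real (W i) * u $ i * cnj (v $ i)) A"
  unfolding self_adjoint_wrt_def
proof (intro ballI)
  fix u v :: "complex vec" assume uv: "u \<in> carrier_vec n" "v \<in> carrier_vec n"
  have Av: "(A *\<^sub>v w) $ i = (\<Sum>j<n. A $$ (i, j) * w $ j)" if "i < n" "w \<in> carrier_vec n" for i w
    using A that by (simp add: scalar_prod_def atLeast0LessThan)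
  have "(\<Sum>i<n. of_real (W i) * (A *\<^sub>v u) $ i * cnj (v $ i)) =
      (\<Sum>i<n. \<Sum>j<n. (of_real (W i) * A $$ (i, j)) * (u $ j * cnj (v $ i)))"
    using uv by (intro sum.cong) (auto simp: Av sum_distrib_left sum_distrib_right ac_simps simp del: index_mult_mat_vec)
  also have "\<dots> = (\<Sum>i<n. \<Sum>j<n. (of_real (W j) * cnj (A $$ (j, i))) * (u $ j * cnj (v $ i)))"
    using d unfolding diag_adjoint_def by (intro sum.cong) auto
  also have "\<dots> = (\<Sum>j<n. \<Sum>i<n. (of_real (W j) * cnj (A $$ (j, i))) * (u $ j * cnj (v $ i)))"
    by (rule sum.swap)
  also have "\<dots> = (\<Sum>j<n. of_real (W j) * u $ j * cnj ((A *\<^sub>v v) $ j))"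
    using uv by (intro sum.cong) (auto simp: Av sum_distrib_left ac_simps simp del: index_mult_mat_vec)
  finally show "(\<Sum>i<n. of_real (W i) * (A *\<^sub>v u) $ i * cnj (v $ i)) =
      (\<Sum>i<n. of_real (W i) * u $ i * cnj ((A *\<^sub>v v) $ i))" .
qed

lemma hermitian_tensor_rep:
  assumes "\<And>a. a \<in> fst ` set L \<Longrightarrow> cnj a = inverse a"
  shows "hermitian_rep (prod_list (map snd L)) (tensor_rep L)"
proof -
  obtain W where "\<And>i. i < prod_list (map snd L) \<Longrightarrow> W i > 0"
    "\<And>r. diag_adjoint (prod_list (map snd L)) W (tensor_rep L (A_elt r))"
    using diag_adjoint_tensor_rep[OF assms] by blast
  then show ?thesis unfolding hermitian_rep_def
    using herm_inner_diag self_adjoint_diag[OF tensor_rep_carrier] by blast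
qed

section \<open>Classification\<close>

text \<open>The conditions for general irreducible representations; the data of the Hermitian case
  satisfy them as well.\<close>

definition admissible :: "complex list \<Rightarrow> real list \<Rightarrow> bool" where
  "admissible as ss \<longleftrightarrow> length as \<ge> 1 \<and> length ss = length as \<and> generic as \<and> (\<forall>s\<in>set ss. pos_half_int s)"

lemma rho_dim_zip: "length ss = length as \<Longrightarrow> rho_dim ss = prod_list (map snd (zip as (map spin_dim ss)))"
  by (simp add: rho_dim_def)

lemma irreducible_rep_iff: "irreducible_rep d \<rho> \<longleftrightarrow> irreducible_set d (\<rho> ` OA)"
  unfolding irreducible_rep_def irreducible_set_def by simp

lemma rho_as_carrier: "length ss = length as \<Longrightarrow> rho_as as ss X \<in> carrier_mat (rho_dim ss) (rho_dim ss)"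
  using tensor_rep_carrier[of "zip as (map spin_dim ss)" X] by (simp add: rho_dim_zip rho_as_def)

lemma rho_as_rep:
  assumes "admissible as ss"
  shows "is_sl_rep (rho_dim ss) (rho_as as ss)" "irreducible_rep (rho_dim ss) (rho_as as ss)"
    "nonzero_rep (rho_dim ss) (rho_as as ss)"
proof -
  let ?L = "zip as (map spin_dim ss)"
  have len: "length as \<ge> 1" "length ss = length as" and gen: "generic as"
    and s: "\<And>s. s \<in> set ss \<Longrightarrow> pos_half_int s" using assms unfolding admissible_def by auto
  have ne: "as \<noteq> []" "ss \<noteq> []" using len by auto
  have L: "map fst ?L = as" "map snd ?L = map spin_dim ss" using len by simp_all
  have fL: "fst ` set ?L = set as" "snd ` set ?L = spin_dim ` set ss" using L by (metis set_map)+
  have dims: "0 \<notin> snd ` set ?L" unfolding fL using s pos_half_int_spin_dim by force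
  show "is_sl_rep (rho_dim ss) (rho_as as ss)"
    unfolding rho_dim_zip[OF len(2)] rho_as_def
  proof (rule tensor_rep_is_sl_rep)
    fix a m assume "(a, m) \<in> set ?L"
    then have "a \<in> set as" by (rule set_zip_leftD)
    then show "a \<noteq> 0" using gen unfolding generic_def by auto
  qed
  have "map (inverse \<circ> fst) ?L = map inverse as" using L(1) by (metis map_map)
  then show "irreducible_rep (rho_dim ss) (rho_as as ss)"
    unfolding irreducible_rep_iff rho_dim_zip[OF len(2)] rho_as_def
    using gen dims fL L(1) by (intro tensor_rep_irreducible) (auto simp: generic_def)
  have as0: "as ! 0 \<in> set as" by (rule nth_mem) (use len(1) in linarith)
  \<comment> \<open>An element acting as E in slot 0 alone witnesses that the representation is
    nonzero, as that slot has dimension at least 2.\<close>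
  obtain e where e: "ev e (as ! 0) = 1" "ev e (inverse (as ! 0)) = 0"
    "\<And>b. b \<in> set as \<Longrightarrow> b \<noteq> as ! 0 \<Longrightarrow> ev e b = 0 \<and> ev e (inverse b) = 0"
    using separating_laurent[OF _ _ as0] gen unfolding generic_def by blast
  have "tensor_rep ?L (oa e 0) ^\<^sub>m 1 = 0\<^sub>m (prod_list (map snd ?L)) (prod_list (map snd ?L)) \<longleftrightarrow>
      ev_rep (snd (?L ! 0)) (fst (?L ! 0)) (oa e 0) ^\<^sub>m 1 = 0\<^sub>m (snd (?L ! 0)) (snd (?L ! 0))"
  proof (rule tensor_rep_slot_pow)
    show "0 < length ?L" using len ne by simp
    show "0 \<notin> snd ` set ?L" by (rule dims)
    fix i assume i: "i < length ?L" "i \<noteq> 0"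
    then have i': "i < length as" "0 < length as" using len by auto
    then have "ev e (as ! i) = 0 \<and> ev e (inverse (as ! i)) = 0"
      using genericD(3)[OF gen i' i(2)] by (intro e(3)) auto
    then have "ev_rep m (as ! i) (oa e 0) = 0\<^sub>m m m" for m
      using ev_rep_oa_cong[of e "as ! i" 0 0 0 m] ev_rep_zero by simp
    then show "ev_rep (snd (?L ! i)) (fst (?L ! i)) (oa e 0) = 0\<^sub>m (snd (?L ! i)) (snd (?L ! i))"
      using i by simp
  qed
  moreover have "ev_rep (snd (?L ! 0)) (fst (?L ! 0)) (oa e 0) = sl2_E (spin_dim (ss ! 0))"
    using len ne e by (simp add: ev_rep_E)
  moreover have "\<not> sl2_E (spin_dim (ss ! 0)) ^\<^sub>m 1 = 0\<^sub>m (spin_dim (ss ! 0)) (spin_dim (ss ! 0))"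
    unfolding sl2_E_pow_zero using pos_half_int_spin_dim[OF s[of "ss ! 0"]] len ne by simp
  moreover have "snd (?L ! 0) = spin_dim (ss ! 0)" using len ne by simp
  ultimately have "tensor_rep ?L (oa e 0) ^\<^sub>m 1 \<noteq> 0\<^sub>m (rho_dim ss) (rho_dim ss)"
    unfolding rho_dim_zip[OF len(2)] by simp
  then have "rho_as as ss (oa e 0) \<noteq> 0\<^sub>m (rho_dim ss) (rho_dim ss)"
    unfolding rho_as_def using tensor_rep_carrier[of ?L "oa e 0"] by auto
  moreover have "oa e 0 \<in> OA" by simp
  ultimately show "nonzero_rep (rho_dim ss) (rho_as as ss)" unfolding nonzero_rep_def by blast
qed

context oa_irrep begin

text \<open>A slot of dimension 1 acts by 0, so its point could be dropped from the support. As the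
  support is minimal, all dimensions are at least 2, which makes the spins positive.\<close>

lemma classification:
  assumes nz: "nonzero_rep d \<rho>"
  obtains as ms where "as \<noteq> []" "generic as" "kills (set as)" "length ms = length as"
    "\<And>m. m \<in> set ms \<Longrightarrow> m \<ge> 2" "equiv_rep d \<rho> (prod_list ms) (tensor_rep (zip as ms))"
proof -
  obtain as where as: "distinct (as @ map inverse as)" "0 \<notin> set as" and k: "kills (set as)"
    and min: "\<And>a. a \<in> set as \<Longrightarrow> \<not> kills (set as - {a})" using exists_support by blast
  have gen: "generic as" using as unfolding generic_def by simp
  obtain ms where ms: "length ms = length as" "\<And>m. m \<in> set ms \<Longrightarrow> m > 0"
    "equiv_rep d \<rho> (prod_list ms) (tensor_rep (zip as ms))"
    using tensor_form[OF as k] by blast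
  have ne: "as \<noteq> []"
  proof
    assume "as = []"
    then have z: "T p q = 0\<^sub>m d d" if "flip q = - q" for p q using k that unfolding kills_def by simp
    obtain X where X: "X \<in> OA" "\<rho> X \<noteq> 0\<^sub>m d d" using nz unfolding nonzero_rep_def by blast
    obtain p q where "X = oa p q" "flip q = - q" using OA_cases[OF X(1)] by blast
    then show False using z X(2) unfolding T_def by simp
  qed
  have "ms ! j \<noteq> 1" if j: "j < length as" for j
  proof
    assume one: "ms ! j = 1"
    have "kills (set as - {as ! j})" unfolding kills_def
    proof (intro allI impI)
      fix p q assume q: "flip q = - q"
        and v: "\<forall>b\<in>set as - {as ! j}. ev p b = 0 \<and> ev p (inverse b) = 0 \<and> ev q b = 0"
      let ?L = "zip as ms"
      have "tensor_rep ?L (oa p q) = 0\<^sub>m (prod_list (map snd ?L)) (prod_list (map snd ?L))"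
      proof (rule tensor_rep_zero_of_ev_rep)
        fix b m assume "(b, m) \<in> set ?L"
        then obtain i where i: "i < length as" "b = as ! i" "m = ms ! i"
          using ms(1) by (auto simp: set_zip)
        show "ev_rep m b (oa p q) = 0\<^sub>m m m"
        proof (cases "i = j")
          case True
          then show ?thesis unfolding ev_rep_oa i(3) one
            by (intro eq_matI) (auto simp: one sl2_E_def sl2_F_def sl2_H_def)
        next
          case False
          then have "b \<in> set as - {as ! j}" using genericD(3)[OF gen i(1) j] i by auto
          then have "ev p b = 0 \<and> ev p (inverse b) = 0 \<and> ev q b = 0" using v by blast
          then show ?thesis using ev_rep_oa_cong[of p b 0 q 0 m] ev_rep_zero by simp
        qed
      qed
      then have "tensor_rep ?L (oa p q) ^\<^sub>m 1 = 0\<^sub>m (prod_list ms) (prod_list ms)" using ms(1) by simp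
      moreover have "\<rho> (oa p q) ^\<^sub>m 1 = 0\<^sub>m d d \<longleftrightarrow> tensor_rep ?L (oa p q) ^\<^sub>m 1 = 0\<^sub>m (prod_list ms) (prod_list ms)"
        using tensor_rep_carrier[of ?L "oa p q"] T_carrier[OF q, of p] ms(1) q unfolding T_def
        by (intro equiv_rep_pow_zero[OF ms(3)]) simp_all
      ultimately show "T p q = 0\<^sub>m d d" using T_carrier[OF q, of p] unfolding T_def by simp
    qed
    then show False using min[of "as ! j"] j by simp
  qed
  then have "m \<noteq> 1" if "m \<in> set ms" for m using that ms(1) by (auto simp: in_set_conv_nth)
  then have "m \<ge> 2" if "m \<in> set ms" for m using ms(2)[OF that] that by fastforce
  then show ?thesis using that[of as ms] ne gen k ms by blast
qed

end

section \<open>Equivalence of two sets of data\<close>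

lemma tensor_rep_as_rho_as:
  assumes "length ms = length as" "\<And>m. m \<in> set ms \<Longrightarrow> m \<ge> 2"
  obtains ss where "length ss = length as" "\<And>s. s \<in> set ss \<Longrightarrow> pos_half_int s"
    "rho_dim ss = prod_list ms" "rho_as as ss = tensor_rep (zip as ms)"
proof -
  define ss where "ss = map (\<lambda>m. (real m - 1) / 2) ms"
  have "map spin_dim ss = ms" unfolding ss_def map_map using assms(2) spin_of_dim
    by (intro map_idI) auto
  moreover have "\<And>s. s \<in> set ss \<Longrightarrow> pos_half_int s" using assms(2) spin_of_dim unfolding ss_def by auto
  ultimately show ?thesis using assms(1) by (intro that[of ss]) (auto simp: ss_def rho_dim_def rho_as_def)
qed

lemma equiv_rep_sym:
  assumes e: "equiv_rep d \<rho> d' \<rho>'" and c: "\<And>X. \<rho> X \<in> carrier_mat d d" "\<And>X. \<rho>' X \<in> carrier_mat d' d'"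
  shows "equiv_rep d' \<rho>' d \<rho>"
proof -
  have dd: "d' = d" using e unfolding equiv_rep_def by simp
  obtain P where P: "P \<in> carrier_mat d d" "invertible_mat P" "\<And>X. X \<in> OA \<Longrightarrow> P * \<rho> X = \<rho>' X * P"
    using e unfolding equiv_rep_def by blast
  obtain Q where Q: "P * Q = 1\<^sub>m d" "Q * P = 1\<^sub>m d" "Q \<in> carrier_mat d d"
    using invertible_mat_inverse[OF P(1,2)] by blast
  have "Q * \<rho>' X = \<rho> X * Q" if "X \<in> OA" for X
    using intertwiner_inverse[OF P(1) Q(3,1,2) c(1) _ P(3)[OF that]] c(2)[of X] dd by simp
  moreover have "invertible_mat Q"
    using Q P(1) unfolding invertible_mat_def inverts_mat_def by auto
  ultimately show ?thesis unfolding equiv_rep_def using Q(3) dd by auto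
qed

lemma equivalent_points:
  assumes adm: "admissible as ss" "admissible as' ss'"
    and eq: "equiv_rep (rho_dim ss) (rho_as as ss) (rho_dim ss') (rho_as as' ss')"
    and j: "j < length as"
  shows "\<exists>k<length as'. ahat (as' ! k) = ahat (as ! j) \<and> ss' ! k = ss ! j"
proof -
  have len: "length ss = length as" "length ss' = length as'" and gen: "generic as" "generic as'"
    and s: "\<And>s. s \<in> set ss \<Longrightarrow> pos_half_int s" "\<And>s. s \<in> set ss' \<Longrightarrow> pos_half_int s"
    using adm unfolding admissible_def by auto
  have sj: "pos_half_int (ss ! j)" using s(1) j len by simp
  have "\<exists>k<length as'. (as' ! k = as ! j \<or> as' ! k = inverse (as ! j)) \<and> map spin_dim ss' ! k = map spin_dim ss ! j"
  proof (rule multiplicity_invariant[OF eq[unfolded rho_as_def] _ _ _ _ gen])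
    show "0 \<notin> set (map spin_dim ss)" "0 \<notin> set (map spin_dim ss')"
      using s pos_half_int_spin_dim by force+
    show "map spin_dim ss ! j \<ge> 2" using pos_half_int_spin_dim[OF sj] j len by simp
  qed (use len j in \<open>auto simp: rho_dim_def\<close>)
  then obtain k where k: "k < length as'" "as' ! k = as ! j \<or> as' ! k = inverse (as ! j)"
    "spin_dim (ss' ! k) = spin_dim (ss ! j)" using j len by auto
  have "ahat (as' ! k) = ahat (as ! j)" using k(2) by (auto simp: ahat_def add.commute)
  moreover have "ss' ! k = ss ! j" using k(1,3) s(2) sj len by (intro spin_dim_inject) auto
  ultimately show ?thesis using k(1) by blast
qed

text \<open>Left to right, matching the points in both directions gives a bijection f from the first
  list to the second; its inverse is \<sigma>. Right to left, the tensor form is applied to the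
  first representation with the points of the second list, and nilpotency indices identify the
  resulting dimensions.\<close>

lemma equivalent_iff_permuted:
  assumes adm: "admissible as ss" "admissible as' ss'"
    and dist: "\<And>j k. j < length as \<Longrightarrow> k < length as \<Longrightarrow> j \<noteq> k \<Longrightarrow> ahat (as ! j) \<noteq> ahat (as ! k)"
    and dist': "\<And>j k. j < length as' \<Longrightarrow> k < length as' \<Longrightarrow> j \<noteq> k \<Longrightarrow> ahat (as' ! j) \<noteq> ahat (as' ! k)"
  shows "equiv_rep (rho_dim ss) (rho_as as ss) (rho_dim ss') (rho_as as' ss') \<longleftrightarrow>
    length as' = length as \<and> (\<exists>\<sigma>. bij_betw \<sigma> {..<length as} {..<length as} \<and>
      (\<forall>j<length as. ahat (as' ! j) = ahat (as ! \<sigma> j) \<and> ss' ! j = ss ! \<sigma> j))"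
    (is "?E \<longleftrightarrow> ?R")
proof
  have carr: "rho_as as ss X \<in> carrier_mat (rho_dim ss) (rho_dim ss)"
    "rho_as as' ss' X \<in> carrier_mat (rho_dim ss') (rho_dim ss')" for X
    using adm rho_as_carrier unfolding admissible_def by blast+
  assume E: ?E
  obtain f where f: "\<And>j. j < length as \<Longrightarrow> f j < length as' \<and> ahat (as' ! f j) = ahat (as ! j) \<and> ss' ! f j = ss ! j"
    using equivalent_points[OF adm E] by metis
  have f_inj: "inj_on f {..<length as}" using f dist by (intro inj_onI) (metis lessThan_iff)
  have f_surj: "\<exists>j<length as. f j = k" if k: "k < length as'" for k
  proof -
    have "equiv_rep (rho_dim ss') (rho_as as' ss') (rho_dim ss) (rho_as as ss)"
      by (rule equiv_rep_sym[OF E carr])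
    from equivalent_points[OF adm(2,1) this k] obtain j where "j < length as" "ahat (as ! j) = ahat (as' ! k)" by blast
    then show ?thesis using f dist' k by metis
  qed
  have bij: "bij_betw f {..<length as} {..<length as'}"
    unfolding bij_betw_def using f_inj f f_surj by auto
  from bij_betw_same_card[OF this] have len: "length as' = length as" by simp
  define g where "g = inv_into {..<length as} f"
  have g: "bij_betw g {..<length as} {..<length as}"
    unfolding g_def using bij_betw_inv_into[OF bij] len by simp
  have "ahat (as' ! j) = ahat (as ! g j) \<and> ss' ! j = ss ! g j" if "j < length as" for j
  proof -
    have "f (g j) = j" unfolding g_def using bij_betw_inv_into_right[OF bij] that len by simp
    moreover have "g j < length as" using g that unfolding bij_betw_def by auto
    ultimately show ?thesis using f[of "g j"] by simp
  qed
  then show ?R using g len by blast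
next
  assume ?R
  then obtain \<sigma> where len: "length as' = length as" and \<sigma>: "bij_betw \<sigma> {..<length as} {..<length as}"
    and eq: "\<And>j. j < length as \<Longrightarrow> ahat (as' ! j) = ahat (as ! \<sigma> j) \<and> ss' ! j = ss ! \<sigma> j" by blast
  have lens: "length ss = length as" "length ss' = length as'" and gen: "generic as" "generic as'"
    and s: "\<And>s. s \<in> set ss \<Longrightarrow> pos_half_int s" "\<And>s. s \<in> set ss' \<Longrightarrow> pos_half_int s"
    using adm unfolding admissible_def by auto
  interpret R: oa_irrep "rho_dim ss" "rho_as as ss"
    using rho_as_rep[OF adm(1)] by unfold_locales
  have \<sigma>_lt: "\<sigma> j < length as" if "j < length as" for j using \<sigma> that unfolding bij_betw_def by auto
  have \<sigma>_surj: "\<exists>j<length as. \<sigma> j = i" if "i < length as" for i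
    using \<sigma> that unfolding bij_betw_def by (metis imageE lessThan_iff)
  \<comment> \<open>The two lists agree up to order and inversion, and the vanishing condition is
    stable under inversion, so it forces every slot of the first module to act by 0.\<close>
  have "R.kills (set as')" unfolding R.kills_def
  proof (intro allI impI)
    fix p q assume q: "flip q = - q" and v: "\<forall>b\<in>set as'. ev p b = 0 \<and> ev p (inverse b) = 0 \<and> ev q b = 0"
    have "tensor_rep (zip as (map spin_dim ss)) (oa p q) = 0\<^sub>m (rho_dim ss) (rho_dim ss)"
      unfolding rho_dim_zip[OF lens(1)]
    proof (rule tensor_rep_vanish)
      fix a assume "a \<in> fst ` set (zip as (map spin_dim ss))"
      then have "a \<in> set as" using lens by (metis imageE prod.collapse set_zip_leftD)
      then obtain i where i: "i < length as" "a = as ! i" by (auto simp: in_set_conv_nth)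
      obtain j where j: "j < length as" "\<sigma> j = i" using \<sigma>_surj[OF i(1)] by blast
      have nz: "a \<noteq> 0" "as' ! j \<noteq> 0"
        using genericD(1)[OF gen(1) i(1) i(1)] genericD(1)[OF gen(2), of j j] i j len by auto
      have "ahat (as' ! j) = ahat a" using eq[OF j(1)] j i by simp
      then have a: "as' ! j = a \<or> as' ! j = inverse a" using ahat_eq_iff[OF nz(2,1)] by simp
      have vj: "ev p (as' ! j) = 0 \<and> ev p (inverse (as' ! j)) = 0 \<and> ev q (as' ! j) = 0" using v j len by simp
      moreover have "ev q (inverse (as' ! j)) = 0" using ev_flip[of q "as' ! j"] q vj by simp
      ultimately show "ev p a = 0 \<and> ev p (inverse a) = 0 \<and> ev q a = 0" using a by auto
    qed
    then show "R.T p q = 0\<^sub>m (rho_dim ss) (rho_dim ss)" unfolding R.T_def by (simp add: rho_as_def)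
  qed
  then obtain ms where ms: "length ms = length as'" "\<And>m. m \<in> set ms \<Longrightarrow> m > 0"
    "equiv_rep (rho_dim ss) (rho_as as ss) (prod_list ms) (tensor_rep (zip as' ms))"
    using R.tensor_form[of as'] gen(2) unfolding generic_def by blast
  \<comment> \<open>Comparing nilpotency indices at \<open>as ! \<sigma> k\<close> finds a slot i
    with the right dimension; distinctness of the \<open>ahat\<close> values forces i = k.\<close>
  have "ms ! k = spin_dim (ss' ! k)" if k: "k < length as" for k
  proof -
    let ?j = "\<sigma> k"
    have j: "?j < length as" using \<sigma>_lt k by blast
    have sj: "pos_half_int (ss ! ?j)" using s(1) j lens by simp
    have "\<exists>i<length as'. (as' ! i = as ! ?j \<or> as' ! i = inverse (as ! ?j)) \<and> ms ! i = map spin_dim ss ! ?j"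
    proof (rule multiplicity_invariant[OF ms(3)[unfolded rho_as_def] _ _ _ _ gen])
      show "0 \<notin> set (map spin_dim ss)" using s pos_half_int_spin_dim by force
      show "0 \<notin> set ms" using ms(2) by force
      show "map spin_dim ss ! ?j \<ge> 2" using pos_half_int_spin_dim[OF sj] j lens by simp
    qed (use lens j ms in \<open>auto simp: rho_dim_def\<close>)
    then obtain i where i: "i < length as'" "as' ! i = as ! ?j \<or> as' ! i = inverse (as ! ?j)"
      "ms ! i = spin_dim (ss ! ?j)" using j lens by auto
    have "ahat (as' ! i) = ahat (as ! ?j)" using i(2) by (auto simp: ahat_def add.commute)
    then have "ahat (as' ! i) = ahat (as' ! k)" using eq[OF k] by simp
    then have "i = k" using dist' i(1) k len by metis
    then show ?thesis using i(3) eq[OF k] by simp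
  qed
  then have "ms = map spin_dim ss'" using ms(1) lens len by (intro nth_equalityI) auto
  then show ?E using ms(3) by (simp add: rho_dim_def rho_as_def)
qed

lemma admissible_of_ahat:
  assumes "length as \<ge> 1" "length ss = length as"
    "\<forall>j<length as. as ! j \<noteq> 0 \<and> ahat (as ! j) \<in> complex_of_real ` {-1<..<1}"
    "\<forall>j<length as. \<forall>k<length as. j \<noteq> k \<longrightarrow> ahat (as ! j) \<noteq> ahat (as ! k)"
    "\<forall>j<length ss. pos_half_int (ss ! j)"
  shows "admissible as ss"
proof -
  have "generic as" by (rule generic_of_ahat) (use assms(3,4) in blast)+
  then show ?thesis using assms(1,2,5) unfolding admissible_def by (auto simp: in_set_conv_nth)
qed

theorem theorem6:
  shows
  "(\<forall>d \<rho>. is_sl_rep d \<rho> \<and> irreducible_rep d \<rho> \<and> nonzero_rep d \<rho> \<longrightarrow>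
      (\<exists>as ss. length as \<ge> 1 \<and> length ss = length as \<and>
         (\<forall>j<length as. as ! j \<noteq> 0 \<and> as ! j \<noteq> 1 \<and> as ! j \<noteq> -1) \<and>
         (\<forall>j<length as. \<forall>k<length as. j \<noteq> k \<longrightarrow> as ! j \<noteq> as ! k \<and> as ! j \<noteq> inverse (as ! k)) \<and>
         (\<forall>j<length ss. pos_half_int (ss ! j)) \<and>
         equiv_rep d \<rho> (rho_dim ss) (rho_as as ss)))
 \<and> (\<forall>d \<rho>. is_sl_rep d \<rho> \<and> irreducible_rep d \<rho> \<and> nonzero_rep d \<rho> \<and> hermitian_rep d \<rho> \<longrightarrow>
      (\<exists>as ss. length as \<ge> 1 \<and> length ss = length as \<and>
         (\<forall>j<length as. as ! j \<noteq> 0 \<and> ahat (as ! j) \<in> complex_of_real ` {-1<..<1}) \<and>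
         (\<forall>j<length as. \<forall>k<length as. j \<noteq> k \<longrightarrow> ahat (as ! j) \<noteq> ahat (as ! k)) \<and>
         (\<forall>j<length ss. pos_half_int (ss ! j)) \<and>
         equiv_rep d \<rho> (rho_dim ss) (rho_as as ss)))
 \<and> (\<forall>as ss. length as \<ge> 1 \<and> length ss = length as \<and>
         (\<forall>j<length as. as ! j \<noteq> 0 \<and> ahat (as ! j) \<in> complex_of_real ` {-1<..<1}) \<and>
         (\<forall>j<length as. \<forall>k<length as. j \<noteq> k \<longrightarrow> ahat (as ! j) \<noteq> ahat (as ! k)) \<and>
         (\<forall>j<length ss. pos_half_int (ss ! j)) \<longrightarrow>
      is_sl_rep (rho_dim ss) (rho_as as ss) \<and> irreducible_rep (rho_dim ss) (rho_as as ss) \<and>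
      nonzero_rep (rho_dim ss) (rho_as as ss) \<and> hermitian_rep (rho_dim ss) (rho_as as ss))
 \<and> (\<forall>as ss as' ss'.
      length as \<ge> 1 \<and> length ss = length as \<and>
         (\<forall>j<length as. as ! j \<noteq> 0 \<and> ahat (as ! j) \<in> complex_of_real ` {-1<..<1}) \<and>
         (\<forall>j<length as. \<forall>k<length as. j \<noteq> k \<longrightarrow> ahat (as ! j) \<noteq> ahat (as ! k)) \<and>
         (\<forall>j<length ss. pos_half_int (ss ! j)) \<and>
      length as' \<ge> 1 \<and> length ss' = length as' \<and>
         (\<forall>j<length as'. as' ! j \<noteq> 0 \<and> ahat (as' ! j) \<in> complex_of_real ` {-1<..<1}) \<and>
         (\<forall>j<length as'. \<forall>k<length as'. j \<noteq> k \<longrightarrow> ahat (as' ! j) \<noteq> ahat (as' ! k)) \<and>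
         (\<forall>j<length ss'. pos_half_int (ss' ! j)) \<longrightarrow>
      (equiv_rep (rho_dim ss) (rho_as as ss) (rho_dim ss') (rho_as as' ss') \<longleftrightarrow>
        length as' = length as \<and>
        (\<exists>\<sigma>. bij_betw \<sigma> {..<length as} {..<length as} \<and>
           (\<forall>j<length as. ahat (as' ! j) = ahat (as ! \<sigma> j) \<and> ss' ! j = ss ! \<sigma> j))))"
proof (intro conjI, goal_cases)
  case 1
  show ?case
  proof (intro allI impI, goal_cases)
    case prems: (1 d \<rho>)
    interpret oa_irrep d \<rho> using prems by unfold_locales auto
    obtain as ms where c: "as \<noteq> []" "generic as" "length ms = length as" "\<And>m. m \<in> set ms \<Longrightarrow> m \<ge> 2"
      "equiv_rep d \<rho> (prod_list ms) (tensor_rep (zip as ms))"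
      using classification prems by metis
    obtain ss where ss: "length ss = length as" "\<And>s. s \<in> set ss \<Longrightarrow> pos_half_int s"
      "rho_dim ss = prod_list ms" "rho_as as ss = tensor_rep (zip as ms)"
      using tensor_rep_as_rho_as[OF c(3,4)] by blast
    have "as ! j \<noteq> 1" "as ! j \<noteq> - 1" if "j < length as" for j
      using genericD(2)[OF c(2) that that] by auto
    then show ?case
      using c(1,5) ss genericD[OF c(2)]
      by (intro exI[of _ as] exI[of _ ss]) (auto simp: Suc_le_eq)
  qed
next
  case 2
  show ?case
  proof (intro allI impI, goal_cases)
    case prems: (1 d \<rho>)
    interpret oa_irrep d \<rho> using prems by unfold_locales auto
    obtain ip where ip: "herm_inner d ip" "self_adjoint_wrt d ip (\<rho> (A_elt 0))" "self_adjoint_wrt d ip (\<rho> (A_elt 1))"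
      using prems unfolding hermitian_rep_def by blast
    interpret oa_hermitian d \<rho> ip using ip by unfold_locales
    obtain as ms where c: "as \<noteq> []" "generic as" "kills (set as)" "length ms = length as" "\<And>m. m \<in> set ms \<Longrightarrow> m \<ge> 2"
      "equiv_rep d \<rho> (prod_list ms) (tensor_rep (zip as ms))"
      using classification prems by metis
    obtain ss where ss: "length ss = length as" "\<And>s. s \<in> set ss \<Longrightarrow> pos_half_int s"
      "rho_dim ss = prod_list ms" "rho_as as ss = tensor_rep (zip as ms)"
      using tensor_rep_as_rho_as[OF c(4,5)] by blast
    have ahat: "ahat (as ! j) \<in> complex_of_real ` {-1<..<1}" if j: "j < length as" for j
      using support_on_unit_circle[OF c(2-6) j] genericD(1,2)[OF c(2) j j] by (intro unit_circle_ahat) auto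
    have dist: "ahat (as ! j) \<noteq> ahat (as ! k)" if "j < length as" "k < length as" "j \<noteq> k" for j k
      using genericD[OF c(2) that(1,2)] genericD(1)[OF c(2) that(2,1)] that(3) by (simp add: ahat_eq_iff)
    show ?case
      using c(1,6) ss genericD(1)[OF c(2)] ahat dist
      by (intro exI[of _ as] exI[of _ ss]) (auto simp: Suc_le_eq)
  qed
next
  case 3
  show ?case
  proof (intro allI impI, elim conjE, goal_cases)
    case prems: (1 as ss)
    have "cnj a = inverse a" if "a \<in> fst ` set (zip as (map spin_dim ss))" for a
    proof -
      have "a \<in> set as" using that by (metis imageE prod.collapse set_zip_leftD)
      then obtain i where "i < length as" "a = as ! i" by (auto simp: in_set_conv_nth)
      then show ?thesis using prems(3) by (intro ahat_unit_circle) auto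
    qed
    then have "hermitian_rep (rho_dim ss) (rho_as as ss)"
      unfolding rho_dim_zip[OF prems(2)] rho_as_def by (rule hermitian_tensor_rep)
    then show ?case using rho_as_rep[OF admissible_of_ahat[OF prems]] by blast
  qed
next
  case 4
  show ?case
  proof (intro allI impI, elim conjE, goal_cases)
    case prems: (1 as ss as' ss')
    show ?case
      by (rule equivalent_iff_permuted[OF admissible_of_ahat[OF prems(1-5)] admissible_of_ahat[OF prems(6-10)]])
        (use prems(4,9) in blast)+
  qed
qed

end
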